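(* Let $\kappa_2(\sigma)=\frac{2\sigma}{\sigma-1}$ for $1<\sigma<\infty$ and $\kappa_2(\infty)=2$. Consider the map $$\mathcal P:\ \sum_{\alpha\in\mathbf N^d}c_\alpha e_\alpha\ \mapsto\ \Big(z\mapsto\sum_{\alpha\in\mathbf N^d}c_\alpha\frac{z^\alpha}{\sqrt{\alpha!}}\Big)$$ from $\boldsymbol{\mathcal A}_0(\mathbf C^d)$ (finite sums) to $A(\mathbf C^d)$. Then the following is true: (1) $\mathcal P$ extends uniquely to a homeomorphism from $\boldsymbol{\mathcal A}_{\flat_1}'(\mathbf C^d)$ to $A(\mathbf C^d)$, and from $\boldsymbol{\mathcal A}_{0,\flat_1}'(\mathbf C^d)$ to $A_d\{0\}$; (2) if $\sigma\in(1,\infty)$, then $\mathcal P$ extends uniquely to a homeomorphism from $\boldsymbol{\mathcal A}_{\flat_\sigma}'(\mathbf C^d)$ to $$\{F\in A(\mathbf C^d)\,;\,|F(z)|\lesssim e^{r|z|^{\kappa_2(\sigma)}}\ \text{for every } r>0\};$$ (3) if $\sigma\in(1,\infty]$, then $\mathcal P$ extends uniquely to a homeomorphism from $\boldsymbol{\mathcal A}_{0,\flat_\sigma}'(\mathbf C^d)$ to $$\{F\in A(\mathbf C^d)\,;\,|F(z)|\lesssim e^{r|z|^{\kappa_2(\sigma)}}\ \text{for some } r>0\}.$$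
   Context: $A(\Omega)$ is the set of analytic functions on the open set $\Omega\subseteq\mathbf C^d$, and $A_d\{0\}$ is the set of all functions which are analytic near the origin in $\mathbf C^d$. $f\lesssim g$ means $f\le cg$ for some constant $c>0$; $e_\alpha(z)=z^\alpha/\sqrt{\alpha!}$, $\alpha\in\mathbf N^d$, $\mathbf N=\{0,1,2,\dots\}$. The $\flat_\sigma$ ($\sigma>0$) are formal symbols, and $\flat_\infty=\frac12$. For $r>0$ and $\alpha\in\mathbf N^d$ let $\vartheta_{r,s}(\alpha)=e^{r|\alpha|^{1/(2s)}}$ when $s>0$ is real, and $\vartheta_{r,\flat_\sigma}(\alpha)=r^{|\alpha|}(\alpha!)^{1/(2\sigma)}$ when $0<\sigma<\infty$. For $p\in(0,\infty]$ and a positive function $\vartheta$ on $\mathbf N^d$, $\ell^p_{[\vartheta]}(\mathbf N^d)$ is the quasi-Banach space of all complex sequences with $\|\{c_\alpha\vartheta(\alpha)\}\|_{\ell^p}<\infty$. Let $\ell_s'(\mathbf N^d)=\bigcap_{r>0}\ell^p_{[1/\vartheta_{r,s}]}(\mathbf N^d)$ with the projective limit topology and $\ell_{0,s}'(\mathbf N^d)=\bigcup_{r>0}\ell^p_{[1/\vartheta_{r,s}]}(\mathbf N^d)$ with the inductive limit topology (these do not depend on $p$). The spaces $\boldsymbol{\mathcal A}_s'(\mathbf C^d)$ and $\boldsymbol{\mathcal A}_{0,s}'(\mathbf C^d)$ consist of all formal power series $\sum_\alpha c_\alpha e_\alpha$ with $\{c_\alpha\}$ in $\ell_s'(\mathbf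 N^d)$ and $\ell_{0,s}'(\mathbf N^d)$, respectively, with topologies transported from the sequence spaces; $\boldsymbol{\mathcal A}_0(\mathbf C^d)$ consists of all such sums with only finitely many nonzero $c_\alpha$. Topologies: for $r_0\in(0,\infty)^d$ let $D_{r_0}(0)=\{z\,;\,|z_j|<r_{0,j},\ j=1,\dots,d\}$; $A(D_{r_0}(0))$ is a Fréchet space with seminorms $F=\sum c_\alpha e_\alpha\mapsto\sup_\alpha|c_\alpha r^\alpha/(\alpha!)^{1/2}|$, where $r_j<r_{0,j}$ for all $j$. $A(\mathbf C^d)$ and $A_d\{0\}$ carry the projective and inductive limit topology, respectively, of the spaces $A(D_r(0))$. For a family $\{\omega_r\}_{r>0}$ of positive weights on $\mathbf C^d$, the set of $F\in A(\mathbf C^d)$ with $|F|\lesssim\omega_r$ for some (for every) $r>0$ carries the inductive (projective) limit topology of the Banach spaces $\{F\in A(\mathbf C^d)\,;\,\sup_z|F(z)|/\omega_r(z)<\infty\}$. *)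

theory Defs
  imports "HOL-Analysis.Analysis"
begin

section \<open>Multi-indices and analytic functions of several variables\<close>

type_synonym 'd multiindex = "nat ^ 'd"

text \<open>A formal power series \<open>\<Sum>\<^sub>\<alpha> c\<^sub>\<alpha> e\<^sub>\<alpha>\<close> is represented by its coefficient family \<open>c\<close>.\<close>
type_synonym 'd formal_series = "'d multiindex \<Rightarrow> complex"

definition mlength :: "'d::finite multiindex \<Rightarrow> nat" where
  "mlength \<alpha> = (\<Sum>j\<in>UNIV. \<alpha> $ j)"

definition mfact :: "'d::finite multiindex \<Rightarrow> real" where
  "mfact \<alpha> = (\<Prod>j\<in>UNIV. fact (\<alpha> $ j))"

definition mpower :: "'a::comm_monoid_mult ^ 'd::finite \<Rightarrow> 'd multiindex \<Rightarrow> 'a" where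
  "mpower z \<alpha> = (\<Prod>j\<in>UNIV. (z $ j) ^ (\<alpha> $ j))"

definition basis_e :: "'d::finite multiindex \<Rightarrow> complex ^ 'd \<Rightarrow> complex" where
  "basis_e \<alpha> z = mpower z \<alpha> / complex_of_real (sqrt (mfact \<alpha>))"

definition mv_analytic_on :: "(complex ^ 'd::finite \<Rightarrow> complex) \<Rightarrow> (complex ^ 'd) set \<Rightarrow> bool" where
  "mv_analytic_on f \<Omega> \<longleftrightarrow>
    (\<forall>a\<in>\<Omega>. \<exists>c :: 'd formal_series.
      \<forall>\<^sub>F z in nhds a. ((\<lambda>\<alpha>. c \<alpha> * mpower (z - a) \<alpha>) has_sum f z) UNIV)"

text \<open>Functions on \<open>\<Omega>\<close> are represented by total functions vanishing outside \<open>\<Omega>\<close>, so that the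
  pointwise operations are the vector space operations of the represented space.\<close>
definition analytic_functions :: "(complex ^ 'd::finite) set \<Rightarrow> (complex ^ 'd \<Rightarrow> complex) set" where
  "analytic_functions \<Omega> = {f. mv_analytic_on f \<Omega> \<and> (\<forall>z. z \<notin> \<Omega> \<longrightarrow> f z = 0)}"

definition restrict0 :: "'a set \<Rightarrow> ('a \<Rightarrow> complex) \<Rightarrow> 'a \<Rightarrow> complex" where
  "restrict0 \<Omega> f = (\<lambda>z. if z \<in> \<Omega> then f z else 0)"

definition polydisc :: "real ^ 'd \<Rightarrow> (complex ^ 'd) set" where
  "polydisc r = {z. \<forall>j. norm (z $ j) < r $ j}"


section \<open>Germs at the origin\<close>

text \<open>``Functions analytic near the origin'' are identified when they agree near the origin.\<close>
quotient_type (overloaded) 'd germ = "complex ^ ('d::finite) \<Rightarrow> complex" /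
  "\<lambda>f g. \<forall>\<^sub>F z in nhds 0. f z = g z"
  morphisms rep_germ germ_of
proof (rule equivpI)
  show "reflp (\<lambda>f g :: complex ^ 'd \<Rightarrow> complex. \<forall>\<^sub>F z in nhds 0. f z = g z)"
    by (rule reflpI) simp
  show "symp (\<lambda>f g :: complex ^ 'd \<Rightarrow> complex. \<forall>\<^sub>F z in nhds 0. f z = g z)"
    by (rule sympI) (simp add: eq_commute)
  show "transp (\<lambda>f g :: complex ^ 'd \<Rightarrow> complex. \<forall>\<^sub>F z in nhds 0. f z = g z)"
    by (rule transpI) (auto elim: eventually_elim2)
qed

lift_definition germ_add :: "('d::finite) germ \<Rightarrow> 'd germ \<Rightarrow> 'd germ" is
  "\<lambda>f g z. f z + g z"
  by (auto elim: eventually_elim2)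

lift_definition germ_scale :: "complex \<Rightarrow> ('d::finite) germ \<Rightarrow> 'd germ" is
  "\<lambda>a f z. a * f z"
  by (auto elim: eventually_mono)

definition analytic_germs :: "('d::finite) germ set" where
  "analytic_germs = germ_of ` {f. \<exists>U. open U \<and> 0 \<in> U \<and> mv_analytic_on f U}"


section \<open>Topologies given by (quasi-, semi-)norms; projective and inductive limits\<close>

definition fun_add :: "('i \<Rightarrow> complex) \<Rightarrow> ('i \<Rightarrow> complex) \<Rightarrow> 'i \<Rightarrow> complex" where
  "fun_add f g = (\<lambda>x. f x + g x)"

definition fun_scale :: "complex \<Rightarrow> ('i \<Rightarrow> complex) \<Rightarrow> 'i \<Rightarrow> complex" where
  "fun_scale a f = (\<lambda>x. a * f x)"

text \<open>Openness is defined through neighbourhoods because a ball of a quasi-norm need not be open.\<close>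
definition seminorms_topology ::
    "('i \<Rightarrow> complex) set \<Rightarrow> (('i \<Rightarrow> complex) \<Rightarrow> real) set \<Rightarrow> ('i \<Rightarrow> complex) topology" where
  "seminorms_topology E Q = topology (\<lambda>U. U \<subseteq> E \<and>
     (\<forall>f\<in>U. \<exists>F \<epsilon>. finite F \<and> F \<subseteq> Q \<and> \<epsilon> > 0 \<and>
        (\<forall>g\<in>E. (\<forall>q\<in>F. q (\<lambda>x. g x - f x) < \<epsilon>) \<longrightarrow> g \<in> U)))"

lemma openin_seminorms_topology:
  "openin (seminorms_topology E Q) U \<longleftrightarrow> U \<subseteq> E \<and>
     (\<forall>f\<in>U. \<exists>F \<epsilon>. finite F \<and> F \<subseteq> Q \<and> \<epsilon> > 0 \<and>
        (\<forall>g\<in>E. (\<forall>q\<in>F. q (\<lambda>x. g x - f x) < \<epsilon>) \<longrightarrow> g \<in> U))"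
proof -
  let ?P = "\<lambda>f U F \<epsilon>. finite F \<and> F \<subseteq> Q \<and> (\<epsilon>::real) > 0 \<and>
        (\<forall>g\<in>E. (\<forall>q\<in>F. q (\<lambda>x. g x - f x) < \<epsilon>) \<longrightarrow> g \<in> U)"
  have inter: "\<exists>F \<epsilon>. ?P f (S \<inter> T) F \<epsilon>"
    if S: "\<exists>F \<epsilon>. ?P f S F \<epsilon>" and T: "\<exists>F \<epsilon>. ?P f T F \<epsilon>" for f S T
  proof -
    obtain F \<epsilon> where 1: "?P f S F \<epsilon>" using S by blast
    obtain G \<delta> where 2: "?P f T G \<delta>" using T by blast
    have "?P f (S \<inter> T) (F \<union> G) (min \<epsilon> \<delta>)" using 1 2 by auto
    then show ?thesis by blast
  qed
  have union: "\<exists>F \<epsilon>. ?P f (\<Union>K) F \<epsilon>" if S: "S \<in> K" and P: "\<exists>F \<epsilon>. ?P f S F \<epsilon>" for f S K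
  proof -
    obtain F \<epsilon> where "?P f S F \<epsilon>" using P by blast
    then have "?P f (\<Union>K) F \<epsilon>" using S by auto
    then show ?thesis by blast
  qed
  have "istopology (\<lambda>U. U \<subseteq> E \<and> (\<forall>f\<in>U. \<exists>F \<epsilon>. ?P f U F \<epsilon>))"
    unfolding istopology_def
  proof (intro conjI allI impI ballI)
    fix S T f
    assume "S \<subseteq> E \<and> (\<forall>f\<in>S. \<exists>F \<epsilon>. ?P f S F \<epsilon>)" "T \<subseteq> E \<and> (\<forall>f\<in>T. \<exists>F \<epsilon>. ?P f T F \<epsilon>)" "f \<in> S \<inter> T"
    then show "\<exists>F \<epsilon>. ?P f (S \<inter> T) F \<epsilon>" by (intro inter) blast+
  next
    fix K f
    assume K: "\<forall>S\<in>K. S \<subseteq> E \<and> (\<forall>f\<in>S. \<exists>F \<epsilon>. ?P f S F \<epsilon>)" and "f \<in> \<Union>K"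
    then obtain S where "S \<in> K" "f \<in> S" by blast
    then show "\<exists>F \<epsilon>. ?P f (\<Union>K) F \<epsilon>" using K by (intro union[of S]) blast+
  qed blast+
  then show ?thesis unfolding seminorms_topology_def by (simp add: topology_inverse')
qed

lemma topspace_seminorms_topology [simp]: "topspace (seminorms_topology E Q) = E"
proof -
  have "openin (seminorms_topology E Q) E"
    unfolding openin_seminorms_topology by (auto intro!: exI[of _ "{}"] exI[of _ 1])
  moreover have "topspace (seminorms_topology E Q) \<subseteq> E"
    using openin_topspace[of "seminorms_topology E Q"] unfolding openin_seminorms_topology by blast
  ultimately show ?thesis by (metis openin_subset subset_antisym)
qed

text \<open>The coarsest topology on \<open>E\<close> making all \<open>\<pi> i\<close> continuous.\<close>
definition projective_limit_topology ::
    "'a set \<Rightarrow> 'i set \<Rightarrow> ('i \<Rightarrow> 'b topology) \<Rightarrow> ('i \<Rightarrow> 'a \<Rightarrow> 'b) \<Rightarrow> 'a topology" where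
  "projective_limit_topology E I X \<pi> =
    topology_generated_by (insert E {E \<inter> \<pi> i -` U |i U. i \<in> I \<and> openin (X i) U})"

lemma topspace_projective_limit_topology [simp]:
  "topspace (projective_limit_topology E I X \<pi>) = E"
  unfolding projective_limit_topology_def topology_generated_by_topspace by auto

definition locally_convex_topology ::
    "('a \<Rightarrow> 'a \<Rightarrow> 'a) \<Rightarrow> (complex \<Rightarrow> 'a \<Rightarrow> 'a) \<Rightarrow> 'a topology \<Rightarrow> bool" where
  "locally_convex_topology add scl T \<longleftrightarrow>
     continuous_map (prod_topology T T) T (\<lambda>(x, y). add x y) \<and>
     continuous_map (prod_topology euclidean T) T (\<lambda>(a, x). scl a x) \<and>
     (\<forall>U x. openin T U \<and> x \<in> U \<longrightarrow>
        (\<exists>V C. openin T V \<and> x \<in> V \<and> V \<subseteq> C \<and> C \<subseteq> U \<and>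
           (\<forall>y\<in>C. \<forall>z\<in>C. \<forall>t::real. 0 \<le> t \<and> t \<le> 1 \<longrightarrow>
              add (scl (of_real t) y) (scl (of_real (1 - t)) z) \<in> C)))"

text \<open>The finest locally convex topology on \<open>E\<close> making all \<open>\<iota> i\<close> continuous, obtained as the
  supremum of all locally convex topologies with this property.\<close>
definition inductive_limit_topology ::
    "('a \<Rightarrow> 'a \<Rightarrow> 'a) \<Rightarrow> (complex \<Rightarrow> 'a \<Rightarrow> 'a) \<Rightarrow>
     'a set \<Rightarrow> 'i set \<Rightarrow> ('i \<Rightarrow> 'b topology) \<Rightarrow> ('i \<Rightarrow> 'b \<Rightarrow> 'a) \<Rightarrow> 'a topology" where
  "inductive_limit_topology add scl E I X \<iota> =
    topology_generated_by (insert E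
      {U. \<exists>T. topspace T = E \<and> locally_convex_topology add scl T \<and>
              (\<forall>i\<in>I. continuous_map (X i) T (\<iota> i)) \<and> openin T U})"

lemma topspace_inductive_limit_topology [simp]:
  "topspace (inductive_limit_topology add scl E I X \<iota>) = E"
  unfolding inductive_limit_topology_def topology_generated_by_topspace
  by (auto dest: openin_subset)


section \<open>Weighted sequence spaces and spaces of formal power series\<close>

text \<open>The index \<open>s\<close> is a positive real number or one of the formal symbols \<open>\<flat>\<^sub>\<sigma>\<close>, \<open>0 < \<sigma> < \<infinity>\<close>;
  \<open>\<flat>\<^sub>\<infinity>\<close> is the real number \<open>1/2\<close>.\<close>
datatype weight_index = Real_Index real | Flat_Index real

definition flat :: "ereal \<Rightarrow> weight_index" where
  "flat \<sigma> = (if \<sigma> = \<infinity> then Real_Index (1/2) else Flat_Index (real_of_ereal \<sigma>))"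

fun weight_theta :: "real \<Rightarrow> weight_index \<Rightarrow> 'd::finite multiindex \<Rightarrow> real" where
  "weight_theta r (Real_Index s) \<alpha> = exp (r * real (mlength \<alpha>) powr (1 / (2 * s)))"
| "weight_theta r (Flat_Index \<sigma>) \<alpha> = r ^ mlength \<alpha> * mfact \<alpha> powr (1 / (2 * \<sigma>))"

definition in_lp :: "ereal \<Rightarrow> ('i \<Rightarrow> complex) \<Rightarrow> bool" where
  "in_lp p a \<longleftrightarrow>
    (if p = \<infinity> then bdd_above (range (\<lambda>i. norm (a i)))
     else (\<lambda>i. norm (a i) powr real_of_ereal p) summable_on UNIV)"

definition lp_norm :: "ereal \<Rightarrow> ('i \<Rightarrow> complex) \<Rightarrow> real" where
  "lp_norm p a =
    (if p = \<infinity> then (SUP i. norm (a i))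
     else (\<Sum>\<^sub>\<infinity>i. norm (a i) powr real_of_ereal p) powr (1 / real_of_ereal p))"

definition weighted_lp :: "ereal \<Rightarrow> ('i \<Rightarrow> real) \<Rightarrow> ('i \<Rightarrow> complex) set" where
  "weighted_lp p \<omega> = {c. in_lp p (\<lambda>i. c i * of_real (\<omega> i))}"

definition weighted_lp_topology :: "ereal \<Rightarrow> ('i \<Rightarrow> real) \<Rightarrow> ('i \<Rightarrow> complex) topology" where
  "weighted_lp_topology p \<omega> =
    seminorms_topology (weighted_lp p \<omega>) {\<lambda>c. lp_norm p (\<lambda>i. c i * of_real (\<omega> i))}"

text \<open>\<open>A_dual p s\<close> and \<open>A0_dual p s\<close> are the spaces \<open>\<A>'\<^sub>s\<close> and \<open>\<A>'\<^sub>0\<^sub>,\<^sub>s\<close>, defined by means of the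
  exponent \<open>p\<close>, with their topologies.\<close>
definition A_dual :: "ereal \<Rightarrow> weight_index \<Rightarrow> ('d::finite) formal_series topology" where
  "A_dual p s = projective_limit_topology
     (\<Inter>r\<in>{0<..}. weighted_lp p (\<lambda>\<alpha>. 1 / weight_theta r s \<alpha>)) {0<..}
     (\<lambda>r. weighted_lp_topology p (\<lambda>\<alpha>. 1 / weight_theta r s \<alpha>)) (\<lambda>r c. c)"

definition A0_dual :: "ereal \<Rightarrow> weight_index \<Rightarrow> ('d::finite) formal_series topology" where
  "A0_dual p s = inductive_limit_topology fun_add fun_scale
     (\<Union>r\<in>{0<..}. weighted_lp p (\<lambda>\<alpha>. 1 / weight_theta r s \<alpha>)) {0<..}
     (\<lambda>r. weighted_lp_topology p (\<lambda>\<alpha>. 1 / weight_theta r s \<alpha>)) (\<lambda>r c. c)"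

definition finite_series :: "('d::finite) formal_series set" where
  "finite_series = {c. finite {\<alpha>. c \<alpha> \<noteq> 0}}"

definition series_map :: "('d::finite) formal_series \<Rightarrow> complex ^ 'd \<Rightarrow> complex" where
  "series_map c = (\<lambda>z. \<Sum>\<alpha> | c \<alpha> \<noteq> 0. c \<alpha> * basis_e \<alpha> z)"


section \<open>Topologies on spaces of analytic functions\<close>

definition expansion_coeffs ::
    "(complex ^ 'd::finite) set \<Rightarrow> (complex ^ 'd \<Rightarrow> complex) \<Rightarrow> 'd formal_series" where
  "expansion_coeffs D f = (THE c. \<forall>z\<in>D. ((\<lambda>\<alpha>. c \<alpha> * basis_e \<alpha> z) has_sum f z) UNIV)"

definition polydisc_topology :: "real ^ 'd::finite \<Rightarrow> (complex ^ 'd \<Rightarrow> complex) topology" where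
  "polydisc_topology r0 = seminorms_topology (analytic_functions (polydisc r0))
     {\<lambda>f. SUP \<alpha>. norm (expansion_coeffs (polydisc r0) f \<alpha> *
             of_real (mpower r \<alpha> / sqrt (mfact \<alpha>)))
      |r. \<forall>j. 0 < r $ j \<and> r $ j < r0 $ j}"

definition entire_topology :: "(complex ^ 'd::finite \<Rightarrow> complex) topology" where
  "entire_topology = projective_limit_topology (analytic_functions UNIV)
     {r. \<forall>j. 0 < r $ j} polydisc_topology (\<lambda>r. restrict0 (polydisc r))"

definition analytic_germs_topology :: "('d::finite) germ topology" where
  "analytic_germs_topology = inductive_limit_topology germ_add germ_scale analytic_germs
     {r. \<forall>j. 0 < r $ j} polydisc_topology (\<lambda>r. germ_of)"

definition weighted_entire ::
    "(complex ^ 'd::finite \<Rightarrow> real) \<Rightarrow> (complex ^ 'd \<Rightarrow> complex) set" where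
  "weighted_entire \<omega> =
    {F \<in> analytic_functions UNIV. \<exists>c>0. \<forall>z. norm (F z) \<le> c * \<omega> z}"

definition weighted_entire_topology ::
    "(complex ^ 'd::finite \<Rightarrow> real) \<Rightarrow> (complex ^ 'd \<Rightarrow> complex) topology" where
  "weighted_entire_topology \<omega> =
    seminorms_topology (weighted_entire \<omega>) {\<lambda>F. SUP z. norm (F z) / \<omega> z}"

definition weighted_entire_every ::
    "(real \<Rightarrow> complex ^ 'd::finite \<Rightarrow> real) \<Rightarrow> (complex ^ 'd \<Rightarrow> complex) topology" where
  "weighted_entire_every \<omega> = projective_limit_topology
     {F \<in> analytic_functions UNIV. \<forall>r>0. \<exists>c>0. \<forall>z. norm (F z) \<le> c * \<omega> r z} {0<..}
     (\<lambda>r. weighted_entire_topology (\<omega> r)) (\<lambda>r F. F)"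

definition weighted_entire_some ::
    "(real \<Rightarrow> complex ^ 'd::finite \<Rightarrow> real) \<Rightarrow> (complex ^ 'd \<Rightarrow> complex) topology" where
  "weighted_entire_some \<omega> = inductive_limit_topology fun_add fun_scale
     {F \<in> analytic_functions UNIV. \<exists>r>0. \<exists>c>0. \<forall>z. norm (F z) \<le> c * \<omega> r z} {0<..}
     (\<lambda>r. weighted_entire_topology (\<omega> r)) (\<lambda>r F. F)"

definition kappa2 :: "ereal \<Rightarrow> real" where
  "kappa2 \<sigma> = (if \<sigma> = \<infinity> then 2 else 2 * real_of_ereal \<sigma> / (real_of_ereal \<sigma> - 1))"


section \<open>Unique extension to a homeomorphism\<close>

definition extends_uniquely_to_homeomorphism ::
    "('a \<Rightarrow> 'b) \<Rightarrow> 'a set \<Rightarrow> 'a topology \<Rightarrow> 'b topology \<Rightarrow> bool" where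
  "extends_uniquely_to_homeomorphism f D X Y \<longleftrightarrow> D \<subseteq> topspace X \<and>
     (\<exists>g. homeomorphic_map X Y g \<and> (\<forall>x\<in>D. g x = f x) \<and>
        (\<forall>h. homeomorphic_map X Y h \<and> (\<forall>x\<in>D. h x = f x) \<longrightarrow> (\<forall>x\<in>topspace X. h x = g x)))"

end

theory Submission
  imports Defs "HOL-Complex_Analysis.Cauchy_Integral_Formula"
begin

text \<open>
  The extension of \<open>series_map\<close> is the map \<open>formal_sum\<close> that sends a coefficient family to the
  sum of its series, and its inverse takes Taylor coefficients at the origin.  Only two analytic
  facts enter: the size of the coefficients controls the growth of the function, and conversely.

  For the index \<open>\<flat>\<^sub>1\<close> the weight condition on \<open>c\<^sub>\<alpha> / \<surd>(\<alpha>!)\<close> is a geometric bound, that is,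
  convergence on a polydisc.  The converse needs that a function which has a power series near
  every point of a polydisc has one power series there (\<open>polydisc_expansion\<close>), together with
  Cauchy's inequalities (\<open>expansion_coeff_bound\<close>).  Instead of iterated contour integrals the proof
  uses the one-variable theory on complex lines through the origin.  It bounds the homogeneous
  parts of the series; these are polynomials, and averaging a polynomial over roots of unity
  extracts a single coefficient (\<open>polynomial_coeff_le\<close>).

  For \<open>\<flat>\<^sub>\<sigma>\<close> with \<open>\<sigma> > 1\<close> one has \<open>1/(2\<sigma>) - 1/2 = -1/\<kappa>\<close> with \<open>\<kappa> = \<kappa>\<^sub>2(\<sigma>)\<close>.  So the coefficients
  behave like \<open>B\<^sup>\<bar>\<^sup>\<alpha>\<^sup>\<bar> (\<alpha>!)\<^sup>-\<^sup>1\<^sup>/\<^sup>\<kappa>\<close> times \<open>\<surd>(\<alpha>!)\<close>, which corresponds to growth \<open>exp (r \<bar>z\<bar>\<^sup>\<kappa>)\<close>: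
  in one direction (\<open>growth_has_expansion\<close>) because \<open>x\<^sup>n / n! \<le> exp x\<close>, in the other
  (\<open>coeff_growth_of_exp_bound\<close>) by Cauchy's inequalities with well chosen radii.

  All these estimates bound linear maps between single steps of the projective or inductive
  systems, with some loss in the parameter \<open>r\<close>.  The loss is harmless in the limits, and it also
  makes the exponent \<open>p\<close> irrelevant, because weights with different parameters differ by a
  geometric factor, which is summable.  The lemmas \<open>homeomorphic_map_projective_limits\<close> and
  \<open>homeomorphic_map_inductive_limits\<close> turn such a zigzag of bounded maps into a homeomorphism of
  the limits.  Uniqueness is a property of the coefficient spaces alone: they are Hausdorff,
  since the coefficients are continuous functionals, and finite series are dense, since
  truncations converge.
\<close>

section \<open>Monomials and sums over multi-indices\<close>

lemma mpower_scale: "mpower (t *s z) \<alpha> = t ^ mlength \<alpha> * mpower z \<alpha>"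
  for t :: "'a::comm_semiring_1"
  by (simp add: mpower_def mlength_def power_mult_distrib prod.distrib power_sum)

lemma mpower_const: "mpower (\<chi> j. t) \<alpha> = (t::'a::comm_semiring_1) ^ mlength \<alpha>"
  by (simp add: mpower_def mlength_def power_sum)

lemma norm_mpower: "norm (mpower z \<alpha>) = mpower (\<chi> j. norm (z $ j)) \<alpha>"
  for z :: "complex ^ 'd::finite"
  by (simp add: mpower_def prod_norm [symmetric] norm_power)

lemma mpower_mono:
  fixes x y :: "real ^ 'd::finite"
  assumes "\<And>j. 0 \<le> x $ j" "\<And>j. x $ j \<le> y $ j"
  shows "mpower x \<alpha> \<le> mpower y \<alpha>"
  unfolding mpower_def using assms by (intro prod_mono) (auto intro: power_mono)

lemma mpower_nonneg: "(\<And>j. 0 \<le> x $ j) \<Longrightarrow> 0 \<le> mpower x \<alpha>" for x :: "real ^ 'd::finite"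
  by (simp add: mpower_def prod_nonneg)

lemma mpower_pos: "(\<And>j. 0 < x $ j) \<Longrightarrow> 0 < mpower x \<alpha>" for x :: "real ^ 'd::finite"
  by (simp add: mpower_def prod_pos)

lemma norm_mpower_le:
  fixes z :: "complex ^ 'd::finite"
  assumes "\<And>j. norm (z $ j) \<le> x $ j"
  shows "norm (mpower z \<alpha>) \<le> mpower x \<alpha>"
  unfolding norm_mpower by (rule mpower_mono) (use assms in auto)

lemma mfact_pos [simp]: "0 < mfact \<alpha>"
  by (simp add: mfact_def prod_pos)

lemma mfact_nonzero [simp]: "mfact \<alpha> \<noteq> 0"
  using mfact_pos [of \<alpha>] by linarith

text \<open>A sum over a box of multi-indices of a product of one-variable terms factorises.  This
  yields the geometric series, the binomial formula and the orthogonality of characters in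
  several variables from their one-variable counterparts.\<close>

lemma sum_box_prod:
  fixes f :: "'d::finite \<Rightarrow> nat \<Rightarrow> 'a::comm_semiring_1"
  assumes "\<And>j. finite (B j)"
  shows "(\<Sum>\<beta> | \<forall>j. \<beta> $ j \<in> B j. \<Prod>j\<in>UNIV. f j (\<beta> $ j)) = (\<Prod>j\<in>UNIV. \<Sum>k\<in>B j. f j k)"
proof -
  have "(\<Prod>j\<in>UNIV. \<Sum>k\<in>B j. f j k) = (\<Sum>g\<in>PiE UNIV B. \<Prod>j\<in>UNIV. f j (g j))"
    by (rule prod_sum_PiE) (use assms in auto)
  also have "\<dots> = (\<Sum>\<beta> | \<forall>j. \<beta> $ j \<in> B j. \<Prod>j\<in>UNIV. f j (\<beta> $ j))"
    by (rule sum.reindex_bij_witness [where i = "\<lambda>\<beta> j. \<beta> $ j" and j = "\<lambda>g. vec_lambda g"]) auto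
  finally show ?thesis ..
qed

lemma finite_box:
  assumes "\<And>j. finite (B j)"
  shows "finite {\<beta> :: 'd::finite multiindex. \<forall>j. \<beta> $ j \<in> B j}"
proof -
  have "{\<beta> :: 'd multiindex. \<forall>j. \<beta> $ j \<in> B j} = vec_lambda ` PiE UNIV B"
    by (auto intro!: image_eqI [where x = "vec_nth _"] simp: vec_lambda_eta)
  then show ?thesis by (simp add: finite_PiE assms)
qed

lemma component_le_mlength: "\<alpha> $ j \<le> mlength \<alpha>"
  unfolding mlength_def by (rule member_le_sum) auto

lemma finite_mlength_le: "finite {\<alpha> :: 'd::finite multiindex. mlength \<alpha> \<le> n}"
  by (rule finite_subset [OF _ finite_box [of "\<lambda>_. {..n}"]])
     (auto intro: order_trans [OF component_le_mlength])

lemma finite_mlength_eq: "finite {\<alpha> :: 'd::finite multiindex. mlength \<alpha> = n}"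
  by (rule finite_subset [OF _ finite_mlength_le [of n]]) auto

lemma finite_set_in_box:
  assumes "finite (A :: 'd::finite multiindex set)"
  obtains n where "\<And>\<alpha> j. \<alpha> \<in> A \<Longrightarrow> \<alpha> $ j < n"
proof
  fix \<alpha> j assume "\<alpha> \<in> A"
  then have "mlength \<alpha> \<le> Max (mlength ` A)" using assms by auto
  then show "\<alpha> $ j < Suc (Max (mlength ` A))" using component_le_mlength [of \<alpha> j] by linarith
qed

lemma geometric_summable_on:
  fixes s :: real
  assumes "0 \<le> s" "s < 1"
  shows "(\<lambda>\<alpha> :: 'd::finite multiindex. s ^ mlength \<alpha>) summable_on UNIV"
proof (rule nonneg_bdd_above_summable_on)
  show "bdd_above (sum (\<lambda>\<alpha> :: 'd multiindex. s ^ mlength \<alpha>) ` {F. F \<subseteq> UNIV \<and> finite F})"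
  proof (rule bdd_aboveI2)
    fix F :: "'d multiindex set" assume "F \<in> {F. F \<subseteq> UNIV \<and> finite F}"
    then have "finite F" by simp
    then obtain n where n: "\<And>\<alpha> j. \<alpha> \<in> F \<Longrightarrow> \<alpha> $ j < n" by (rule finite_set_in_box) blast
    have "(\<Sum>\<alpha>\<in>F. s ^ mlength \<alpha>) \<le> (\<Sum>\<alpha> | \<forall>j::'d. \<alpha> $ j \<in> {..<n}. s ^ mlength \<alpha>)"
    proof (rule sum_mono2)
      show "finite {\<alpha> :: 'd multiindex. \<forall>j. \<alpha> $ j \<in> {..<n}}" by (rule finite_box) simp
    qed (use n assms in auto)
    also have "\<dots> = (\<Sum>\<alpha> | \<forall>j::'d. \<alpha> $ j \<in> {..<n}. \<Prod>j\<in>UNIV. s ^ (\<alpha> $ j))"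
      by (simp add: mlength_def power_sum)
    also have "\<dots> = (\<Prod>j\<in>(UNIV :: 'd set). \<Sum>k\<in>{..<n}. s ^ k)"
      by (rule sum_box_prod) simp
    also have "\<dots> \<le> (\<Prod>j\<in>(UNIV :: 'd set). 1 / (1 - s))"
    proof (rule prod_mono, safe)
      show "0 \<le> (\<Sum>k<n. s ^ k)" by (simp add: sum_nonneg assms)
      have "(\<Sum>k<n. s ^ k) \<le> (\<Sum>k. s ^ k)"
        by (rule sum_le_suminf) (use assms in \<open>auto intro: summable_geometric\<close>)
      then show "(\<Sum>k<n. s ^ k) \<le> 1 / (1 - s)" using assms by (simp add: suminf_geometric)
    qed
    finally show "(\<Sum>\<alpha>\<in>F. s ^ mlength \<alpha>) \<le> (\<Prod>j\<in>(UNIV :: 'd set). 1 / (1 - s))" .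
  qed
qed (use assms in auto)

lemma abs_summable_geometric:
  fixes a :: "'d::finite multiindex \<Rightarrow> 'a::banach"
  assumes "0 \<le> s" "s < 1" and le: "\<And>\<alpha>. norm (a \<alpha>) \<le> M * s ^ mlength \<alpha>"
  shows "(\<lambda>\<alpha>. norm (a \<alpha>)) summable_on UNIV"
  by (rule summable_on_comparison_test [where f = "\<lambda>\<alpha>. M * s ^ mlength \<alpha>"])
     (use le assms in \<open>auto intro: summable_on_cmult_right geometric_summable_on\<close>)


section \<open>Coefficients of polynomials\<close>

lemma sum_character:
  fixes m n :: nat
  assumes "m < N" "n < N"
  shows "(\<Sum>k<N. exp (2 * of_real pi * \<i> * of_nat (m + (N - n)) / of_nat N) ^ k) =
         (if m = n then of_nat N else 0)"
proof -
  define x where "x = exp (2 * of_real pi * \<i> * of_nat (m + (N - n)) / of_nat N)"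
  have N: "1 \<le> N" using assms by linarith
  have x1: "x = 1 \<longleftrightarrow> N dvd m + (N - n)" unfolding x_def by (rule complex_root_unity_eq_1 [OF N])
  have "N dvd m + (N - n) \<longleftrightarrow> m = n"
  proof
    assume "N dvd m + (N - n)"
    then obtain q where q: "m + (N - n) = N * q" ..
    have "0 < N * q" "N * q < N * 2" using q assms by linarith+
    then have "q = 1" using assms by auto
    then show "m = n" using q assms by simp
  qed (use assms in auto)
  then have eq: "x = 1 \<longleftrightarrow> m = n" using x1 by simp
  have "x ^ N = exp (of_nat N * (2 * of_real pi * \<i> * of_nat (m + (N - n)) / of_nat N))"
    unfolding x_def by (rule exp_of_nat_mult [symmetric])
  also have "\<dots> = exp (2 * of_real pi * \<i> * of_nat (m + (N - n)) / of_nat 1)" using N by simp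
  also have "\<dots> = 1" using complex_root_unity_eq_1 [of 1 "m + (N - n)"] by simp
  finally have "x ^ N = 1" .
  then show ?thesis using eq unfolding x_def [symmetric]
    by (auto simp: geometric_sum)
qed

text \<open>Averaging a polynomial, multiplied by a character, over the points of a torus whose angles
  are \<open>N\<close>-th roots of unity isolates a single coefficient, as soon as \<open>N\<close> exceeds all degrees.
  This replaces Cauchy's integral formula over the torus.\<close>

lemma polynomial_coeff_le:
  fixes a :: "'d::finite multiindex \<Rightarrow> complex" and \<rho> :: "real ^ 'd"
  assumes fin: "finite A" and \<alpha>0: "\<alpha>0 \<in> A" and \<rho>: "\<And>j. 0 \<le> \<rho> $ j"
    and bound: "\<And>z. (\<And>j. norm (z $ j) = \<rho> $ j) \<Longrightarrow> norm (\<Sum>\<alpha>\<in>A. a \<alpha> * mpower z \<alpha>) \<le> M"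
  shows "norm (a \<alpha>0) * mpower \<rho> \<alpha>0 \<le> M"
proof -
  obtain N where N: "\<And>\<alpha> j. \<alpha> \<in> A \<Longrightarrow> \<alpha> $ j < N" using finite_set_in_box [OF fin] by blast
  have N0: "0 < N" using N [OF \<alpha>0] by (metis gr_implies_not0 gr0I)
  define \<omega> where "\<omega> m = exp (2 * of_real pi * \<i> * of_nat m / of_nat N)" for m
  have \<omega>_add: "\<omega> (m + n) = \<omega> m * \<omega> n" for m n
    by (simp add: \<omega>_def exp_add [symmetric] add_divide_distrib distrib_left)
  have \<omega>_mult: "\<omega> (m * n) = \<omega> m ^ n" for m n
  proof -
    have "\<omega> m ^ n = exp (of_nat n * (2 * of_real pi * \<i> * of_nat m / of_nat N))"
      unfolding \<omega>_def by (rule exp_of_nat_mult [symmetric])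
    then show ?thesis by (simp add: \<omega>_def mult_ac)
  qed
  have \<omega>_norm: "norm (\<omega> m) = 1" for m
    by (simp add: \<omega>_def norm_exp_eq_Re)
  define K where "K = {k :: 'd multiindex. \<forall>j. k $ j \<in> {..<N}}"
  define w where "w k = (\<chi> j. of_real (\<rho> $ j) * \<omega> (k $ j))" for k :: "'d multiindex"
  define \<chi>0 where "\<chi>0 k = (\<Prod>j\<in>UNIV. \<omega> (k $ j * (N - \<alpha>0 $ j)))" for k :: "'d multiindex"
  have finK: "finite K" unfolding K_def by (rule finite_box) simp
  have cardK: "card K = N ^ CARD('d)"
  proof -
    have "of_nat (card K) = (\<Sum>k\<in>K. \<Prod>j\<in>(UNIV::'d set). (1::nat))" by simp
    also have "\<dots> = (\<Prod>j\<in>(UNIV :: 'd set). \<Sum>k\<in>{..<N}. 1)" unfolding K_def by (rule sum_box_prod) simp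
    finally show ?thesis by simp
  qed
  have orth: "(\<Sum>k\<in>K. \<chi>0 k * mpower (w k) \<alpha>) =
      (if \<alpha> = \<alpha>0 then of_real (mpower \<rho> \<alpha>0) * of_nat (N ^ CARD('d)) else 0)"
    if "\<alpha> \<in> A" for \<alpha>
  proof -
    have "(\<Sum>k\<in>K. \<chi>0 k * mpower (w k) \<alpha>) =
        (\<Sum>k\<in>K. of_real (mpower \<rho> \<alpha>) * (\<Prod>j\<in>UNIV. \<omega> (\<alpha> $ j + (N - \<alpha>0 $ j)) ^ (k $ j)))"
      by (rule sum.cong)
        (simp_all add: \<chi>0_def w_def mpower_def prod.distrib [symmetric] power_mult_distrib
          \<omega>_mult [symmetric] \<omega>_add [symmetric] algebra_simps)
    also have "\<dots> = of_real (mpower \<rho> \<alpha>) *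
        (\<Sum>k\<in>K. \<Prod>j\<in>UNIV. \<omega> (\<alpha> $ j + (N - \<alpha>0 $ j)) ^ (k $ j))"
      by (simp add: sum_distrib_left)
    also have "(\<Sum>k\<in>K. \<Prod>j\<in>UNIV. \<omega> (\<alpha> $ j + (N - \<alpha>0 $ j)) ^ (k $ j)) =
        (\<Prod>j\<in>UNIV. \<Sum>k\<in>{..<N}. \<omega> (\<alpha> $ j + (N - \<alpha>0 $ j)) ^ k)"
      unfolding K_def by (rule sum_box_prod) simp
    also have "\<dots> = (\<Prod>j\<in>UNIV. if \<alpha> $ j = \<alpha>0 $ j then of_nat N else 0)"
      unfolding \<omega>_def
      by (rule prod.cong) (simp_all only: sum_character [OF N [OF that] N [OF \<alpha>0]])
    also have "\<dots> = (if \<alpha> = \<alpha>0 then of_nat (N ^ CARD('d)) else 0)"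
      by (auto simp: vec_eq_iff)
    finally show ?thesis by simp
  qed
  have "(\<Sum>k\<in>K. \<chi>0 k * (\<Sum>\<alpha>\<in>A. a \<alpha> * mpower (w k) \<alpha>)) =
      (\<Sum>\<alpha>\<in>A. a \<alpha> * (\<Sum>k\<in>K. \<chi>0 k * mpower (w k) \<alpha>))"
    by (simp add: sum_distrib_left sum.swap [of _ A K] mult_ac)
  also have "\<dots> = a \<alpha>0 * (of_real (mpower \<rho> \<alpha>0) * of_nat (N ^ CARD('d)))"
    using fin \<alpha>0 by (simp add: orth if_distrib cong: if_cong)
  finally have avg: "a \<alpha>0 * (of_real (mpower \<rho> \<alpha>0) * of_nat (N ^ CARD('d))) =
      (\<Sum>k\<in>K. \<chi>0 k * (\<Sum>\<alpha>\<in>A. a \<alpha> * mpower (w k) \<alpha>))" ..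
  have "norm (a \<alpha>0) * mpower \<rho> \<alpha>0 * real (N ^ CARD('d)) =
      norm (a \<alpha>0 * (of_real (mpower \<rho> \<alpha>0) * of_nat (N ^ CARD('d))))"
    using mpower_nonneg [of \<rho> \<alpha>0] \<rho> by (simp add: norm_mult norm_power)
  also have "\<dots> \<le> (\<Sum>k\<in>K. norm (\<chi>0 k * (\<Sum>\<alpha>\<in>A. a \<alpha> * mpower (w k) \<alpha>)))"
    unfolding avg by (rule norm_sum)
  also have "\<dots> \<le> (\<Sum>k\<in>K. M)"
  proof (rule sum_mono)
    fix k
    have "norm (\<chi>0 k) = 1" by (simp add: \<chi>0_def prod_norm [symmetric] \<omega>_norm)
    moreover have "norm (\<Sum>\<alpha>\<in>A. a \<alpha> * mpower (w k) \<alpha>) \<le> M"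
      by (rule bound) (simp add: w_def norm_mult \<omega>_norm \<rho>)
    ultimately show "norm (\<chi>0 k * (\<Sum>\<alpha>\<in>A. a \<alpha> * mpower (w k) \<alpha>)) \<le> M"
      by (simp add: norm_mult)
  qed
  also have "\<dots> = M * real (N ^ CARD('d))" by (simp add: cardK)
  finally show ?thesis using N0 by (simp del: of_nat_power)
qed

section \<open>Power series in several variables\<close>

text \<open>Grouping the terms of equal degree turns a power series in several variables into a power
  series in one variable on every complex line through the origin.\<close>

definition homogeneous_part :: "('d::finite multiindex \<Rightarrow> complex) \<Rightarrow> nat \<Rightarrow> complex ^ 'd \<Rightarrow> complex" where
  "homogeneous_part a n z = (\<Sum>\<alpha> | mlength \<alpha> = n. a \<alpha> * mpower z \<alpha>)"

lemma homogeneous_part_scale: "homogeneous_part a n (t *s z) = homogeneous_part a n z * t ^ n"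
  by (simp add: homogeneous_part_def mpower_scale sum_distrib_left mult_ac)

lemma has_sum_imp_homogeneous_sums:
  assumes "((\<lambda>\<alpha>. a \<alpha> * mpower z \<alpha>) has_sum s) UNIV"
  shows "(\<lambda>n. homogeneous_part a n z) sums s"
proof -
  have "((\<lambda>(n, \<alpha>). a \<alpha> * mpower z \<alpha>) has_sum s) (SIGMA n:UNIV. {\<alpha>. mlength \<alpha> = n})"
    using assms
    by (subst has_sum_reindex_bij_witness [where i = "\<lambda>\<alpha>. (mlength \<alpha>, \<alpha>)" and j = snd
          and T = UNIV and h = "\<lambda>\<alpha>. a \<alpha> * mpower z \<alpha>" and s' = s]) auto
  then have "((\<lambda>n. homogeneous_part a n z) has_sum s) UNIV"
    by (rule has_sum_SigmaD) (simp add: homogeneous_part_def finite_mlength_eq has_sum_finiteI)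
  then show ?thesis by (rule has_sum_imp_sums)
qed

lemma uniform_ratio_less_one:
  fixes x \<rho> :: "real ^ 'd::finite"
  assumes "\<And>j. 0 < \<rho> $ j" "\<And>j. x $ j < \<rho> $ j"
  obtains s where "0 < s" "s < 1" "\<And>j. x $ j \<le> s * \<rho> $ j"
proof
  define m where "m = Max (range (\<lambda>j. x $ j / \<rho> $ j))"
  show "0 < max (1/2) m" by simp
  have "m < 1" unfolding m_def using assms by (subst Max_less_iff) auto
  then show "max (1/2) m < 1" by simp
  fix j
  have "x $ j / \<rho> $ j \<le> m" unfolding m_def by (rule Max_ge) auto
  then have "x $ j / \<rho> $ j \<le> max (1/2) m" by simp
  then show "x $ j \<le> max (1/2) m * \<rho> $ j" using assms(1) [of j] by (simp add: pos_divide_le_eq)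
qed

lemma abs_summable_in_polydisc:
  fixes x \<rho> :: "real ^ 'd::finite"
  assumes bound: "\<And>\<alpha>. norm (a \<alpha>) * mpower \<rho> \<alpha> \<le> M"
    and x: "\<And>j. 0 \<le> x $ j" "\<And>j. x $ j < \<rho> $ j"
  shows "(\<lambda>\<alpha>. norm (a \<alpha>) * mpower x \<alpha>) summable_on UNIV"
proof -
  have \<rho>: "0 < \<rho> $ j" for j using x [of j] by linarith
  obtain s where s: "0 < s" "s < 1" "\<And>j. x $ j \<le> s * \<rho> $ j"
    using uniform_ratio_less_one [of \<rho> x] \<rho> x by blast
  have le: "norm (a \<alpha>) * mpower x \<alpha> \<le> M * s ^ mlength \<alpha>" for \<alpha>
  proof -
    have "mpower x \<alpha> \<le> mpower (s *s \<rho>) \<alpha>" by (rule mpower_mono) (use x s in auto)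
    then have "norm (a \<alpha>) * mpower x \<alpha> \<le> norm (a \<alpha>) * (s ^ mlength \<alpha> * mpower \<rho> \<alpha>)"
      by (simp add: mpower_scale mult_left_mono)
    also have "\<dots> = (norm (a \<alpha>) * mpower \<rho> \<alpha>) * s ^ mlength \<alpha>" by simp
    also have "\<dots> \<le> M * s ^ mlength \<alpha>" using bound s by (intro mult_right_mono) auto
    finally show ?thesis .
  qed
  show ?thesis
    by (rule summable_on_comparison_test [where f = "\<lambda>\<alpha>. M * s ^ mlength \<alpha>"])
      (use s le x in \<open>auto intro!: summable_on_cmult_right geometric_summable_on mult_nonneg_nonneg mpower_nonneg\<close>)
qed

lemma power_series_summable:
  fixes z :: "complex ^ 'd::finite"
  assumes bound: "\<And>\<alpha>. norm (a \<alpha> :: complex) * mpower \<rho> \<alpha> \<le> M" and z: "z \<in> polydisc \<rho>"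
  shows "(\<lambda>\<alpha>. a \<alpha> * mpower z \<alpha>) summable_on UNIV"
proof (rule abs_summable_summable)
  show "(\<lambda>\<alpha>. norm (a \<alpha> * mpower z \<alpha>)) summable_on UNIV"
    unfolding norm_mult norm_mpower
    by (rule abs_summable_in_polydisc [OF bound]) (use z in \<open>auto simp: polydisc_def\<close>)
qed

lemma norm_const_vec_le: "norm (\<chi> j::'d::finite. c) \<le> real CARD('d) * norm c" for c :: complex
  unfolding norm_vec_def by (rule order_trans [OF L2_set_le_sum]) auto

text \<open>Evaluating a convergent expansion at a point whose coordinates relative to the centre all
  equal \<open>\<delta>\<close> turns convergence near the centre into a summable majorant on a whole polydisc.\<close>

lemma local_expansion_majorant:
  fixes b :: "complex ^ 'd::finite"
  assumes "\<forall>\<^sub>F z in nhds b. ((\<lambda>\<alpha>. c \<alpha> * mpower (z - b) \<alpha>) has_sum f z) UNIV"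
  obtains \<delta> where "0 < \<delta>" "(\<lambda>\<alpha>. norm (c \<alpha>) * \<delta> ^ mlength \<alpha>) summable_on UNIV"
    "\<And>z. norm (z - b) < \<delta> \<Longrightarrow> ((\<lambda>\<alpha>. c \<alpha> * mpower (z - b) \<alpha>) has_sum f z) UNIV"
proof -
  obtain d where d: "0 < d"
    "\<And>z. dist z b < d \<Longrightarrow> ((\<lambda>\<alpha>. c \<alpha> * mpower (z - b) \<alpha>) has_sum f z) UNIV"
    using assms unfolding eventually_nhds_metric by blast
  define \<delta> where "\<delta> = d / (2 * real CARD('d))"
  define z where "z = b + (\<chi> j. complex_of_real \<delta>)"
  have "1 \<le> real CARD('d)" by (simp add: Suc_leI)
  then have "1 < 2 * real CARD('d)" by linarith
  then have \<delta>: "0 < \<delta>" "\<delta> < d" using d(1) by (simp_all add: \<delta>_def divide_less_eq)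
  have "dist z b \<le> real CARD('d) * \<delta>"
    using norm_const_vec_le [of "complex_of_real \<delta>", where 'd = 'd] \<delta> by (simp add: z_def dist_norm)
  also have "\<dots> < d" using d(1) by (simp add: \<delta>_def)
  finally have "((\<lambda>\<alpha>. c \<alpha> * mpower (z - b) \<alpha>) has_sum f z) UNIV" by (rule d(2))
  then have "(\<lambda>\<alpha>. norm (c \<alpha> * mpower (z - b) \<alpha>)) summable_on UNIV"
    using summable_on_iff_abs_summable_on_complex has_sum_imp_summable by fast
  moreover have "norm (c \<alpha> * mpower (z - b) \<alpha>) = norm (c \<alpha>) * \<delta> ^ mlength \<alpha>" for \<alpha>
    using \<delta> by (simp add: z_def norm_mult mpower_const norm_power)
  ultimately have "(\<lambda>\<alpha>. norm (c \<alpha>) * \<delta> ^ mlength \<alpha>) summable_on UNIV" by simp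
  then show ?thesis using that [of \<delta>] \<delta> d(2) by (auto simp: dist_norm)
qed

lemma mv_analytic_on_subset: "mv_analytic_on f \<Omega> \<Longrightarrow> \<Omega>' \<subseteq> \<Omega> \<Longrightarrow> mv_analytic_on f \<Omega>'"
  by (auto simp: mv_analytic_on_def)

lemma mv_analytic_on_zero: "mv_analytic_on (\<lambda>z. 0) \<Omega>"
  by (auto simp: mv_analytic_on_def intro!: exI [of _ "\<lambda>_. 0"])

text \<open>The local majorants bound the function near each point, and finitely many neighbourhoods cover a compact set.\<close>

lemma mv_analytic_bounded_on_compact:
  fixes f :: "complex ^ 'd::finite \<Rightarrow> complex"
  assumes f: "mv_analytic_on f \<Omega>" and K: "compact K" "K \<subseteq> \<Omega>"
  obtains M where "\<And>z. z \<in> K \<Longrightarrow> norm (f z) \<le> M"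
proof -
  have "\<exists>\<delta> M. 0 < \<delta> \<and> (\<forall>z\<in>ball b \<delta>. norm (f z) \<le> M)" if b: "b \<in> \<Omega>" for b
  proof -
    obtain c where c: "\<forall>\<^sub>F z in nhds b. ((\<lambda>\<alpha>. c \<alpha> * mpower (z - b) \<alpha>) has_sum f z) UNIV"
      using f b unfolding mv_analytic_on_def by blast
    obtain \<delta> where \<delta>: "0 < \<delta>" "(\<lambda>\<alpha>. norm (c \<alpha>) * \<delta> ^ mlength \<alpha>) summable_on UNIV"
      "\<And>z. norm (z - b) < \<delta> \<Longrightarrow> ((\<lambda>\<alpha>. c \<alpha> * mpower (z - b) \<alpha>) has_sum f z) UNIV"
      by (rule local_expansion_majorant [OF c]) (rule that)
    have "norm (f z) \<le> (\<Sum>\<^sub>\<infinity>\<alpha>. norm (c \<alpha>) * \<delta> ^ mlength \<alpha>)" if z: "z \<in> ball b \<delta>" for z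
    proof (rule norm_infsum_le)
      have zb: "norm (z - b) < \<delta>" using z by (simp add: dist_norm norm_minus_commute)
      then show "((\<lambda>\<alpha>. c \<alpha> * mpower (z - b) \<alpha>) has_sum f z) UNIV" by (rule \<delta>(3))
      show "((\<lambda>\<alpha>. norm (c \<alpha>) * \<delta> ^ mlength \<alpha>) has_sum
          (\<Sum>\<^sub>\<infinity>\<alpha>. norm (c \<alpha>) * \<delta> ^ mlength \<alpha>)) UNIV"
        using \<delta>(2) by (rule has_sum_infsum)
      fix \<alpha>
      have "norm (mpower (z - b) \<alpha>) \<le> mpower (\<chi> j. \<delta>) \<alpha>"
      proof (rule norm_mpower_le)
        fix j
        have "norm ((z - b) $ j) \<le> norm (z - b)" by (rule Finite_Cartesian_Product.norm_nth_le)
        then show "norm ((z - b) $ j) \<le> (\<chi> j. \<delta>) $ j" using zb by simp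
      qed
      then show "norm (c \<alpha> * mpower (z - b) \<alpha>) \<le> norm (c \<alpha>) * \<delta> ^ mlength \<alpha>"
        by (simp add: norm_mult mpower_const mult_left_mono)
    qed
    then show ?thesis using \<delta>(1) by blast
  qed
  then obtain \<delta> M where \<delta>M: "\<And>b. b \<in> \<Omega> \<Longrightarrow> 0 < \<delta> b" "\<And>b z. b \<in> \<Omega> \<Longrightarrow> z \<in> ball b (\<delta> b) \<Longrightarrow> norm (f z) \<le> M b"
    by metis
  have "K \<subseteq> (\<Union>b\<in>K. ball b (\<delta> b))" using \<delta>M(1) K(2) by force
  then obtain K' where K': "K' \<subseteq> K" "finite K'" "K \<subseteq> (\<Union>b\<in>K'. ball b (\<delta> b))"
    using compactE_image [OF K(1), of K "\<lambda>b. ball b (\<delta> b)"] by auto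
  show ?thesis
  proof
    fix z assume "z \<in> K"
    then obtain b where b: "b \<in> K'" "z \<in> ball b (\<delta> b)" using K' by blast
    then have "norm (f z) \<le> M b" using \<delta>M(2) K K' by blast
    also have "\<dots> \<le> \<bar>M b\<bar>" by simp
    also have "\<dots> \<le> (\<Sum>b\<in>K'. \<bar>M b\<bar>)" by (rule member_le_sum) (use b K' in auto)
    finally show "norm (f z) \<le> (\<Sum>b\<in>K'. \<bar>M b\<bar>)" .
  qed
qed

lemma powser_coeff_unique:
  fixes a b :: "nat \<Rightarrow> complex"
  assumes "0 < r" "\<And>t. norm t < r \<Longrightarrow> (\<lambda>n. a n * t ^ n) sums f t"
    "\<And>t. norm t < r \<Longrightarrow> (\<lambda>n. b n * t ^ n) sums f t"
  shows "a = b"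
proof (rule ccontr)
  assume "a \<noteq> b"
  then obtain m where m: "a m - b m \<noteq> 0" by (auto simp: fun_eq_iff)
  have sums0: "(\<lambda>n. (a n - b n) * t ^ n) sums 0" if t: "norm t < r" for t
    using sums_diff [OF assms(2) [OF t] assms(3) [OF t]] by (simp add: left_diff_distrib)
  have "a 0 - b 0 = 0" using sums0 [of 0] assms(1) powser_sums_zero_iff [of "\<lambda>n. a n - b n" 0] by simp
  then have "0 < m" using m by (cases m) auto
  show False
  proof (rule powser_0_nonzero [of r 0 "\<lambda>n. a n - b n" "\<lambda>_. 0" m])
    show "\<And>t. norm (t - 0) < r \<Longrightarrow> (\<lambda>n. (a n - b n) * (t - 0) ^ n) sums 0" using sums0 by simp
    fix s assume s: "0 < s" "\<And>z::complex. z \<in> cball 0 s - {0} \<Longrightarrow> (0::complex) \<noteq> 0"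
    show False using s(1) s(2) [of "of_real s"] by auto
  qed (use assms(1) m \<open>0 < m\<close> in auto)
qed

text \<open>The series is only assumed to represent \<open>f\<close> near 0, while the bound and the conclusion concern
  the unit circle.  Holomorphy of \<open>f\<close> on a larger disc bridges the gap: its Taylor series
  converges there, and has the same coefficients.\<close>

lemma powser_coeff_bound:
  fixes b :: "nat \<Rightarrow> complex"
  assumes r: "0 < r" "\<And>t. norm t < r \<Longrightarrow> (\<lambda>n. b n * t ^ n) sums f t"
    and f: "f holomorphic_on ball 0 R" "1 < R"
    and M: "\<And>t. norm t = 1 \<Longrightarrow> norm (f t) \<le> M"
  shows "norm (b n) \<le> M" and "b sums f 1"
proof -
  define d where "d n = (deriv ^^ n) f 0 / fact n" for n
  have sums_d: "(\<lambda>n. d n * t ^ n) sums f t" if "norm t < R" for t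
    using holomorphic_power_series [OF f(1), of t] that by (simp add: d_def)
  have bd: "b = d"
    by (rule powser_coeff_unique [of "min r R" _ f]) (use r f sums_d in auto)
  show "b sums f 1" using sums_d [of 1] f(2) bd by simp
  have "norm ((deriv ^^ n) f 0) \<le> fact n * M / 1 ^ n"
  proof (rule Cauchy_inequality)
    show "f holomorphic_on ball 0 1" using f by (rule_tac holomorphic_on_subset) auto
    show "continuous_on (cball 0 1) f"
      using f by (intro holomorphic_on_imp_continuous_on) (rule_tac holomorphic_on_subset, auto)
  qed (use M in auto)
  then show "norm (b n) \<le> M"
    by (simp add: bd d_def norm_divide divide_le_eq mult.commute)
qed

lemma tendsto_vscale: "((\<lambda>t. t *s w) \<longlongrightarrow> t0 *s w) (nhds t0)"
  for w :: "complex ^ 'd::finite"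
  by (rule vec_tendstoI) (auto intro!: tendsto_intros filterlim_ident)

lemma holomorphic_on_slice:
  fixes f :: "complex ^ 'd::finite \<Rightarrow> complex"
  assumes f: "mv_analytic_on f \<Omega>" and V: "\<And>t. t \<in> V \<Longrightarrow> t *s w \<in> \<Omega>"
  shows "(\<lambda>t. f (t *s w)) holomorphic_on V"
proof -
  have "(\<lambda>t. f (t *s w)) field_differentiable (at t0)" if t0: "t0 \<in> V" for t0
  proof -
    obtain c where "\<forall>\<^sub>F z in nhds (t0 *s w).
        ((\<lambda>\<alpha>. c \<alpha> * mpower (z - t0 *s w) \<alpha>) has_sum f z) UNIV"
      using f V [OF t0] unfolding mv_analytic_on_def by blast
    then have "\<forall>\<^sub>F t in nhds t0. ((\<lambda>\<alpha>. c \<alpha> * mpower (t *s w - t0 *s w) \<alpha>) has_sum f (t *s w)) UNIV"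
      by (rule eventually_compose_filterlim [OF _ tendsto_vscale])
    then obtain d where d: "0 < d" "\<And>t. dist t t0 < d \<Longrightarrow>
        ((\<lambda>\<alpha>. c \<alpha> * mpower (t *s w - t0 *s w) \<alpha>) has_sum f (t *s w)) UNIV"
      unfolding eventually_nhds_metric by blast
    have "(\<lambda>n. homogeneous_part c n w * (t - t0) ^ n) sums f (t *s w)" if "t \<in> ball t0 d" for t
    proof -
      have "((\<lambda>\<alpha>. c \<alpha> * mpower ((t - t0) *s w) \<alpha>) has_sum f (t *s w)) UNIV"
        using d(2) [of t] that by (simp add: dist_commute vector_sub_rdistrib)
      from has_sum_imp_homogeneous_sums [OF this] show ?thesis
        by (simp only: homogeneous_part_scale)
    qed
    then have "(\<lambda>t. f (t *s w)) analytic_on ball t0 d" by (rule power_series_analytic)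
    then show ?thesis using d(1) by (meson analytic_on_imp_differentiable_at centre_in_ball)
  qed
  then show ?thesis
    using field_differentiable_at_within holomorphic_on_def by blast
qed

text \<open>Along a complex line through the origin the function is holomorphic in one variable and its
  Taylor coefficients are the homogeneous parts, so the one-variable Cauchy inequality bounds the
  homogeneous parts.  These are polynomials, whose single coefficients are reached by averaging
  over roots of unity.  The expansion \<open>a\<close> is only known to converge close to the origin: that
  it converges on the whole polydisc is a consequence.\<close>

lemma expansion_coeff_bound:
  fixes f :: "complex ^ 'd::finite \<Rightarrow> complex"
  assumes f: "mv_analytic_on f (polydisc r0)"
    and a: "\<forall>\<^sub>F z in nhds 0. ((\<lambda>\<alpha>. a \<alpha> * mpower z \<alpha>) has_sum f z) UNIV"
    and \<rho>: "\<And>j. 0 < \<rho> $ j" "\<And>j. \<rho> $ j < r0 $ j"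
    and M: "\<And>z. (\<And>j. norm (z $ j) \<le> \<rho> $ j) \<Longrightarrow> norm (f z) \<le> M"
  shows "norm (a \<alpha>) * mpower \<rho> \<alpha> \<le> M"
    and "\<And>w. (\<And>j. norm (w $ j) \<le> \<rho> $ j) \<Longrightarrow> (\<lambda>n. homogeneous_part a n w) sums f w"
proof -
  have r0: "0 < r0 $ j" for j using \<rho> [of j] by linarith
  obtain s where s: "0 < s" "s < 1" "\<And>j. \<rho> $ j \<le> s * r0 $ j"
    using uniform_ratio_less_one [of r0 \<rho>] r0 \<rho> by blast
  have slice: "norm (homogeneous_part a n w) \<le> M \<and> (\<lambda>n. homogeneous_part a n w) sums f w"
    if w: "\<And>j. norm (w $ j) \<le> \<rho> $ j" for w n
  proof -
    have "t *s w \<in> polydisc r0" if "t \<in> ball 0 (1 / s)" for t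
    proof -
      have "norm t * norm (w $ j) < r0 $ j" for j
      proof -
        have "norm t * norm (w $ j) \<le> norm t * (s * r0 $ j)"
          using w [of j] s(3) [of j] by (intro mult_left_mono) auto
        also have "\<dots> = (norm t * s) * r0 $ j" by simp
        also have "\<dots> < 1 * r0 $ j"
          using that s r0 by (intro mult_strict_right_mono) (auto simp: field_simps)
        finally show ?thesis by simp
      qed
      then show ?thesis by (simp add: polydisc_def norm_mult)
    qed
    then have hol: "(\<lambda>t. f (t *s w)) holomorphic_on ball 0 (1 / s)"
      by (rule holomorphic_on_slice [OF f])
    have "\<forall>\<^sub>F t in nhds 0. ((\<lambda>\<alpha>. a \<alpha> * mpower (t *s w) \<alpha>) has_sum f (t *s w)) UNIV"
      by (rule eventually_compose_filterlim [OF a]) (use tendsto_vscale [of w 0] in simp)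
    then obtain d where d: "0 < d" "\<And>t. norm t < d \<Longrightarrow>
        ((\<lambda>\<alpha>. a \<alpha> * mpower (t *s w) \<alpha>) has_sum f (t *s w)) UNIV"
      unfolding eventually_nhds_metric by auto
    have sums: "(\<lambda>n. homogeneous_part a n w * t ^ n) sums f (t *s w)" if "norm t < d" for t
      using has_sum_imp_homogeneous_sums [OF d(2) [OF that]] by (simp add: homogeneous_part_scale)
    have bd: "norm (f (t *s w)) \<le> M" if "norm t = 1" for t
      by (rule M) (use w that in \<open>simp add: norm_mult\<close>)
    show ?thesis
      using powser_coeff_bound [OF d(1) sums hol _ bd] s by simp
  qed
  show "(\<lambda>n. homogeneous_part a n w) sums f w" if "\<And>j. norm (w $ j) \<le> \<rho> $ j" for w
    using slice [OF that] by blast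
  show "norm (a \<alpha>) * mpower \<rho> \<alpha> \<le> M"
  proof (rule polynomial_coeff_le)
    show "finite {\<beta> :: 'd multiindex. mlength \<beta> = mlength \<alpha>}" by (rule finite_mlength_eq)
    show "norm (\<Sum>\<beta> | mlength \<beta> = mlength \<alpha>. a \<beta> * mpower z \<beta>) \<le> M"
      if "\<And>j. norm (z $ j) = \<rho> $ j" for z
      using slice [of z] that unfolding homogeneous_part_def by simp
  qed (use \<rho> in \<open>auto intro: less_imp_le\<close>)
qed

text \<open>The difference of the two families expands the zero function, for which Cauchy's inequality
  holds with the bound 0.\<close>

lemma expansion_unique:
  fixes a b :: "'d::finite formal_series"
  assumes "\<forall>\<^sub>F z in nhds 0. ((\<lambda>\<alpha>. a \<alpha> * mpower z \<alpha>) has_sum f z) UNIV"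
    "\<forall>\<^sub>F z in nhds 0. ((\<lambda>\<alpha>. b \<alpha> * mpower z \<alpha>) has_sum f z) UNIV"
  shows "a = b"
proof
  fix \<alpha>
  have "\<forall>\<^sub>F z in nhds 0. ((\<lambda>\<alpha>. (a \<alpha> - b \<alpha>) * mpower z \<alpha>) has_sum 0) UNIV"
    using assms
  proof eventually_elim
    case (elim z)
    have "((\<lambda>\<alpha>. a \<alpha> * mpower z \<alpha> + - (b \<alpha> * mpower z \<alpha>)) has_sum (f z + - f z)) UNIV"
      by (intro has_sum_add elim has_sum_uminusI)
    then show ?case by (simp add: left_diff_distrib)
  qed
  from expansion_coeff_bound(1) [OF mv_analytic_on_zero this, of "\<chi> j. 1" "\<chi> j. 2" 0 \<alpha>]
  show "a \<alpha> = b \<alpha>" by (simp add: mpower_const)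
qed

lemma compact_closed_polydisc: "compact {z :: complex ^ 'd::finite. \<forall>j. norm (z $ j) \<le> \<rho> $ j}"
proof -
  have "{z :: complex ^ 'd. \<forall>j. norm (z $ j) \<le> \<rho> $ j} = (\<Inter>j. {z. norm (z $ j) \<le> \<rho> $ j})" by auto
  moreover have "closed (\<Inter>j. {z :: complex ^ 'd. norm (z $ j) \<le> \<rho> $ j})"
    by (intro closed_INT ballI closed_Collect_le continuous_intros)
  moreover have "bounded {z :: complex ^ 'd. \<forall>j. norm (z $ j) \<le> \<rho> $ j}"
    unfolding bounded_iff
  proof (intro exI ballI)
    fix z :: "complex ^ 'd" assume "z \<in> {z. \<forall>j. norm (z $ j) \<le> \<rho> $ j}"
    then show "norm z \<le> (\<Sum>j\<in>UNIV. \<rho> $ j)"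
      unfolding norm_vec_def by (auto intro!: order_trans [OF L2_set_le_sum] sum_mono)
  qed
  ultimately show ?thesis by (simp add: compact_eq_bounded_closed)
qed

text \<open>Cauchy's inequality on a slightly larger compact polydisc gives absolute convergence at \<open>z\<close>; the
  value is found by summing the homogeneous parts along the line through \<open>z\<close>.\<close>

theorem polydisc_expansion:
  fixes f :: "complex ^ 'd::finite \<Rightarrow> complex"
  assumes f: "mv_analytic_on f (polydisc r0)"
    and a: "\<forall>\<^sub>F z in nhds 0. ((\<lambda>\<alpha>. a \<alpha> * mpower z \<alpha>) has_sum f z) UNIV"
    and z: "z \<in> polydisc r0"
  shows "((\<lambda>\<alpha>. a \<alpha> * mpower z \<alpha>) has_sum f z) UNIV"
proof -
  have zr: "norm (z $ j) < r0 $ j" for j using z by (simp add: polydisc_def)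
  then have r0: "0 < r0 $ j" for j by (rule le_less_trans [OF norm_ge_zero])
  define \<rho> where "\<rho> = (\<chi> j. (norm (z $ j) + r0 $ j) / 2)"
  have \<rho>: "0 < \<rho> $ j" "\<rho> $ j < r0 $ j" "norm (z $ j) < \<rho> $ j" for j
    using zr [of j] r0 [of j] by (auto simp: \<rho>_def intro: add_nonneg_pos)
  define K where "K = {w :: complex ^ 'd. \<forall>j. norm (w $ j) \<le> \<rho> $ j}"
  have "K \<subseteq> polydisc r0" using \<rho>(2) by (auto simp: K_def polydisc_def intro: le_less_trans)
  then obtain M where M: "\<And>w. w \<in> K \<Longrightarrow> norm (f w) \<le> M"
    using mv_analytic_bounded_on_compact [OF f, of K] compact_closed_polydisc unfolding K_def by blast
  have M': "\<And>w. (\<And>j. norm (w $ j) \<le> \<rho> $ j) \<Longrightarrow> norm (f w) \<le> M" using M by (simp add: K_def)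
  note bd = expansion_coeff_bound [OF f a \<rho>(1,2) M']
  have "(\<lambda>\<alpha>. a \<alpha> * mpower z \<alpha>) summable_on UNIV"
    by (rule power_series_summable [OF bd(1)]) (use \<rho> in \<open>auto simp: polydisc_def\<close>)
  then obtain S where S: "((\<lambda>\<alpha>. a \<alpha> * mpower z \<alpha>) has_sum S) UNIV" by (auto simp: summable_on_def)
  have "(\<lambda>n. homogeneous_part a n z) sums f z" by (rule bd(2)) (use \<rho>(3) less_imp_le in auto)
  with has_sum_imp_homogeneous_sums [OF S] have "S = f z" by (rule sums_unique2)
  with S show ?thesis by simp
qed

lemma has_sum_multi_binomial:
  fixes x y :: "'a::real_normed_field ^ 'd::finite"
  shows "((\<lambda>\<beta>. \<Prod>j\<in>UNIV. of_nat (\<alpha> $ j choose \<beta> $ j) * x $ j ^ (\<beta> $ j) * y $ j ^ (\<alpha> $ j - \<beta> $ j))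
     has_sum mpower (x + y) \<alpha>) UNIV"
proof (rule has_sum_finite_neutralI)
  show "finite {\<beta> :: 'd multiindex. \<forall>j. \<beta> $ j \<in> {..\<alpha> $ j}}" by (rule finite_box) simp
  show "mpower (x + y) \<alpha> = (\<Sum>\<beta> | \<forall>j. \<beta> $ j \<in> {..\<alpha> $ j}. \<Prod>j\<in>UNIV. of_nat (\<alpha> $ j choose \<beta> $ j) * x $ j ^ (\<beta> $ j) * y $ j ^ (\<alpha> $ j - \<beta> $ j))"
    by (subst sum_box_prod) (simp_all add: mpower_def binomial_ring)
  fix \<beta> :: "'d multiindex" assume "\<beta> \<in> UNIV - {\<beta>. \<forall>j. \<beta> $ j \<in> {..\<alpha> $ j}}"
  then obtain j where "\<alpha> $ j < \<beta> $ j" by (auto simp: not_le)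
  then show "(\<Prod>j\<in>UNIV. of_nat (\<alpha> $ j choose \<beta> $ j) * x $ j ^ (\<beta> $ j) * y $ j ^ (\<alpha> $ j - \<beta> $ j)) = 0"
    by (intro prod_zero bexI [of _ j]) (auto simp: binomial_eq_0)
qed simp

text \<open>Re-expansion about another point \<open>b\<close>: the double series obtained from the binomial
  formula converges absolutely where \<open>\<bar>b\<^sub>j\<bar> + \<bar>z\<^sub>j - b\<^sub>j\<bar> < \<rho>\<^sub>j\<close>, so that it may be summed in
  the other order.\<close>

theorem power_series_mv_analytic:
  fixes f :: "complex ^ 'd::finite \<Rightarrow> complex"
  assumes bound: "\<And>\<alpha>. norm (a \<alpha>) * mpower \<rho> \<alpha> \<le> M"
    and f: "\<And>z. z \<in> polydisc \<rho> \<Longrightarrow> ((\<lambda>\<alpha>. a \<alpha> * mpower z \<alpha>) has_sum f z) UNIV"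
  shows "mv_analytic_on f (polydisc \<rho>)"
  unfolding mv_analytic_on_def
proof
  fix b :: "complex ^ 'd" assume b: "b \<in> polydisc \<rho>"
  define \<delta> where "\<delta> = Min (range (\<lambda>j. \<rho> $ j - norm (b $ j)))"
  have \<delta>: "0 < \<delta>" "\<And>j. norm (b $ j) + \<delta> \<le> \<rho> $ j"
  proof -
    show "0 < \<delta>" unfolding \<delta>_def using b by (subst Min_gr_iff) (auto simp: polydisc_def)
    fix j have "\<delta> \<le> \<rho> $ j - norm (b $ j)" unfolding \<delta>_def by (rule Min_le) auto
    then show "norm (b $ j) + \<delta> \<le> \<rho> $ j" by simp
  qed
  define D where "D \<alpha> \<beta> = (\<Prod>j\<in>UNIV. of_nat (\<alpha> $ j choose \<beta> $ j) * b $ j ^ (\<alpha> $ j - \<beta> $ j))"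
    for \<alpha> \<beta> :: "'d multiindex"
  define c where "c \<beta> = (\<Sum>\<^sub>\<infinity>\<alpha>. a \<alpha> * D \<alpha> \<beta>)" for \<beta>
  have "((\<lambda>\<beta>. c \<beta> * mpower (z - b) \<beta>) has_sum f z) UNIV" if z: "dist z b < \<delta>" for z
  proof -
    define h where "h = z - b"
    have h: "norm (h $ j) < \<delta>" for j
      using z Finite_Cartesian_Product.norm_nth_le [of h j] by (simp add: h_def dist_norm)
    have bh: "norm (b $ j) + norm (h $ j) < \<rho> $ j" for j using h [of j] \<delta>(2) [of j] by linarith
    have zb: "z = h + b" by (simp add: h_def)
    have z\<rho>: "z \<in> polydisc \<rho>"
      unfolding polydisc_def zb using bh by (auto intro: le_less_trans [OF norm_triangle_ineq] simp: add.commute)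
    define F where "F \<alpha> \<beta> = a \<alpha> * D \<alpha> \<beta> * mpower h \<beta>" for \<alpha> \<beta>
    have F_eq: "F \<alpha> \<beta> = a \<alpha> * (\<Prod>j\<in>UNIV. of_nat (\<alpha> $ j choose \<beta> $ j) * h $ j ^ (\<beta> $ j) * b $ j ^ (\<alpha> $ j - \<beta> $ j))" for \<alpha> \<beta>
      by (simp add: F_def D_def mpower_def prod.distrib mult_ac)
    have F_sum: "((\<lambda>\<beta>. F \<alpha> \<beta>) has_sum a \<alpha> * mpower z \<alpha>) UNIV" for \<alpha>
      unfolding F_eq zb by (intro has_sum_cmult_right has_sum_multi_binomial)
    define hb where "hb = (\<chi> j. norm (h $ j)) + (\<chi> j. norm (b $ j))"
    have F_norm: "((\<lambda>\<beta>. norm (F \<alpha> \<beta>)) has_sum norm (a \<alpha>) * mpower hb \<alpha>) UNIV" for \<alpha>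
    proof -
      have "norm (F \<alpha> \<beta>) = norm (a \<alpha>) * (\<Prod>j\<in>UNIV. of_nat (\<alpha> $ j choose \<beta> $ j) *
          (\<chi> j. norm (h $ j)) $ j ^ (\<beta> $ j) * (\<chi> j. norm (b $ j)) $ j ^ (\<alpha> $ j - \<beta> $ j))" for \<beta>
        by (simp add: F_eq norm_mult norm_power prod_norm [symmetric])
      then show ?thesis unfolding hb_def
        by (simp only: has_sum_cmult_right [OF has_sum_multi_binomial])
    qed
    have "(\<lambda>(\<alpha>, \<beta>). norm (F \<alpha> \<beta>)) summable_on (UNIV \<times> UNIV)"
    proof (rule summable_on_SigmaI)
      show "((\<lambda>\<beta>. case (\<alpha>, \<beta>) of (\<alpha>, \<beta>) \<Rightarrow> norm (F \<alpha> \<beta>)) has_sum norm (a \<alpha>) * mpower hb \<alpha>) UNIV" for \<alpha>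
        using F_norm by simp
      show "(\<lambda>\<alpha>. norm (a \<alpha>) * mpower hb \<alpha>) summable_on UNIV"
        by (rule abs_summable_in_polydisc [OF bound]) (use bh in \<open>auto simp: hb_def add.commute\<close>)
    qed auto
    then have "(\<lambda>p. norm ((\<lambda>(\<alpha>, \<beta>). F \<alpha> \<beta>) p)) summable_on (UNIV \<times> UNIV)"
      by (simp add: case_prod_unfold)
    then have summ: "(\<lambda>(\<alpha>, \<beta>). F \<alpha> \<beta>) summable_on (UNIV \<times> UNIV)"
      by (rule abs_summable_summable)
    then obtain S where S: "((\<lambda>(\<alpha>, \<beta>). F \<alpha> \<beta>) has_sum S) (UNIV \<times> UNIV)"
      by (auto simp: summable_on_def)
    have "((\<lambda>\<alpha>. a \<alpha> * mpower z \<alpha>) has_sum S) UNIV"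
      by (rule has_sum_SigmaD [OF S]) (use F_sum in simp)
    then have "S = f z" using f [OF z\<rho>] by (rule has_sum_unique)
    then have S': "((\<lambda>(\<beta>, \<alpha>). F \<alpha> \<beta>) has_sum f z) (UNIV \<times> UNIV)"
      using S by (subst has_sum_swap) (simp add: case_prod_unfold)
    have "((\<lambda>\<beta>. c \<beta> * mpower h \<beta>) has_sum f z) UNIV"
    proof (rule has_sum_SigmaD [OF S'])
      fix \<beta>
      have "(\<lambda>\<alpha>. F \<alpha> \<beta>) summable_on UNIV"
        by (rule summable_on_SigmaD1 [where f = "\<lambda>\<beta> \<alpha>. F \<alpha> \<beta>" and A = UNIV and B = "\<lambda>_. UNIV"])
          (use S' in \<open>auto simp: summable_on_def\<close>)
      then have "((\<lambda>\<alpha>. F \<alpha> \<beta>) has_sum (\<Sum>\<^sub>\<infinity>\<alpha>. F \<alpha> \<beta>)) UNIV" by (rule has_sum_infsum)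
      moreover have "(\<Sum>\<^sub>\<infinity>\<alpha>. F \<alpha> \<beta>) = c \<beta> * mpower h \<beta>"
        unfolding F_def c_def by (rule infsum_cmult_left')
      ultimately show "((\<lambda>\<alpha>. case (\<beta>, \<alpha>) of (\<beta>, \<alpha>) \<Rightarrow> F \<alpha> \<beta>) has_sum c \<beta> * mpower h \<beta>) UNIV" by simp
    qed
    then show ?thesis by (simp add: h_def)
  qed
  then show "\<exists>c. \<forall>\<^sub>F z in nhds b. ((\<lambda>\<alpha>. c \<alpha> * mpower (z - b) \<alpha>) has_sum f z) UNIV"
    unfolding eventually_nhds_metric using \<delta>(1) by blast
qed

section \<open>Continuity for the limit topologies\<close>

text \<open>The bound compares differences directly, which is the right form for the quasi-norms of \<open>\<ell>\<^sup>p\<close>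
  with \<open>p < 1\<close>, where the triangle inequality fails.\<close>

lemma continuous_map_seminorms:
  assumes g: "\<And>f. f \<in> E \<Longrightarrow> g f \<in> E'"
    and bound: "\<And>q'. q' \<in> Q' \<Longrightarrow> \<exists>q\<in>Q. \<exists>C\<ge>0. \<forall>f\<in>E. \<forall>f'\<in>E.
      q' (\<lambda>x. g f' x - g f x) \<le> C * q (\<lambda>x. f' x - f x)"
  shows "continuous_map (seminorms_topology E Q) (seminorms_topology E' Q') g"
  unfolding continuous_map_def topspace_seminorms_topology
proof (intro conjI allI impI)
  show "g \<in> E \<rightarrow> E'" using g by blast
  fix U assume U: "openin (seminorms_topology E' Q') U"
  obtain q C where qC: "\<And>q'. q' \<in> Q' \<Longrightarrow> q q' \<in> Q" "\<And>q'. q' \<in> Q' \<Longrightarrow> 0 \<le> C q'"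
    "\<And>q' f f'. q' \<in> Q' \<Longrightarrow> f \<in> E \<Longrightarrow> f' \<in> E \<Longrightarrow>
      q' (\<lambda>x. g f' x - g f x) \<le> C q' * q q' (\<lambda>x. f' x - f x)"
    using bound by metis
  show "openin (seminorms_topology E Q) {f \<in> E. g f \<in> U}"
    unfolding openin_seminorms_topology
  proof (intro conjI ballI)
    fix f assume "f \<in> {f \<in> E. g f \<in> U}"
    then have f: "f \<in> E" "g f \<in> U" by auto
    then obtain F \<epsilon> where F: "finite F" "F \<subseteq> Q'" "\<epsilon> > 0"
      "\<And>h. h \<in> E' \<Longrightarrow> (\<And>q'. q' \<in> F \<Longrightarrow> q' (\<lambda>x. h x - g f x) < \<epsilon>) \<Longrightarrow> h \<in> U"
      using U unfolding openin_seminorms_topology by meson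
    define K where "K = (\<Sum>q'\<in>F. C q') + 1"
    have K: "0 < K" using F qC(2) unfolding K_def by (intro add_nonneg_pos sum_nonneg) auto
    have "g f' \<in> U" if f': "f' \<in> E" "\<And>q'. q' \<in> F \<Longrightarrow> q q' (\<lambda>x. f' x - f x) < \<epsilon> / K" for f'
    proof (rule F(4))
      show "g f' \<in> E'" using g f' by blast
      fix q' assume q': "q' \<in> F"
      then have q'Q: "q' \<in> Q'" using F(2) by blast
      have "C q' \<le> (\<Sum>q'\<in>F. C q')" using F q' qC(2) by (intro member_le_sum) auto
      then have CK: "C q' < K" by (simp add: K_def)
      have "q' (\<lambda>x. g f' x - g f x) \<le> C q' * q q' (\<lambda>x. f' x - f x)"
        using qC(3) q'Q f f' by blast
      also have "\<dots> \<le> C q' * (\<epsilon> / K)"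
        using f'(2) [OF q'] qC(2) [OF q'Q] by (intro mult_left_mono) auto
      also have "\<dots> < K * (\<epsilon> / K)" using CK F(3) K by (intro mult_strict_right_mono) auto
      finally show "q' (\<lambda>x. g f' x - g f x) < \<epsilon>" using K by simp
    qed
    then show "\<exists>F \<epsilon>. finite F \<and> F \<subseteq> Q \<and> 0 < \<epsilon> \<and>
        (\<forall>h\<in>E. (\<forall>q\<in>F. q (\<lambda>x. h x - f x) < \<epsilon>) \<longrightarrow> h \<in> {f \<in> E. g f \<in> U})"
      using F qC(1) K by (intro exI [of _ "q ` F"] exI [of _ "\<epsilon> / K"]) auto
  qed auto
qed

lemma continuous_map_seminorms_euclidean:
  fixes g :: "('i \<Rightarrow> complex) \<Rightarrow> complex"
  assumes "q \<in> Q" "C \<ge> 0"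
    and bound: "\<And>f f'. f \<in> E \<Longrightarrow> f' \<in> E \<Longrightarrow> norm (g f' - g f) \<le> C * q (\<lambda>x. f' x - f x)"
  shows "continuous_map (seminorms_topology E Q) euclidean g"
  unfolding continuous_map_def topspace_seminorms_topology
proof (intro conjI allI impI)
  fix U :: "complex set" assume U: "openin euclidean U"
  show "openin (seminorms_topology E Q) {f \<in> E. g f \<in> U}"
    unfolding openin_seminorms_topology
  proof (intro conjI ballI)
    fix f assume "f \<in> {f \<in> E. g f \<in> U}"
    then have f: "f \<in> E" "g f \<in> U" by auto
    then obtain \<epsilon> where \<epsilon>: "\<epsilon> > 0" "\<And>y. dist y (g f) < \<epsilon> \<Longrightarrow> y \<in> U"
      using U by (metis open_openin open_dist)
    have "g h \<in> U" if "h \<in> E" "q (\<lambda>x. h x - f x) < \<epsilon> / (C + 1)" for h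
    proof (rule \<epsilon>(2))
      have "norm (g h - g f) \<le> C * q (\<lambda>x. h x - f x)" using bound f that by blast
      also have "\<dots> \<le> C * (\<epsilon> / (C + 1))" using that assms(2) by (intro mult_left_mono) auto
      also have "\<dots> < (C + 1) * (\<epsilon> / (C + 1))"
        using assms(2) \<epsilon>(1) by (intro mult_strict_right_mono) auto
      finally show "dist (g h) (g f) < \<epsilon>" using assms(2) by (simp add: dist_norm)
    qed
    then show "\<exists>F \<epsilon>. finite F \<and> F \<subseteq> Q \<and> 0 < \<epsilon> \<and>
        (\<forall>h\<in>E. (\<forall>q\<in>F. q (\<lambda>x. h x - f x) < \<epsilon>) \<longrightarrow> h \<in> {f \<in> E. g f \<in> U})"
      using assms(1,2) \<epsilon>(1) by (intro exI [of _ "{q}"] exI [of _ "\<epsilon> / (C + 1)"]) auto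
  qed auto
qed auto

lemma limitin_seminorms:
  fixes u :: "nat \<Rightarrow> 'i \<Rightarrow> complex"
  assumes "l \<in> E" "\<And>n. u n \<in> E" "\<And>q. q \<in> Q \<Longrightarrow> (\<lambda>n. q (\<lambda>x. u n x - l x)) \<longlonglongrightarrow> 0"
  shows "limitin (seminorms_topology E Q) u l sequentially"
  unfolding limitin_def topspace_seminorms_topology
proof (intro conjI allI impI)
  fix U assume "openin (seminorms_topology E Q) U \<and> l \<in> U"
  then obtain F \<epsilon> where F: "finite F" "F \<subseteq> Q" "\<epsilon> > 0"
    "\<And>g. g \<in> E \<Longrightarrow> (\<forall>q\<in>F. q (\<lambda>x. g x - l x) < \<epsilon>) \<Longrightarrow> g \<in> U"
    unfolding openin_seminorms_topology by meson
  have "\<forall>\<^sub>F n in sequentially. \<forall>q\<in>F. q (\<lambda>x. u n x - l x) < \<epsilon>"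
    using F assms(3) by (intro eventually_ball_finite ballI order_tendstoD(2) [where y = 0]) auto
  then show "\<forall>\<^sub>F n in sequentially. u n \<in> U"
    by eventually_elim (use F(4) assms(2) in auto)
qed (use assms in auto)

lemma limitin_topology_generated_by:
  assumes "l \<in> \<Union>S" "\<And>U. U \<in> S \<Longrightarrow> l \<in> U \<Longrightarrow> \<forall>\<^sub>F n in F. u n \<in> U"
  shows "limitin (topology_generated_by S) u l F"
  unfolding limitin_def topology_generated_by_topspace
proof (intro conjI allI impI assms(1))
  fix U assume U: "openin (topology_generated_by S) U \<and> l \<in> U"
  then have "generate_topology_on S U" by (simp add: openin_topology_generated_by)
  moreover have "l \<in> U" using U by blast
  ultimately show "\<forall>\<^sub>F n in F. u n \<in> U"
  proof (induction rule: generate_topology_on.induct)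
    case (Int a b)
    then show ?case by (simp add: eventually_conj)
  next
    case (UN K)
    then obtain k where "k \<in> K" "l \<in> k" by blast
    with UN.IH have "\<forall>\<^sub>F n in F. u n \<in> k" by blast
    then show ?case by (rule eventually_mono) (use \<open>k \<in> K\<close> in blast)
  qed (use assms(2) in auto)
qed

lemma continuous_map_projection:
  assumes "i \<in> I" "\<And>x. x \<in> E \<Longrightarrow> \<pi> i x \<in> topspace (X i)"
  shows "continuous_map (projective_limit_topology E I X \<pi>) (X i) (\<pi> i)"
  unfolding continuous_map_def topspace_projective_limit_topology
proof (intro conjI allI impI)
  fix U assume "openin (X i) U"
  then have "openin (projective_limit_topology E I X \<pi>) (E \<inter> \<pi> i -` U)"
    unfolding projective_limit_topology_def using assms(1)
    by (intro topology_generated_by_Basis) blast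
  moreover have "E \<inter> \<pi> i -` U = {x \<in> E. \<pi> i x \<in> U}" by auto
  ultimately show "openin (projective_limit_topology E I X \<pi>) {x \<in> E. \<pi> i x \<in> U}" by simp
qed (use assms in auto)

lemma continuous_map_into_projective_limit:
  assumes g: "\<And>z. z \<in> topspace Z \<Longrightarrow> g z \<in> E"
    and cont: "\<And>i. i \<in> I \<Longrightarrow> continuous_map Z (X i) (\<lambda>z. \<pi> i (g z))"
  shows "continuous_map Z (projective_limit_topology E I X \<pi>) g"
  unfolding projective_limit_topology_def continuous_on_generated_topo_iff
proof (intro conjI allI impI)
  fix U assume "U \<in> insert E {E \<inter> \<pi> i -` U |i U. i \<in> I \<and> openin (X i) U}"
  then consider "U = E" | i V where "U = E \<inter> \<pi> i -` V" "i \<in> I" "openin (X i) V" by blast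
  then show "openin Z (g -` U \<inter> topspace Z)"
  proof cases
    case 1
    then have "g -` U \<inter> topspace Z = topspace Z" using g by auto
    then show ?thesis by simp
  next
    case 2
    then have "g -` U \<inter> topspace Z = {z \<in> topspace Z. \<pi> i (g z) \<in> V}" using g by auto
    then show ?thesis using openin_continuous_map_preimage [OF cont] 2 by simp
  qed
qed (use g in auto)

lemma limitin_projective_limit:
  assumes l: "l \<in> E" "\<And>n. u n \<in> E"
    and lim: "\<And>i. i \<in> I \<Longrightarrow> limitin (X i) (\<lambda>n. \<pi> i (u n)) (\<pi> i l) F"
  shows "limitin (projective_limit_topology E I X \<pi>) u l F"
  unfolding projective_limit_topology_def
proof (rule limitin_topology_generated_by)
  fix U assume U: "U \<in> insert E {E \<inter> \<pi> i -` U |i U. i \<in> I \<and> openin (X i) U}" "l \<in> U"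
  then consider "U = E" | i V where "U = E \<inter> \<pi> i -` V" "i \<in> I" "openin (X i) V" by blast
  then show "\<forall>\<^sub>F n in F. u n \<in> U"
  proof cases
    case 2
    then have "\<forall>\<^sub>F n in F. \<pi> i (u n) \<in> V"
      using lim [of i] U(2) unfolding limitin_def by auto
    then show ?thesis by eventually_elim (use 2 l in auto)
  qed (use l in auto)
qed (use l in auto)

text \<open>A zigzag between the two systems suffices: every step of either system is reached by a
  continuous map from some step of the other, compatibly with \<open>g\<close> and its inverse.\<close>

lemma homeomorphic_map_projective_limits:
  assumes bij: "bij_betw g E E'"
    and XE: "\<And>i x. i \<in> I \<Longrightarrow> x \<in> E \<Longrightarrow> \<pi> i x \<in> topspace (X i)"
    and YE: "\<And>j y. j \<in> J \<Longrightarrow> y \<in> E' \<Longrightarrow> \<pi>' j y \<in> topspace (Y j)"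
    and fwd: "\<And>j. j \<in> J \<Longrightarrow> \<exists>i\<in>I. \<exists>h. continuous_map (X i) (Y j) h \<and> (\<forall>x\<in>E. h (\<pi> i x) = \<pi>' j (g x))"
    and bwd: "\<And>i. i \<in> I \<Longrightarrow> \<exists>j\<in>J. \<exists>k. continuous_map (Y j) (X i) k \<and> (\<forall>x\<in>E. k (\<pi>' j (g x)) = \<pi> i x)"
  shows "homeomorphic_map (projective_limit_topology E I X \<pi>) (projective_limit_topology E' J Y \<pi>') g"
    (is "homeomorphic_map ?X ?Y g")
proof -
  have gE: "g x \<in> E'" if "x \<in> E" for x using bij that by (rule bij_betw_apply)
  have iE: "inv_into E g y \<in> E" "g (inv_into E g y) = y" if "y \<in> E'" for y
    using bij that by (auto simp: bij_betw_def inv_into_into f_inv_into_f)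
  have "continuous_map ?X ?Y g"
  proof (rule continuous_map_into_projective_limit)
    fix j assume j: "j \<in> J"
    obtain i h where h: "i \<in> I" "continuous_map (X i) (Y j) h" "\<And>x. x \<in> E \<Longrightarrow> h (\<pi> i x) = \<pi>' j (g x)"
      using fwd [OF j] by blast
    have "continuous_map ?X (X i) (\<pi> i)"
      by (rule continuous_map_projection) (use XE h in auto)
    then have "continuous_map ?X (Y j) (h \<circ> \<pi> i)"
      by (rule continuous_map_compose) (rule h(2))
    then show "continuous_map ?X (Y j) (\<lambda>x. \<pi>' j (g x))"
      by (rule continuous_map_eq) (use h(3) in auto)
  qed (use gE in auto)
  moreover have "continuous_map ?Y ?X (inv_into E g)"
  proof (rule continuous_map_into_projective_limit)
    fix i assume i: "i \<in> I"
    obtain j k where k: "j \<in> J" "continuous_map (Y j) (X i) k" "\<And>x. x \<in> E \<Longrightarrow> k (\<pi>' j (g x)) = \<pi> i x"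
      using bwd [OF i] by blast
    have "continuous_map ?Y (Y j) (\<pi>' j)"
      by (rule continuous_map_projection) (use YE k in auto)
    then have "continuous_map ?Y (X i) (k \<circ> \<pi>' j)"
      by (rule continuous_map_compose) (rule k(2))
    then show "continuous_map ?Y (X i) (\<lambda>y. \<pi> i (inv_into E g y))"
    proof (rule continuous_map_eq)
      fix y assume "y \<in> topspace ?Y"
      then have "y \<in> E'" by simp
      then show "(k \<circ> \<pi>' j) y = \<pi> i (inv_into E g y)" using k(3) [of "inv_into E g y"] iE by simp
    qed
  qed (use iE in auto)
  ultimately have "homeomorphic_maps ?X ?Y g (inv_into E g)"
    unfolding homeomorphic_maps_def using bij iE by (auto simp: bij_betw_def)
  then show ?thesis unfolding homeomorphic_map_maps by blast
qed

text \<open>Vector spaces are carrier sets with explicitly given operations, as in the definition of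
  the inductive limit topology.  The predicate includes that the
  source is closed under the operations; for a bijection this passes to the target.\<close>

definition linear_between where
  "linear_between add scl E add' scl' E' g \<longleftrightarrow>
     (\<forall>x\<in>E. \<forall>y\<in>E. add x y \<in> E) \<and> (\<forall>a. \<forall>x\<in>E. scl a x \<in> E) \<and> (\<forall>x\<in>E. g x \<in> E') \<and>
     (\<forall>x\<in>E. \<forall>y\<in>E. g (add x y) = add' (g x) (g y)) \<and> (\<forall>a. \<forall>x\<in>E. g (scl a x) = scl' a (g x))"

lemma linear_between_inv_into:
  assumes lin: "linear_between add scl E add' scl' E' g" and bij: "bij_betw g E E'"
  shows "linear_between add' scl' E' add scl E (inv_into E g)"
proof -
  have iE: "inv_into E g y \<in> E" "g (inv_into E g y) = y" if "y \<in> E'" for y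
    using bij that by (auto simp: bij_betw_def inv_into_into f_inv_into_f)
  have ig: "inv_into E g (g x) = x" if "x \<in> E" for x
    using bij that by (auto simp: bij_betw_def)
  let ?i = "inv_into E g"
  have add: "add' x y = g (add (?i x) (?i y))" "add (?i x) (?i y) \<in> E" if "x \<in> E'" "y \<in> E'" for x y
    using lin iE that unfolding linear_between_def by auto
  have scl: "scl' a x = g (scl a (?i x))" "scl a (?i x) \<in> E" if "x \<in> E'" for a x
    using lin iE that unfolding linear_between_def by auto
  have gE: "g x \<in> E'" if "x \<in> E" for x using lin that unfolding linear_between_def by auto
  show ?thesis
    unfolding linear_between_def using add scl ig gE iE by auto
qed

text \<open>Pulling back a locally convex topology along a linear map gives a locally convex topology.
  Thus every competitor in the supremum defining an inductive limit topology on the target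
  yields a competitor on the source.\<close>

lemma locally_convex_pullback:
  assumes lc: "locally_convex_topology add' scl' T'"
    and lin: "linear_between add scl E add' scl' (topspace T') g"
  shows "locally_convex_topology add scl (pullback_topology E g T')"
    and "topspace (pullback_topology E g T') = E"
proof -
  let ?T = "pullback_topology E g T'"
  show top: "topspace ?T = E"
    using lin by (auto simp: topspace_pullback_topology linear_between_def)
  have g: "continuous_map ?T T' g"
    using continuous_map_pullback [OF continuous_map_id, of E g T'] by simp
  have into: "continuous_map Z ?T k" if "continuous_map Z T' (\<lambda>z. g (k z))" "\<And>z. z \<in> topspace Z \<Longrightarrow> k z \<in> E" for Z k
    by (rule continuous_map_pullback') (use that in \<open>auto simp: o_def\<close>)
  have "continuous_map (prod_topology ?T ?T) T' ((\<lambda>(x, y). add' x y) \<circ> (\<lambda>(x, y). (g x, g y)))"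
    by (rule continuous_map_compose [of _ "prod_topology T' T'"])
      (use lc g in \<open>auto simp: locally_convex_topology_def continuous_map_prod_top\<close>)
  then have "continuous_map (prod_topology ?T ?T) T' (\<lambda>p. g ((\<lambda>(x, y). add x y) p))"
    by (rule continuous_map_eq) (use lin top in \<open>auto simp: linear_between_def\<close>)
  then have add: "continuous_map (prod_topology ?T ?T) ?T (\<lambda>(x, y). add x y)"
    by (rule into) (use lin top in \<open>auto simp: linear_between_def\<close>)
  have "continuous_map (prod_topology euclidean ?T) T' ((\<lambda>(a, x). scl' a x) \<circ> (\<lambda>(a, x). (id a, g x)))"
    by (rule continuous_map_compose [of _ "prod_topology euclidean T'"])
      (use lc g in \<open>auto simp: locally_convex_topology_def continuous_map_prod_top simp del: id_apply\<close>)
  then have "continuous_map (prod_topology euclidean ?T) T' (\<lambda>p. g ((\<lambda>(a, x). scl a x) p))"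
    by (rule continuous_map_eq) (use lin top in \<open>auto simp: linear_between_def\<close>)
  then have scl: "continuous_map (prod_topology euclidean ?T) ?T (\<lambda>(a, x). scl a x)"
    by (rule into) (use lin top in \<open>auto simp: linear_between_def\<close>)
  have conv: "\<exists>V C. openin ?T V \<and> x \<in> V \<and> V \<subseteq> C \<and> C \<subseteq> U \<and>
      (\<forall>y\<in>C. \<forall>z\<in>C. \<forall>t::real. 0 \<le> t \<and> t \<le> 1 \<longrightarrow>
         add (scl (of_real t) y) (scl (of_real (1 - t)) z) \<in> C)"
    if U: "openin ?T U" "x \<in> U" for U x
  proof -
    obtain U' where U': "openin T' U'" "U = g -` U' \<inter> E"
      using U(1) unfolding openin_pullback_topology by blast
    then have "openin T' U' \<and> g x \<in> U'" using U(2) by auto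
    then obtain V C where VC: "openin T' V" "g x \<in> V" "V \<subseteq> C" "C \<subseteq> U'"
      "\<forall>y\<in>C. \<forall>z\<in>C. \<forall>t::real. 0 \<le> t \<and> t \<le> 1 \<longrightarrow>
         add' (scl' (of_real t) y) (scl' (of_real (1 - t)) z) \<in> C"
      using lc unfolding locally_convex_topology_def by meson
    have "openin ?T (g -` V \<inter> E)" using VC(1) unfolding openin_pullback_topology by blast
    moreover have "add (scl (of_real t) y) (scl (of_real (1 - t)) z) \<in> g -` C \<inter> E"
      if "y \<in> g -` C \<inter> E" "z \<in> g -` C \<inter> E" "0 \<le> t" "t \<le> 1" for y z t
      using VC(5) that lin unfolding linear_between_def by auto
    ultimately show ?thesis
      using VC U' U(2) by (intro exI [of _ "g -` V \<inter> E"] exI [of _ "g -` C \<inter> E"]) auto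
  qed
  show "locally_convex_topology add scl ?T"
    unfolding locally_convex_topology_def using add scl conv by blast
qed

lemma continuous_map_from_inductive_limit:
  assumes lc: "locally_convex_topology add' scl' T'"
    and lin: "linear_between add scl E add' scl' (topspace T') g"
    and \<iota>: "\<And>i x. i \<in> I \<Longrightarrow> x \<in> topspace (X i) \<Longrightarrow> \<iota> i x \<in> E"
    and cont: "\<And>i. i \<in> I \<Longrightarrow> continuous_map (X i) T' (\<lambda>x. g (\<iota> i x))"
  shows "continuous_map (inductive_limit_topology add scl E I X \<iota>) T' g"
  unfolding continuous_map_def topspace_inductive_limit_topology
proof (intro conjI allI impI)
  show "g \<in> E \<rightarrow> topspace T'" using lin by (auto simp: linear_between_def)
  fix U assume U: "openin T' U"
  let ?T = "pullback_topology E g T'"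
  have "continuous_map (X i) ?T (\<iota> i)" if "i \<in> I" for i
    by (rule continuous_map_pullback') (use that cont \<iota> in \<open>auto simp: o_def\<close>)
  moreover have "openin ?T (g -` U \<inter> E)" using U unfolding openin_pullback_topology by blast
  ultimately have "openin (inductive_limit_topology add scl E I X \<iota>) (g -` U \<inter> E)"
    unfolding inductive_limit_topology_def
    by (intro topology_generated_by_Basis insertI2 CollectI exI [of _ ?T])
      (use locally_convex_pullback [OF lc lin] in auto)
  moreover have "g -` U \<inter> E = {x \<in> E. g x \<in> U}" by auto
  ultimately show "openin (inductive_limit_topology add scl E I X \<iota>) {x \<in> E. g x \<in> U}" by simp
qed

lemma continuous_map_into_inductive_limit:
  assumes g: "\<And>z. z \<in> topspace Z \<Longrightarrow> g z \<in> E"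
    and cont: "\<And>T. topspace T = E \<Longrightarrow> locally_convex_topology add scl T \<Longrightarrow>
      (\<And>i. i \<in> I \<Longrightarrow> continuous_map (X i) T (\<iota> i)) \<Longrightarrow> continuous_map Z T g"
  shows "continuous_map Z (inductive_limit_topology add scl E I X \<iota>) g"
  unfolding inductive_limit_topology_def continuous_on_generated_topo_iff
proof (intro conjI allI impI)
  fix U assume "U \<in> insert E {U. \<exists>T. topspace T = E \<and> locally_convex_topology add scl T \<and>
      (\<forall>i\<in>I. continuous_map (X i) T (\<iota> i)) \<and> openin T U}"
  then consider "U = E" | T where "topspace T = E" "locally_convex_topology add scl T"
      "\<forall>i\<in>I. continuous_map (X i) T (\<iota> i)" "openin T U" by blast
  then show "openin Z (g -` U \<inter> topspace Z)"
  proof cases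
    case 1
    then have "g -` U \<inter> topspace Z = topspace Z" using g by auto
    then show ?thesis by simp
  next
    case 2
    then have "continuous_map Z T g" using cont by blast
    then have "openin Z {z \<in> topspace Z. g z \<in> U}"
      using 2(4) by (rule openin_continuous_map_preimage)
    moreover have "g -` U \<inter> topspace Z = {z \<in> topspace Z. g z \<in> U}" by auto
    ultimately show ?thesis by simp
  qed
qed (use g in auto)

lemma continuous_map_inclusion_inductive_limit:
  assumes "i \<in> I" "\<And>x. x \<in> topspace (X i) \<Longrightarrow> \<iota> i x \<in> E"
  shows "continuous_map (X i) (inductive_limit_topology add scl E I X \<iota>) (\<iota> i)"
  by (rule continuous_map_into_inductive_limit) (use assms in auto)

lemma continuous_map_inductive_limits:
  assumes lin: "linear_between add scl E add' scl' E' g"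
    and \<iota>: "\<And>i x. i \<in> I \<Longrightarrow> x \<in> topspace (X i) \<Longrightarrow> \<iota> i x \<in> E"
    and fwd: "\<And>i. i \<in> I \<Longrightarrow> \<exists>j\<in>J. \<exists>h. continuous_map (X i) (Y j) h \<and>
      (\<forall>x\<in>topspace (X i). g (\<iota> i x) = \<kappa> j (h x))"
  shows "continuous_map (inductive_limit_topology add scl E I X \<iota>)
    (inductive_limit_topology add' scl' E' J Y \<kappa>) g"
proof (rule continuous_map_into_inductive_limit)
  fix T assume T: "topspace T = E'" "locally_convex_topology add' scl' T"
    "\<And>j. j \<in> J \<Longrightarrow> continuous_map (Y j) T (\<kappa> j)"
  show "continuous_map (inductive_limit_topology add scl E I X \<iota>) T g"
  proof (rule continuous_map_from_inductive_limit [OF T(2)])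
    fix i assume "i \<in> I"
    from fwd [OF this] obtain j h where h: "j \<in> J" "continuous_map (X i) (Y j) h"
      "\<forall>x\<in>topspace (X i). g (\<iota> i x) = \<kappa> j (h x)" by blast
    have "continuous_map (X i) T (\<kappa> j \<circ> h)"
      by (rule continuous_map_compose [OF h(2) T(3) [OF h(1)]])
    then show "continuous_map (X i) T (\<lambda>x. g (\<iota> i x))"
      by (rule continuous_map_eq) (simp add: h(3))
  qed (use lin T \<iota> in auto)
qed (use lin in \<open>auto simp: linear_between_def\<close>)

text \<open>The dual zigzag: every step of either system maps continuously into some step of the other.\<close>

lemma homeomorphic_map_inductive_limits:
  assumes lin: "linear_between add scl E add' scl' E' g" and bij: "bij_betw g E E'"
    and \<iota>: "\<And>i x. i \<in> I \<Longrightarrow> x \<in> topspace (X i) \<Longrightarrow> \<iota> i x \<in> E"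
    and \<kappa>: "\<And>j y. j \<in> J \<Longrightarrow> y \<in> topspace (Y j) \<Longrightarrow> \<kappa> j y \<in> E'"
    and fwd: "\<And>i. i \<in> I \<Longrightarrow> \<exists>j\<in>J. \<exists>h. continuous_map (X i) (Y j) h \<and>
      (\<forall>x\<in>topspace (X i). g (\<iota> i x) = \<kappa> j (h x))"
    and bwd: "\<And>j. j \<in> J \<Longrightarrow> \<exists>i\<in>I. \<exists>k. continuous_map (Y j) (X i) k \<and>
      (\<forall>y\<in>topspace (Y j). g (\<iota> i (k y)) = \<kappa> j y)"
  shows "homeomorphic_map (inductive_limit_topology add scl E I X \<iota>)
    (inductive_limit_topology add' scl' E' J Y \<kappa>) g"
    (is "homeomorphic_map ?X ?Y g")
proof -
  have 1: "continuous_map ?X ?Y g"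
    by (rule continuous_map_inductive_limits [OF lin \<iota> fwd])
  have 2: "continuous_map ?Y ?X (inv_into E g)"
  proof (rule continuous_map_inductive_limits [OF linear_between_inv_into [OF lin bij] \<kappa>])
    fix j assume "j \<in> J"
    from bwd [OF this] obtain i k where k: "i \<in> I" "continuous_map (Y j) (X i) k"
      "\<forall>y\<in>topspace (Y j). g (\<iota> i (k y)) = \<kappa> j y" by blast
    have "inv_into E g (\<kappa> j y) = \<iota> i (k y)" if y: "y \<in> topspace (Y j)" for y
    proof -
      have "k y \<in> topspace (X i)" using k(2) y by (auto simp: continuous_map_def)
      then have "\<iota> i (k y) \<in> E" using \<iota> k(1) by blast
      then show ?thesis using k(3) y bij by (metis bij_betw_inv_into_left)
    qed
    then show "\<exists>i\<in>I. \<exists>h. continuous_map (Y j) (X i) h \<and> (\<forall>x\<in>topspace (Y j). inv_into E g (\<kappa> j x) = \<iota> i (h x))"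
      using k by blast
  qed
  have "homeomorphic_maps ?X ?Y g (inv_into E g)"
    unfolding homeomorphic_maps_def using bij 1 2
    by (auto simp: bij_betw_def f_inv_into_f)
  then show ?thesis unfolding homeomorphic_map_maps by blast
qed

text \<open>Linear functionals on an inductive limit are covered by the continuity criterion for maps into
  locally convex spaces once the scalar field is recognised as such a space.\<close>

lemma locally_convex_complex: "locally_convex_topology (+) (*) (euclidean :: complex topology)"
  unfolding locally_convex_topology_def
proof (intro conjI allI impI)
  show "continuous_map (prod_topology euclidean euclidean) euclidean (\<lambda>(x, y). x + y :: complex)"
    "continuous_map (prod_topology euclidean euclidean) euclidean (\<lambda>(x, y). x * y :: complex)"
    by (auto simp: case_prod_unfold intro!: continuous_intros)
  fix U and x :: complex assume "openin euclidean U \<and> x \<in> U"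
  then obtain e where e: "0 < e" "ball x e \<subseteq> U" using open_contains_ball by (metis open_openin)
  have "of_real t * y + of_real (1 - t) * z \<in> ball x e"
    if "y \<in> ball x e" "z \<in> ball x e" "0 \<le> t" "t \<le> 1" for y z t
    using convexD [OF convex_ball that(1,2), of t "1 - t"] that by (simp add: scaleR_conv_of_real)
  then show "\<exists>V C. openin euclidean V \<and> x \<in> V \<and> V \<subseteq> C \<and> C \<subseteq> U \<and>
      (\<forall>y\<in>C. \<forall>z\<in>C. \<forall>t::real. 0 \<le> t \<and> t \<le> 1 \<longrightarrow> of_real t * y + of_real (1 - t) * z \<in> C)"
    using e by (intro exI [of _ "ball x e"]) auto
qed

lemma Hausdorff_space_separating_functions:
  fixes f :: "'i \<Rightarrow> 'a \<Rightarrow> complex"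
  assumes cont: "\<And>i. continuous_map X euclidean (f i)"
    and sep: "\<And>x y. x \<in> topspace X \<Longrightarrow> y \<in> topspace X \<Longrightarrow> (\<And>i. f i x = f i y) \<Longrightarrow> x = y"
  shows "Hausdorff_space X"
  unfolding Hausdorff_space_def
proof (intro allI impI)
  fix x y assume xy: "x \<in> topspace X \<and> y \<in> topspace X \<and> x \<noteq> y"
  then obtain i where "f i x \<noteq> f i y" using sep by blast
  from hausdorff [OF this] obtain U V where
    UV: "open U" "open V" "f i x \<in> U" "f i y \<in> V" "U \<inter> V = {}" by blast
  have "openin X {z \<in> topspace X. f i z \<in> U}" "openin X {z \<in> topspace X. f i z \<in> V}"
    using openin_continuous_map_preimage [OF cont] UV by auto
  then show "\<exists>U V. openin X U \<and> openin X V \<and> x \<in> U \<and> y \<in> V \<and> disjnt U V"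
    by (intro exI [of _ "{z \<in> topspace X. f i z \<in> U}"] exI [of _ "{z \<in> topspace X. f i z \<in> V}"])
      (use UV xy in \<open>auto simp: disjnt_def\<close>)
qed

text \<open>A map with dense domain has at most one continuous extension into a Hausdorff space, and
  the target of a homeomorphism is Hausdorff when its source is.  Uniqueness is therefore a
  property of the source space alone.\<close>

lemma extends_uniquely_to_homeomorphismI:
  assumes D: "D \<subseteq> topspace X" "topspace X \<subseteq> X closure_of D" and X: "Hausdorff_space X"
    and g: "homeomorphic_map X Y g" "\<And>x. x \<in> D \<Longrightarrow> g x = f x"
  shows "extends_uniquely_to_homeomorphism f D X Y"
proof -
  have Y: "Hausdorff_space Y"
    using X g(1) homeomorphic_Hausdorff_space homeomorphic_map_imp_homeomorphic_space by blast
  have "h x = g x" if h: "homeomorphic_map X Y h" "\<forall>x\<in>D. h x = f x" and x: "x \<in> topspace X" for h x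
  proof (rule forall_in_closure_of_eq [where f = h and g = g and x = x, OF _ Y])
    show "x \<in> X closure_of D" using D x by blast
    show "continuous_map X Y h" "continuous_map X Y g"
      using h(1) g(1) by (auto dest: homeomorphic_imp_continuous_map)
    show "\<And>x. x \<in> D \<Longrightarrow> h x = g x" using h g by auto
  qed
  then show ?thesis unfolding extends_uniquely_to_homeomorphism_def using D g by blast
qed

lemma dense_if_limits:
  assumes "\<And>x. x \<in> topspace X \<Longrightarrow> \<exists>u. (\<forall>n::nat. u n \<in> D) \<and> limitin X u x sequentially"
  shows "topspace X \<subseteq> X closure_of D"
proof
  fix x assume x: "x \<in> topspace X"
  from assms [OF x] obtain u where u: "\<forall>n. u n \<in> D" "limitin X u x sequentially" by blast
  show "x \<in> X closure_of D"
    unfolding in_closure_of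
  proof (intro conjI allI impI x)
    fix T assume T: "x \<in> T \<and> openin X T"
    then have "\<forall>\<^sub>F n in sequentially. u n \<in> T" using u(2) unfolding limitin_def by blast
    then obtain n where "u n \<in> T" by (meson eventually_happens sequentially_bot)
    then show "\<exists>y. y \<in> D \<and> y \<in> T" using u(1) by blast
  qed
qed

section \<open>Weighted sequence spaces\<close>

lemma norm_le_lp_norm:
  assumes p: "0 < p" and a: "in_lp p a"
  shows "norm (a i) \<le> lp_norm p a"
proof (cases "p = \<infinity>")
  case True
  then show ?thesis using a by (auto simp: in_lp_def lp_norm_def intro!: cSUP_upper)
next
  case False
  then obtain q where q: "p = ereal q" "0 < q" using p by (cases p) auto
  have summ: "(\<lambda>i. norm (a i) powr q) summable_on UNIV" using a q by (simp add: in_lp_def)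
  have "sum (\<lambda>i. norm (a i) powr q) {i} \<le> (\<Sum>\<^sub>\<infinity>i. norm (a i) powr q)"
    by (rule finite_sum_le_infsum) (use summ in auto)
  then have "(norm (a i) powr q) powr (1 / q) \<le> (\<Sum>\<^sub>\<infinity>i. norm (a i) powr q) powr (1 / q)"
    using q by (intro powr_mono2) auto
  then show ?thesis using q by (simp add: lp_norm_def powr_powr)
qed

text \<open>Geometric decay puts a sequence into every \<open>\<ell>\<^sup>p\<close>.  Since the weights for different
  parameters differ by geometric factors, all exponents \<open>p\<close> lead to the same limit spaces.\<close>

lemma in_lp_geometric:
  assumes p: "0 < p" and s: "0 \<le> s" "s < 1"
  shows "\<exists>C\<ge>0. \<forall>M\<ge>0. \<forall>a :: 'd::finite multiindex \<Rightarrow> complex.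
    (\<forall>\<alpha>. norm (a \<alpha>) \<le> M * s ^ mlength \<alpha>) \<longrightarrow> in_lp p a \<and> lp_norm p a \<le> C * M"
proof (cases "p = \<infinity>")
  case True
  show ?thesis
  proof (intro exI [of _ 1] conjI allI impI)
    fix M :: real and a :: "'d multiindex \<Rightarrow> complex"
    assume M: "0 \<le> M" and "\<forall>\<alpha>. norm (a \<alpha>) \<le> M * s ^ mlength \<alpha>"
    then have a: "norm (a \<alpha>) \<le> M * s ^ mlength \<alpha>" for \<alpha> by blast
    have "norm (a \<alpha>) \<le> M" for \<alpha>
      using a [of \<alpha>] mult_left_mono [OF power_le_one [OF s(1) less_imp_le [OF s(2)]] M, of "mlength \<alpha>"]
      by simp
    then show "in_lp p a" "lp_norm p a \<le> 1 * M"
      using True by (auto simp: in_lp_def lp_norm_def intro!: bdd_aboveI2 cSUP_least)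
  qed simp
next
  case False
  then obtain q where q: "p = ereal q" "0 < q" using p by (cases p) auto
  define G where "G = (\<Sum>\<^sub>\<infinity>\<alpha> :: 'd multiindex. (s powr q) ^ mlength \<alpha>)"
  have sq: "0 \<le> s powr q" "s powr q < 1" using s q powr_less_mono2 [of q s 1] by auto
  have summ: "(\<lambda>\<alpha> :: 'd multiindex. (s powr q) ^ mlength \<alpha>) summable_on UNIV"
    by (rule geometric_summable_on [OF sq])
  have G: "0 \<le> G" unfolding G_def by (rule infsum_nonneg) (use sq in auto)
  have pw: "(s ^ n) powr q = (s powr q) ^ n" for n
    by (induction n) (use s in \<open>auto simp: powr_mult\<close>)
  show ?thesis
  proof (intro exI [of _ "G powr (1 / q)"] conjI allI impI)
    fix M :: real and a :: "'d multiindex \<Rightarrow> complex"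
    assume M: "0 \<le> M" and "\<forall>\<alpha>. norm (a \<alpha>) \<le> M * s ^ mlength \<alpha>"
    then have a: "norm (a \<alpha>) \<le> M * s ^ mlength \<alpha>" for \<alpha> by blast
    have le: "norm (a \<alpha>) powr q \<le> M powr q * (s powr q) ^ mlength \<alpha>" for \<alpha>
    proof -
      have "norm (a \<alpha>) powr q \<le> (M * s ^ mlength \<alpha>) powr q"
        using a q by (intro powr_mono2) auto
      also have "\<dots> = M powr q * (s ^ mlength \<alpha>) powr q" using M s by (simp add: powr_mult)
      also have "(s ^ mlength \<alpha>) powr q = (s powr q) ^ mlength \<alpha>" by (rule pw)
      finally show ?thesis .
    qed
    have summ': "(\<lambda>\<alpha>. M powr q * (s powr q) ^ mlength \<alpha>) summable_on (UNIV :: 'd multiindex set)"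
      by (rule summable_on_cmult_right [OF summ])
    have in_lp: "(\<lambda>\<alpha>. norm (a \<alpha>) powr q) summable_on UNIV"
      by (rule summable_on_comparison_test [OF summ']) (use le in auto)
    have "(\<Sum>\<^sub>\<infinity>\<alpha>. norm (a \<alpha>) powr q) \<le> (\<Sum>\<^sub>\<infinity>\<alpha> :: 'd multiindex. M powr q * (s powr q) ^ mlength \<alpha>)"
      by (rule infsum_mono [OF in_lp summ']) (rule le)
    also have "\<dots> = M powr q * G" unfolding G_def by (rule infsum_cmult_right')
    finally have "(\<Sum>\<^sub>\<infinity>\<alpha>. norm (a \<alpha>) powr q) powr (1 / q) \<le> (M powr q * G) powr (1 / q)"
      using q by (intro powr_mono2) (auto intro: infsum_nonneg)
    also have "\<dots> = G powr (1 / q) * M" using q M G by (simp add: powr_mult powr_powr)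
    finally show "lp_norm p a \<le> G powr (1 / q) * M" using q by (simp add: lp_norm_def)
    show "in_lp p a" using in_lp q by (simp add: in_lp_def)
  qed simp
qed

text \<open>For the indices \<open>\<flat>\<^sub>\<sigma>\<close>, including \<open>\<flat>\<^sub>\<infinity> = 1/2\<close>, the weights have the common form
  \<open>b\<^sup>\<bar>\<^sup>\<alpha>\<^sup>\<bar> (\<alpha>!)\<^sup>e\<close>.\<close>

definition flat_base :: "ereal \<Rightarrow> real \<Rightarrow> real" where
  "flat_base \<sigma> r = (if \<sigma> = \<infinity> then exp r else r)"

definition flat_exponent :: "ereal \<Rightarrow> real" where
  "flat_exponent \<sigma> = (if \<sigma> = \<infinity> then 0 else 1 / (2 * real_of_ereal \<sigma>))"

lemma weight_theta_flat:
  "weight_theta r (flat \<sigma>) \<alpha> = flat_base \<sigma> r ^ mlength \<alpha> * mfact \<alpha> powr flat_exponent \<sigma>"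
  by (simp add: flat_def flat_base_def flat_exponent_def exp_of_nat2_mult)

lemma flat_base_pos: "0 < r \<Longrightarrow> 0 < flat_base \<sigma> r"
  by (simp add: flat_base_def)

lemma flat_base_less: "r < r' \<Longrightarrow> flat_base \<sigma> r < flat_base \<sigma> r'"
  by (simp add: flat_base_def)

lemma flat_base_exceeds: obtains r where "0 < r" "B < flat_base \<sigma> r"
proof
  show "0 < \<bar>B\<bar> + 1" by simp
  show "B < flat_base \<sigma> (\<bar>B\<bar> + 1)"
    using exp_ge_add_one_self [of "\<bar>B\<bar> + 1"] unfolding flat_base_def by (simp; linarith)
qed

lemma weight_theta_pos: "0 < r \<Longrightarrow> 0 < weight_theta r (flat \<sigma>) \<alpha>"
  by (simp add: weight_theta_flat flat_base_pos)

abbreviation weighted_norm :: "ereal \<Rightarrow> ereal \<Rightarrow> real \<Rightarrow> 'd::finite formal_series \<Rightarrow> real" where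
  "weighted_norm p \<sigma> r c \<equiv> lp_norm p (\<lambda>\<alpha>. c \<alpha> * of_real (1 / weight_theta r (flat \<sigma>) \<alpha>))"

abbreviation weighted_space :: "ereal \<Rightarrow> ereal \<Rightarrow> real \<Rightarrow> 'd::finite formal_series set" where
  "weighted_space p \<sigma> r \<equiv> weighted_lp p (\<lambda>\<alpha>. 1 / weight_theta r (flat \<sigma>) \<alpha>)"

abbreviation weighted_topology :: "ereal \<Rightarrow> ereal \<Rightarrow> real \<Rightarrow> 'd::finite formal_series topology" where
  "weighted_topology p \<sigma> r \<equiv> weighted_lp_topology p (\<lambda>\<alpha>. 1 / weight_theta r (flat \<sigma>) \<alpha>)"

text \<open>The pointwise form of membership in a weighted space, in which the exponent \<open>p\<close> no longer
  occurs.  A weighted norm controls \<open>M\<close>; conversely \<open>M\<close> controls every weighted norm belonging to a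
  strictly larger base.\<close>

definition coeff_growth :: "real \<Rightarrow> real \<Rightarrow> real \<Rightarrow> 'd::finite formal_series \<Rightarrow> bool" where
  "coeff_growth e B M c \<longleftrightarrow> (\<forall>\<alpha>. norm (c \<alpha>) \<le> M * (B ^ mlength \<alpha> * mfact \<alpha> powr e))"

lemma coeff_growth_weighted_norm:
  assumes "0 < p" "0 < r" "c \<in> weighted_space p \<sigma> r"
  shows "coeff_growth (flat_exponent \<sigma>) (flat_base \<sigma> r) (weighted_norm p \<sigma> r c) c"
    and "0 \<le> weighted_norm p \<sigma> r c"
proof -
  let ?a = "\<lambda>\<alpha>. c \<alpha> * of_real (1 / weight_theta r (flat \<sigma>) \<alpha>)"
  have le: "norm (?a \<alpha>) \<le> weighted_norm p \<sigma> r c" for \<alpha>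
    by (rule norm_le_lp_norm) (use assms in \<open>auto simp: weighted_lp_def\<close>)
  then show "0 \<le> weighted_norm p \<sigma> r c" using norm_ge_zero order_trans by blast
  have "norm (c \<alpha>) \<le> weighted_norm p \<sigma> r c * weight_theta r (flat \<sigma>) \<alpha>" for \<alpha>
    using le [of \<alpha>] weight_theta_pos [OF assms(2), of \<sigma> \<alpha>]
    by (simp add: norm_mult norm_divide pos_divide_le_eq)
  then show "coeff_growth (flat_exponent \<sigma>) (flat_base \<sigma> r) (weighted_norm p \<sigma> r c) c"
    by (simp add: coeff_growth_def weight_theta_flat)
qed

lemma weighted_norm_coeff_growth:
  assumes p: "0 < p" and r: "0 < r" and B: "0 < B" "B < flat_base \<sigma> r"
  shows "\<exists>C\<ge>0. \<forall>M\<ge>0. \<forall>c :: 'd::finite formal_series. coeff_growth (flat_exponent \<sigma>) B M c \<longrightarrow>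
    c \<in> weighted_space p \<sigma> r \<and> weighted_norm p \<sigma> r c \<le> C * M"
proof -
  define s where "s = B / flat_base \<sigma> r"
  have s: "0 \<le> s" "s < 1" using B flat_base_pos [OF r, of \<sigma>] by (auto simp: s_def)
  obtain C where C: "0 \<le> C" "\<forall>M\<ge>0. \<forall>a :: 'd multiindex \<Rightarrow> complex.
      (\<forall>\<alpha>. norm (a \<alpha>) \<le> M * s ^ mlength \<alpha>) \<longrightarrow> in_lp p a \<and> lp_norm p a \<le> C * M"
    using in_lp_geometric [OF p s] by blast
  show ?thesis
  proof (intro exI [of _ C] conjI allI impI C(1))
    fix M and c :: "'d formal_series"
    assume M: "0 \<le> M" and c: "coeff_growth (flat_exponent \<sigma>) B M c"
    have "norm (c \<alpha> * of_real (1 / weight_theta r (flat \<sigma>) \<alpha>)) \<le> M * s ^ mlength \<alpha>" for \<alpha>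
    proof -
      have "norm (c \<alpha>) \<le> M * (B ^ mlength \<alpha> * mfact \<alpha> powr flat_exponent \<sigma>)"
        using c by (simp add: coeff_growth_def)
      also have "\<dots> = M * s ^ mlength \<alpha> * weight_theta r (flat \<sigma>) \<alpha>"
        using flat_base_pos [OF r, of \<sigma>] by (simp add: weight_theta_flat s_def power_divide)
      finally show ?thesis
        using weight_theta_pos [OF r, of \<sigma> \<alpha>] by (simp add: norm_mult norm_divide pos_divide_le_eq)
    qed
    then show "c \<in> weighted_space p \<sigma> r" "weighted_norm p \<sigma> r c \<le> C * M"
      using C(2) M by (auto simp: weighted_lp_def)
  qed
qed

lemma coeff_growth_mono:
  assumes "coeff_growth e B M c" "0 \<le> B" "B \<le> B'" "M \<le> M'" "0 \<le> M'"
  shows "coeff_growth e B' M' c"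
  unfolding coeff_growth_def
proof
  fix \<alpha>
  have "norm (c \<alpha>) \<le> M * (B ^ mlength \<alpha> * mfact \<alpha> powr e)"
    using assms(1) by (simp add: coeff_growth_def)
  also have "\<dots> \<le> M' * (B' ^ mlength \<alpha> * mfact \<alpha> powr e)"
    using assms by (intro mult_mono power_mono) auto
  finally show "norm (c \<alpha>) \<le> M' * (B' ^ mlength \<alpha> * mfact \<alpha> powr e)" .
qed

lemma coeff_growth_add:
  "coeff_growth e B M c \<Longrightarrow> coeff_growth e B M' c' \<Longrightarrow> coeff_growth e B (M + M') (fun_add c c')"
  unfolding coeff_growth_def fun_add_def distrib_right
  by (intro allI order_trans [OF norm_triangle_ineq] add_mono) auto

lemma coeff_growth_scale:
  "coeff_growth e B M c \<Longrightarrow> coeff_growth e B (norm a * M) (fun_scale a c)"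
  unfolding coeff_growth_def fun_scale_def norm_mult mult.assoc by (simp add: mult_left_mono)

text \<open>For \<open>p < 1\<close> there is no triangle inequality, but \<open>\<bar>x - y\<bar>\<^sup>p \<le> 2\<^sup>p (\<bar>x\<bar>\<^sup>p + \<bar>y\<bar>\<^sup>p)\<close> holds for all
  finite \<open>p\<close> because \<open>\<bar>x - y\<bar>\<close> is at most twice the larger modulus.\<close>

lemma in_lp_diff:
  assumes "0 < p" "in_lp p a" "in_lp p b"
  shows "in_lp p (\<lambda>i. a i - b i)"
proof (cases "p = \<infinity>")
  case True
  obtain A B where "\<And>i. norm (a i) \<le> A" "\<And>i. norm (b i) \<le> B"
    using assms True by (auto simp: in_lp_def bdd_above_def)
  then have "norm (a i - b i) \<le> A + B" for i
    by (meson add_mono norm_triangle_le_diff)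
  then show ?thesis using True by (auto simp: in_lp_def intro!: bdd_aboveI2)
next
  case False
  then obtain q where q: "p = ereal q" "0 < q" using assms(1) by (cases p) auto
  have le: "norm (a i - b i) powr q \<le> 2 powr q * (norm (a i) powr q + norm (b i) powr q)" for i
  proof -
    have "norm (a i - b i) \<le> 2 * max (norm (a i)) (norm (b i))"
      using norm_triangle_ineq4 [of "a i" "b i"] by linarith
    then have "norm (a i - b i) powr q \<le> (2 * max (norm (a i)) (norm (b i))) powr q"
      using q by (intro powr_mono2) auto
    also have "\<dots> = 2 powr q * max (norm (a i)) (norm (b i)) powr q"
      by (simp add: powr_mult le_max_iff_disj)
    also have "max (norm (a i)) (norm (b i)) powr q \<le> norm (a i) powr q + norm (b i) powr q"
      by (simp add: max_def)
    finally show ?thesis by simp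
  qed
  have "(\<lambda>i. 2 powr q * (norm (a i) powr q + norm (b i) powr q)) summable_on UNIV"
    using assms q by (intro summable_on_cmult_right summable_on_add) (auto simp: in_lp_def)
  then have "(\<lambda>i. norm (a i - b i) powr q) summable_on UNIV"
    by (rule summable_on_comparison_test) (use le in auto)
  then show ?thesis using q by (simp add: in_lp_def)
qed

lemma weighted_space_diff:
  "0 < p \<Longrightarrow> c \<in> weighted_lp p w \<Longrightarrow> c' \<in> weighted_lp p w \<Longrightarrow> (\<lambda>\<alpha>. c \<alpha> - c' \<alpha>) \<in> weighted_lp p w"
  by (auto simp: weighted_lp_def left_diff_distrib intro: in_lp_diff)

lemma topspace_weighted_lp_topology [simp]: "topspace (weighted_lp_topology p w) = weighted_lp p w"
  by (simp add: weighted_lp_topology_def)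

lemma continuous_map_coeff:
  fixes \<alpha> :: "'d::finite multiindex"
  assumes p: "0 < p" and r: "0 < r"
  shows "continuous_map (weighted_topology p \<sigma> r) euclidean (\<lambda>c. c \<alpha>)"
  unfolding weighted_lp_topology_def
proof (rule continuous_map_seminorms_euclidean [OF singletonI])
  show "0 \<le> weight_theta r (flat \<sigma>) \<alpha>" using weight_theta_pos [OF r] less_imp_le by blast
  fix c c' :: "'d formal_series" assume "c \<in> weighted_space p \<sigma> r" "c' \<in> weighted_space p \<sigma> r"
  then have "(\<lambda>\<alpha>. c' \<alpha> - c \<alpha>) \<in> weighted_space p \<sigma> r" using p weighted_space_diff by blast
  from coeff_growth_weighted_norm(1) [OF p r this]
  show "norm (c' \<alpha> - c \<alpha>) \<le> weight_theta r (flat \<sigma>) \<alpha> * weighted_norm p \<sigma> r (\<lambda>\<alpha>. c' \<alpha> - c \<alpha>)"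
    by (simp add: coeff_growth_def weight_theta_flat mult.commute)
qed

definition truncate :: "nat \<Rightarrow> 'd::finite formal_series \<Rightarrow> 'd formal_series" where
  "truncate n c = (\<lambda>\<alpha>. if mlength \<alpha> \<le> n then c \<alpha> else 0)"

lemma truncate_finite_series: "truncate n c \<in> finite_series"
  unfolding finite_series_def truncate_def
  by (auto intro: finite_subset [OF _ finite_mlength_le [of n]])

lemma coeff_growth_truncate:
  assumes "coeff_growth e B M c" "0 \<le> B" "0 \<le> M"
  shows "coeff_growth e B M (truncate n c)"
  using assms by (auto simp: coeff_growth_def truncate_def)

text \<open>A geometric loss in the weight makes truncations converge, so finite series are dense in both
  kinds of limits.\<close>

lemma limitin_truncate:
  fixes c :: "'d::finite formal_series"
  assumes p: "0 < p" and r: "0 < r" and B: "0 < B" "B < flat_base \<sigma> r" and M: "0 \<le> M"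
    and c: "coeff_growth (flat_exponent \<sigma>) B M c"
  shows "limitin (weighted_topology p \<sigma> r) (\<lambda>n. truncate n c) c sequentially"
  unfolding weighted_lp_topology_def
proof (rule limitin_seminorms)
  let ?e = "flat_exponent \<sigma>" and ?b = "flat_base \<sigma> r"
  note b = flat_base_pos [OF r, of \<sigma>]
  show c_in: "c \<in> weighted_space p \<sigma> r"
    using weighted_norm_coeff_growth [OF p r B] c M by blast
  show t_in: "truncate n c \<in> weighted_space p \<sigma> r" for n
    using weighted_norm_coeff_growth [OF p r B] coeff_growth_truncate [OF c less_imp_le [OF B(1)] M] M
    by blast
  \<comment> \<open>Half of the geometric decay is spent on smallness of the tail, half on its summability.\<close>
  define s where "s = sqrt (B / ?b)"
  have s: "0 < s" "s < 1" "s * s = B / ?b" using B b by (auto simp: s_def)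
  have sb: "0 < s * ?b" "s * ?b < ?b" using s b by auto
  obtain C where C: "0 \<le> C" "\<forall>M\<ge>0. \<forall>d :: 'd formal_series. coeff_growth ?e (s * ?b) M d \<longrightarrow>
      d \<in> weighted_space p \<sigma> r \<and> weighted_norm p \<sigma> r d \<le> C * M"
    using weighted_norm_coeff_growth [OF p r sb] by blast
  have tail: "coeff_growth ?e (s * ?b) (M * s ^ n) (\<lambda>\<alpha>. truncate n c \<alpha> - c \<alpha>)" for n
    unfolding coeff_growth_def
  proof
    fix \<alpha>
    show "norm (truncate n c \<alpha> - c \<alpha>) \<le> M * s ^ n * ((s * ?b) ^ mlength \<alpha> * mfact \<alpha> powr ?e)"
    proof (cases "mlength \<alpha> \<le> n")
      case True
      then show ?thesis using M s b by (simp add: truncate_def)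
    next
      case False
      have "norm (truncate n c \<alpha> - c \<alpha>) = norm (c \<alpha>)" using False by (simp add: truncate_def)
      also have "\<dots> \<le> M * (B ^ mlength \<alpha> * mfact \<alpha> powr ?e)" using c by (simp add: coeff_growth_def)
      also have "B = s * (s * ?b)" using s(3) b by (simp add: mult.assoc [symmetric])
      also have "M * ((s * (s * ?b)) ^ mlength \<alpha> * mfact \<alpha> powr ?e)
          = s ^ mlength \<alpha> * (M * ((s * ?b) ^ mlength \<alpha> * mfact \<alpha> powr ?e))"
        by (simp add: power_mult_distrib)
      also have "\<dots> \<le> s ^ n * (M * ((s * ?b) ^ mlength \<alpha> * mfact \<alpha> powr ?e))"
        using False s M b by (intro mult_right_mono power_decreasing) auto
      finally show ?thesis by (simp add: mult_ac)
    qed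
  qed
  fix q assume "q \<in> {\<lambda>d :: 'd formal_series. weighted_norm p \<sigma> r d}"
  then have q: "q = (\<lambda>d. weighted_norm p \<sigma> r d)" by simp
  show "(\<lambda>n. q (\<lambda>\<alpha>. truncate n c \<alpha> - c \<alpha>)) \<longlonglongrightarrow> 0"
  proof (rule Lim_null_comparison)
    show "\<forall>\<^sub>F n in sequentially. norm (q (\<lambda>\<alpha>. truncate n c \<alpha> - c \<alpha>)) \<le> C * M * s ^ n"
    proof (rule always_eventually, rule allI)
      fix n
      have "(\<lambda>\<alpha>. truncate n c \<alpha> - c \<alpha>) \<in> weighted_space p \<sigma> r"
        using weighted_space_diff [OF p t_in c_in] .
      then have "0 \<le> weighted_norm p \<sigma> r (\<lambda>\<alpha>. truncate n c \<alpha> - c \<alpha>)"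
        by (rule coeff_growth_weighted_norm(2) [OF p r])
      moreover have "weighted_norm p \<sigma> r (\<lambda>\<alpha>. truncate n c \<alpha> - c \<alpha>) \<le> C * (M * s ^ n)"
        using C(2) tail [of n] M s by simp
      ultimately show "norm (q (\<lambda>\<alpha>. truncate n c \<alpha> - c \<alpha>)) \<le> C * M * s ^ n"
        by (simp add: q mult.assoc)
    qed
    show "(\<lambda>n. C * M * s ^ n) \<longlonglongrightarrow> 0"
      using s by (intro tendsto_mult_right_zero LIMSEQ_power_zero) auto
  qed
qed

lemma finite_series_coeff_growth:
  assumes "c \<in> finite_series" "0 < B"
  obtains M where "0 \<le> M" "coeff_growth e B M c"
proof
  define w where "w \<alpha> = B ^ mlength \<alpha> * mfact \<alpha> powr e" for \<alpha> :: "'a multiindex"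
  have w: "0 < w \<alpha>" for \<alpha> using assms by (simp add: w_def)
  let ?M = "\<Sum>\<alpha> | c \<alpha> \<noteq> 0. norm (c \<alpha>) / w \<alpha>"
  show M: "0 \<le> ?M" using w by (auto intro!: sum_nonneg divide_nonneg_pos)
  show "coeff_growth e B ?M c"
    unfolding coeff_growth_def w_def [symmetric]
  proof
    fix \<alpha>
    show "norm (c \<alpha>) \<le> ?M * w \<alpha>"
    proof (cases "c \<alpha> = 0")
      case True
      then show ?thesis using M w [of \<alpha>] by simp
    next
      case False
      have "norm (c \<alpha>) / w \<alpha> \<le> ?M"
        by (rule member_le_sum [where f = "\<lambda>\<alpha>. norm (c \<alpha>) / w \<alpha>"])
          (use assms False w in \<open>auto simp: finite_series_def intro: divide_nonneg_pos\<close>)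
      then show ?thesis using w [of \<alpha>] by (simp add: pos_divide_le_eq)
    qed
  qed
qed

lemma finite_series_in_weighted_space:
  assumes "0 < p" "0 < r" "c \<in> finite_series"
  shows "c \<in> weighted_space p \<sigma> r"
proof -
  have B: "0 < flat_base \<sigma> r / 2" "flat_base \<sigma> r / 2 < flat_base \<sigma> r"
    using flat_base_pos [OF assms(2), of \<sigma>] by auto
  obtain M where "0 \<le> M" "coeff_growth (flat_exponent \<sigma>) (flat_base \<sigma> r / 2) M c"
    by (rule finite_series_coeff_growth [OF assms(3) B(1)]) (rule that)
  then show ?thesis using weighted_norm_coeff_growth [OF assms(1,2) B] by blast
qed

lemma topspace_A_dual:
  "topspace (A_dual p (flat \<sigma>)) = (\<Inter>r\<in>{0<..}. weighted_space p \<sigma> r)"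
  by (simp add: A_dual_def)

lemma topspace_A0_dual:
  "topspace (A0_dual p (flat \<sigma>)) = (\<Union>r\<in>{0<..}. weighted_space p \<sigma> r)"
  by (simp add: A0_dual_def)

text \<open>Membership is characterised independently of \<open>p\<close>; closure under addition is immediate in this
  form, also when the individual weighted spaces are only quasi-normed.\<close>

lemma A0_dual_coeff_growth_iff:
  fixes c :: "'d::finite formal_series"
  assumes p: "0 < p"
  shows "c \<in> topspace (A0_dual p (flat \<sigma>)) \<longleftrightarrow> (\<exists>B>0. \<exists>M\<ge>0. coeff_growth (flat_exponent \<sigma>) B M c)"
proof
  assume "c \<in> topspace (A0_dual p (flat \<sigma>))"
  then obtain r where r: "0 < r" "c \<in> weighted_space p \<sigma> r" by (auto simp: topspace_A0_dual)
  from coeff_growth_weighted_norm [OF p this] flat_base_pos [OF r(1)]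
  show "\<exists>B>0. \<exists>M\<ge>0. coeff_growth (flat_exponent \<sigma>) B M c" by blast
next
  assume "\<exists>B>0. \<exists>M\<ge>0. coeff_growth (flat_exponent \<sigma>) B M c"
  then obtain B M where BM: "0 < B" "0 \<le> M" "coeff_growth (flat_exponent \<sigma>) B M c" by blast
  obtain r where r: "0 < r" "B < flat_base \<sigma> r" by (rule flat_base_exceeds)
  then have "c \<in> weighted_space p \<sigma> r"
    using weighted_norm_coeff_growth [OF p r(1) BM(1) r(2)] BM by blast
  then show "c \<in> topspace (A0_dual p (flat \<sigma>))" using r by (auto simp: topspace_A0_dual)
qed

lemma A0_dual_add_closed:
  assumes p: "0 < p"
    and c: "c \<in> topspace (A0_dual p (flat \<sigma>))" and c': "c' \<in> topspace (A0_dual p (flat \<sigma>))"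
  shows "fun_add c c' \<in> topspace (A0_dual p (flat \<sigma>))"
proof -
  obtain B M where BM: "0 < B" "0 \<le> M" "coeff_growth (flat_exponent \<sigma>) B M c"
    using c A0_dual_coeff_growth_iff [OF p] by blast
  obtain B' M' where BM': "0 < B'" "0 \<le> M'" "coeff_growth (flat_exponent \<sigma>) B' M' c'"
    using c' A0_dual_coeff_growth_iff [OF p] by blast
  have "coeff_growth (flat_exponent \<sigma>) (max B B') (M + M') (fun_add c c')"
    by (rule coeff_growth_add [OF coeff_growth_mono [OF BM(3)] coeff_growth_mono [OF BM'(3)]])
      (use BM BM' in auto)
  then show ?thesis
    unfolding A0_dual_coeff_growth_iff [OF p] using BM BM'
    by (intro exI [of _ "max B B'"] exI [of _ "M + M'"] conjI) auto
qed

lemma A0_dual_scale_closed: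
  assumes p: "0 < p" and c: "c \<in> topspace (A0_dual p (flat \<sigma>))"
  shows "fun_scale a c \<in> topspace (A0_dual p (flat \<sigma>))"
proof -
  obtain B M where BM: "0 < B" "0 \<le> M" "coeff_growth (flat_exponent \<sigma>) B M c"
    using c A0_dual_coeff_growth_iff [OF p] by blast
  then show ?thesis
    unfolding A0_dual_coeff_growth_iff [OF p] using coeff_growth_scale [OF BM(3), of a]
    by (intro exI [of _ B] exI [of _ "norm a * M"] conjI) auto
qed

lemma finite_series_subset_A_dual:
  assumes "0 < p" shows "finite_series \<subseteq> topspace (A_dual p (flat \<sigma>))"
  using finite_series_in_weighted_space [OF assms] by (auto simp: topspace_A_dual)

lemma finite_series_subset_A0_dual:
  assumes "0 < p" shows "finite_series \<subseteq> topspace (A0_dual p (flat \<sigma>))"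
  using finite_series_in_weighted_space [OF assms, of 1] by (force simp: topspace_A0_dual)

lemma finite_series_dense_A_dual:
  assumes p: "0 < p"
  shows "topspace (A_dual p (flat \<sigma>) :: 'd::finite formal_series topology)
    \<subseteq> A_dual p (flat \<sigma>) closure_of finite_series"
proof (rule dense_if_limits)
  fix c :: "'d formal_series" assume c: "c \<in> topspace (A_dual p (flat \<sigma>))"
  have "limitin (A_dual p (flat \<sigma>)) (\<lambda>n. truncate n c) c sequentially"
    unfolding A_dual_def
  proof (rule limitin_projective_limit)
    show "c \<in> (\<Inter>r\<in>{0<..}. weighted_space p \<sigma> r)" using c by (simp only: topspace_A_dual)
    show "truncate n c \<in> (\<Inter>r\<in>{0<..}. weighted_space p \<sigma> r)" for n
      using truncate_finite_series finite_series_subset_A_dual [OF p] by (metis subsetD topspace_A_dual)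
    fix r :: real assume "r \<in> {0<..}"
    then have r: "0 < r" "0 < r / 2" "r / 2 < r" by auto
    have c2: "c \<in> weighted_space p \<sigma> (r / 2)" using c r by (auto simp: topspace_A_dual)
    show "limitin (weighted_topology p \<sigma> r) (\<lambda>n. truncate n c) c sequentially"
      by (rule limitin_truncate [OF p r(1) flat_base_pos [OF r(2)] flat_base_less [OF r(3)]
            coeff_growth_weighted_norm(2,1) [OF p r(2) c2]])
  qed
  then show "\<exists>u. (\<forall>n. u n \<in> finite_series) \<and> limitin (A_dual p (flat \<sigma>)) u c sequentially"
    using truncate_finite_series by (intro exI [of _ "\<lambda>n. truncate n c"]) auto
qed

lemma continuous_map_inclusion_A0_dual:
  assumes "0 < r"
  shows "continuous_map (weighted_topology p \<sigma> r) (A0_dual p (flat \<sigma>)) (\<lambda>c. c)"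
  unfolding A0_dual_def
  by (rule continuous_map_inclusion_inductive_limit [where \<iota> = "\<lambda>r c. c"]) (use assms in auto)

lemma finite_series_dense_A0_dual:
  assumes p: "0 < p"
  shows "topspace (A0_dual p (flat \<sigma>) :: 'd::finite formal_series topology)
    \<subseteq> A0_dual p (flat \<sigma>) closure_of finite_series"
proof (rule dense_if_limits)
  fix c :: "'d formal_series" assume "c \<in> topspace (A0_dual p (flat \<sigma>))"
  then obtain B M where BM: "0 < B" "0 \<le> M" "coeff_growth (flat_exponent \<sigma>) B M c"
    using A0_dual_coeff_growth_iff [OF p] by blast
  obtain r where r: "0 < r" "B < flat_base \<sigma> r" by (rule flat_base_exceeds)
  have "limitin (weighted_topology p \<sigma> r) (\<lambda>n. truncate n c) c sequentially"
    by (rule limitin_truncate [OF p r(1) BM(1) r(2) BM(2,3)])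
  from continuous_map_limit [OF continuous_map_inclusion_A0_dual [OF r(1)] this]
  show "\<exists>u. (\<forall>n. u n \<in> finite_series) \<and> limitin (A0_dual p (flat \<sigma>)) u c sequentially"
    using truncate_finite_series by (intro exI [of _ "\<lambda>n. truncate n c"]) (auto simp: o_def)
qed

lemma Hausdorff_A_dual:
  assumes p: "0 < p"
  shows "Hausdorff_space (A_dual p (flat \<sigma>))"
proof (rule Hausdorff_space_separating_functions [where f = "\<lambda>\<alpha> c. c \<alpha>"])
  fix \<alpha> :: "'a multiindex"
  have "continuous_map (A_dual p (flat \<sigma>)) (weighted_topology p \<sigma> 1) (\<lambda>c. c)"
    unfolding A_dual_def by (rule continuous_map_projection [where \<pi> = "\<lambda>r c. c"]) auto
  from continuous_map_compose [OF this continuous_map_coeff [OF p, of 1 \<sigma> \<alpha>]]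
  show "continuous_map (A_dual p (flat \<sigma>)) euclidean (\<lambda>c. c \<alpha>)" by (simp add: o_def)
qed auto

lemma Hausdorff_A0_dual:
  assumes p: "0 < p"
  shows "Hausdorff_space (A0_dual p (flat \<sigma>))"
proof (rule Hausdorff_space_separating_functions [where f = "\<lambda>\<alpha> c. c \<alpha>"])
  fix \<alpha> :: "'a multiindex"
  show "continuous_map (A0_dual p (flat \<sigma>)) euclidean (\<lambda>c. c \<alpha>)"
    unfolding A0_dual_def
  proof (rule continuous_map_from_inductive_limit [OF locally_convex_complex])
    show "linear_between fun_add fun_scale (\<Union>r\<in>{0<..}. weighted_space p \<sigma> r)
        (+) (*) (topspace euclidean) (\<lambda>c. c \<alpha>)"
      unfolding linear_between_def topspace_A0_dual [symmetric]
      by (intro conjI ballI allI A0_dual_add_closed A0_dual_scale_closed p)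
        (simp_all add: fun_add_def fun_scale_def)
    show "continuous_map (weighted_topology p \<sigma> r) euclidean (\<lambda>c. c \<alpha>)" if "r \<in> {0<..}" for r
      using that p by (intro continuous_map_coeff) auto
  qed auto
qed auto

section \<open>Expansions in the normalised monomials\<close>

definition formal_sum :: "'d::finite formal_series \<Rightarrow> complex ^ 'd \<Rightarrow> complex" where
  "formal_sum c z = (\<Sum>\<^sub>\<infinity>\<alpha>. c \<alpha> * basis_e \<alpha> z)"

abbreviation has_expansion :: "'d::finite formal_series \<Rightarrow> (complex ^ 'd \<Rightarrow> complex) \<Rightarrow> complex ^ 'd \<Rightarrow> bool" where
  "has_expansion c f z \<equiv> ((\<lambda>\<alpha>. c \<alpha> * basis_e \<alpha> z) has_sum f z) UNIV"

lemma mult_basis_e: "c * basis_e \<alpha> z = (c / of_real (sqrt (mfact \<alpha>))) * mpower z \<alpha>"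
  by (simp add: basis_e_def)

lemma norm_mult_basis_e:
  "norm (c * basis_e \<alpha> z) = norm c * mpower (\<chi> j. norm (z $ j)) \<alpha> / sqrt (mfact \<alpha>)"
  by (simp add: basis_e_def norm_mult norm_divide norm_mpower less_imp_le)

lemma formal_sum_eqI: "has_expansion c f z \<Longrightarrow> formal_sum c z = f z"
  unfolding formal_sum_def by (rule infsumI)

lemma has_expansion_formal_sum: "(\<lambda>\<alpha>. c \<alpha> * basis_e \<alpha> z) summable_on UNIV \<Longrightarrow> has_expansion c (formal_sum c) z"
  unfolding formal_sum_def by (rule has_sum_infsum)

lemma has_expansion_diff:
  assumes "has_expansion c f z" "has_expansion c' f' z"
  shows "has_expansion (\<lambda>\<alpha>. c \<alpha> - c' \<alpha>) (\<lambda>z. f z - f' z) z"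
  using has_sum_add [OF assms(1) has_sum_uminusI [OF assms(2)]] by (simp add: left_diff_distrib)

lemma has_expansion_add:
  assumes "has_expansion c f z" "has_expansion c' f' z"
  shows "has_expansion (fun_add c c') (\<lambda>z. f z + f' z) z"
  using has_sum_add [OF assms] by (simp add: fun_add_def distrib_right)

lemma has_expansion_scale:
  assumes "has_expansion c f z"
  shows "has_expansion (fun_scale a c) (\<lambda>z. a * f z) z"
  using has_sum_cmult_right [OF assms, of a] by (simp add: fun_scale_def mult.assoc)

lemma formal_sum_finite_series:
  assumes "c \<in> finite_series"
  shows "formal_sum c = series_map c"
proof
  fix z
  have "formal_sum c z = (\<Sum>\<^sub>\<infinity>\<alpha>\<in>{\<alpha>. c \<alpha> \<noteq> 0}. c \<alpha> * basis_e \<alpha> z)"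
    unfolding formal_sum_def by (rule infsum_cong_neutral) auto
  also have "\<dots> = series_map c z"
    using assms by (simp add: finite_series_def series_map_def)
  finally show "formal_sum c z = series_map c z" .
qed

lemma open_polydisc: "open (polydisc r)"
proof -
  have "polydisc r = (\<Inter>j. {z. norm (z $ j) < r $ j})" by (auto simp: polydisc_def)
  moreover have "open (\<Inter>j. {z :: complex ^ 'a. norm (z $ j) < r $ j})"
    by (intro open_INT ballI open_Collect_less continuous_intros) auto
  ultimately show ?thesis by simp
qed

lemma zero_in_polydisc: "(\<And>j. 0 < r $ j) \<Longrightarrow> 0 \<in> polydisc r"
  by (simp add: polydisc_def)

lemma has_expansion_unique:
  assumes "\<forall>\<^sub>F z in nhds 0. has_expansion c f z" "\<forall>\<^sub>F z in nhds 0. has_expansion c' f z"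
  shows "c = c'"
proof
  fix \<alpha>
  have "(\<lambda>\<alpha>. c \<alpha> / of_real (sqrt (mfact \<alpha>))) = (\<lambda>\<alpha>. c' \<alpha> / of_real (sqrt (mfact \<alpha>)))"
    by (rule expansion_unique [of _ f]) (use assms in \<open>simp_all add: mult_basis_e\<close>)
  from fun_cong [OF this, of \<alpha>] show "c \<alpha> = c' \<alpha>" by simp
qed

lemma mv_analytic_expands_near_zero:
  assumes "mv_analytic_on f D" "0 \<in> D"
  obtains c where "\<forall>\<^sub>F z in nhds 0. has_expansion c f z"
proof -
  obtain a where a: "\<forall>\<^sub>F z in nhds 0. ((\<lambda>\<alpha>. a \<alpha> * mpower (z - 0) \<alpha>) has_sum f z) UNIV"
    using assms unfolding mv_analytic_on_def by blast
  show thesis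
    by (rule that [of "\<lambda>\<alpha>. a \<alpha> * of_real (sqrt (mfact \<alpha>))"]) (use a in \<open>simp add: mult_basis_e\<close>)
qed

lemma has_expansion_polydisc:
  assumes "mv_analytic_on f (polydisc r0)" "\<forall>\<^sub>F z in nhds 0. has_expansion c f z" "z \<in> polydisc r0"
  shows "has_expansion c f z"
  using polydisc_expansion [OF assms(1), of "\<lambda>\<alpha>. c \<alpha> / of_real (sqrt (mfact \<alpha>))" z] assms(2,3)
  by (simp add: mult_basis_e)

lemma has_expansion_coeff_bound:
  fixes f :: "complex ^ 'd::finite \<Rightarrow> complex"
  assumes "mv_analytic_on f (polydisc r0)" "\<forall>\<^sub>F z in nhds 0. has_expansion c f z"
    "\<And>j. 0 < \<rho> $ j" "\<And>j. \<rho> $ j < r0 $ j"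
    and "\<And>z. (\<And>j. norm (z $ j) \<le> \<rho> $ j) \<Longrightarrow> norm (f z) \<le> M"
  shows "norm (c \<alpha>) * (mpower \<rho> \<alpha> / sqrt (mfact \<alpha>)) \<le> M"
  using expansion_coeff_bound(1) [OF assms(1) _ assms(3-5), of "\<lambda>\<alpha>. c \<alpha> / of_real (sqrt (mfact \<alpha>))" \<alpha>]
    assms(2) by (simp add: mult_basis_e norm_divide less_imp_le)

lemma expansion_coeffs_eqI:
  assumes "open D" "0 \<in> D" "\<And>z. z \<in> D \<Longrightarrow> has_expansion c f z"
  shows "expansion_coeffs D f = c"
  unfolding expansion_coeffs_def
proof (rule the_equality)
  have ev: "\<forall>\<^sub>F z in nhds 0. z \<in> D" by (rule eventually_nhds_in_open [OF assms(1,2)])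
  fix c' assume "\<forall>z\<in>D. has_expansion c' f z"
  then show "c' = c" using assms(3)
    by (intro has_expansion_unique [of _ f]) (auto intro: eventually_mono [OF ev])
qed (use assms in auto)

lemma expansion_coeffs_polydisc:
  assumes f: "mv_analytic_on f (polydisc r0)" and r0: "\<And>j. 0 < r0 $ j" and z: "z \<in> polydisc r0"
  shows "has_expansion (expansion_coeffs (polydisc r0) f) f z"
proof -
  obtain c where c: "\<forall>\<^sub>F z in nhds 0. has_expansion c f z"
    using mv_analytic_expands_near_zero [OF f zero_in_polydisc [OF r0]] by metis
  have "expansion_coeffs (polydisc r0) f = c"
    by (rule expansion_coeffs_eqI [OF open_polydisc zero_in_polydisc [OF r0]])
      (rule has_expansion_polydisc [OF f c])
  then show ?thesis using has_expansion_polydisc [OF f c z] by simp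
qed

lemma in_polydisc_norm: "z \<in> polydisc (\<chi> j. norm z + 1)"
  unfolding polydisc_def
  by (auto intro: le_less_trans [OF Finite_Cartesian_Product.norm_nth_le])

lemma expansion_coeffs_entire:
  fixes f :: "complex ^ 'd::finite \<Rightarrow> complex"
  assumes f: "mv_analytic_on f UNIV"
  shows "has_expansion (expansion_coeffs UNIV f) f z"
proof -
  obtain c where c: "\<forall>\<^sub>F z in nhds 0. has_expansion c f z"
    using mv_analytic_expands_near_zero [OF f UNIV_I] by metis
  have exp: "has_expansion c f z" for z
    by (rule has_expansion_polydisc [OF mv_analytic_on_subset [OF f] c in_polydisc_norm]) simp
  have "expansion_coeffs UNIV f = c" by (rule expansion_coeffs_eqI) (use exp in auto)
  then show ?thesis using exp by simp
qed

text \<open>Summability at the point with all coordinates \<open>R\<close> gives the geometric coefficient bound on the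
  polydisc of radius \<open>R\<close>.\<close>

lemma entire_formal_sum:
  fixes c :: "'d::finite formal_series"
  assumes "\<And>z. (\<lambda>\<alpha>. c \<alpha> * basis_e \<alpha> z) summable_on UNIV"
  shows "formal_sum c \<in> analytic_functions UNIV"
proof -
  have "mv_analytic_on (formal_sum c) (polydisc (\<chi> j. R))" if R: "0 < R" for R
  proof (rule power_series_mv_analytic)
    let ?z = "\<chi> j::'d. complex_of_real R"
    show "((\<lambda>\<alpha>. c \<alpha> / of_real (sqrt (mfact \<alpha>)) * mpower z \<alpha>) has_sum formal_sum c z) UNIV" for z
      using has_expansion_formal_sum [OF assms] by (simp add: mult_basis_e)
    have summ: "(\<lambda>\<alpha>. norm (c \<alpha> * basis_e \<alpha> ?z)) summable_on UNIV"
      using summable_on_iff_abs_summable_on_complex [THEN iffD1, OF assms] .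
    fix \<alpha>
    have "norm (c \<alpha> / of_real (sqrt (mfact \<alpha>))) * mpower (\<chi> j. R) \<alpha> = sum (\<lambda>\<alpha>. norm (c \<alpha> * basis_e \<alpha> ?z)) {\<alpha>}"
      using R by (simp add: norm_mult_basis_e norm_divide less_imp_le)
    also have "\<dots> \<le> (\<Sum>\<^sub>\<infinity>\<alpha>. norm (c \<alpha> * basis_e \<alpha> ?z))"
      by (rule finite_sum_le_infsum) (use summ in auto)
    finally show "norm (c \<alpha> / of_real (sqrt (mfact \<alpha>))) * mpower (\<chi> j. R) \<alpha>
        \<le> (\<Sum>\<^sub>\<infinity>\<alpha>. norm (c \<alpha> * basis_e \<alpha> ?z))" .
  qed
  then have an: "mv_analytic_on (formal_sum c) (polydisc (\<chi> j. norm b + 1))" for b :: "complex ^ 'd"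
    using add_nonneg_pos [OF norm_ge_zero zero_less_one, of b] by blast
  have "mv_analytic_on (formal_sum c) UNIV"
    using bspec [OF an [unfolded mv_analytic_on_def] in_polydisc_norm] unfolding mv_analytic_on_def by blast
  then show ?thesis by (simp add: analytic_functions_def)
qed

lemma restrict0_analytic:
  assumes f: "mv_analytic_on f D" and D: "open D"
  shows "restrict0 D f \<in> analytic_functions D"
proof -
  have "mv_analytic_on (restrict0 D f) D"
    unfolding mv_analytic_on_def
  proof
    fix b assume b: "b \<in> D"
    then obtain c where c: "\<forall>\<^sub>F z in nhds b. ((\<lambda>\<alpha>. c \<alpha> * mpower (z - b) \<alpha>) has_sum f z) UNIV"
      using f unfolding mv_analytic_on_def by blast
    have "\<forall>\<^sub>F z in nhds b. ((\<lambda>\<alpha>. c \<alpha> * mpower (z - b) \<alpha>) has_sum restrict0 D f z) UNIV"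
      using c eventually_nhds_in_open [OF D b] by eventually_elim (simp add: restrict0_def)
    then show "\<exists>c. \<forall>\<^sub>F z in nhds b. ((\<lambda>\<alpha>. c \<alpha> * mpower (z - b) \<alpha>) has_sum restrict0 D f z) UNIV" by (intro exI [of _ c])
  qed
  then show ?thesis by (simp add: analytic_functions_def restrict0_def)
qed

section \<open>Polydiscs and the weights \<open>r\<^sup>\<bar>\<^sup>\<alpha>\<^sup>\<bar> (\<alpha>!)\<^sup>1\<^sup>/\<^sup>2\<close>\<close>

lemma flat_one [simp]: "flat_exponent 1 = 1/2" "flat_base 1 r = r"
  by (simp_all add: flat_exponent_def flat_base_def)

lemma coeff_growth_half_bound:
  assumes c: "coeff_growth (1/2) B M c" and B: "0 < B"
  shows "norm (c \<alpha> / of_real (sqrt (mfact \<alpha>))) * mpower (\<chi> j. 1 / B) \<alpha> \<le> M"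
proof -
  have "norm (c \<alpha>) \<le> M * (B ^ mlength \<alpha> * sqrt (mfact \<alpha>))"
    using c by (simp add: coeff_growth_def powr_half_sqrt less_imp_le)
  then have "norm (c \<alpha>) / (B ^ mlength \<alpha> * sqrt (mfact \<alpha>)) \<le> M"
    using B by (subst pos_divide_le_eq) auto
  then show ?thesis by (simp add: norm_divide mpower_const power_one_over less_imp_le mult.commute)
qed

lemma coeff_growth_half_expands:
  assumes c: "coeff_growth (1/2) B M c" and B: "0 < B" and z: "z \<in> polydisc (\<chi> j. 1 / B)"
  shows "has_expansion c (formal_sum c) z"
  using power_series_summable [OF coeff_growth_half_bound [OF c B] z]
  by (intro has_expansion_formal_sum) (simp add: mult_basis_e)

lemma coeff_growth_half_analytic:
  assumes c: "coeff_growth (1/2) B M c" and B: "0 < B"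
  shows "mv_analytic_on (formal_sum c) (polydisc (\<chi> j. 1 / B))"
  by (rule power_series_mv_analytic [OF coeff_growth_half_bound [OF c B]])
    (use coeff_growth_half_expands [OF c B] in \<open>simp add: mult_basis_e\<close>)

lemma polydisc_mono: "(\<And>j. r $ j \<le> r' $ j) \<Longrightarrow> polydisc r \<subseteq> polydisc r'"
  by (auto simp: polydisc_def intro: less_le_trans)

abbreviation polydisc_norm :: "real ^ 'd::finite \<Rightarrow> real ^ 'd \<Rightarrow> (complex ^ 'd \<Rightarrow> complex) \<Rightarrow> real" where
  "polydisc_norm r0 r f \<equiv>
    (SUP \<alpha>. norm (expansion_coeffs (polydisc r0) f \<alpha> * of_real (mpower r \<alpha> / sqrt (mfact \<alpha>))))"

text \<open>A supremum over the reals bounds its members only if the set is bounded above; here Cauchy's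
  inequality on the closed polydisc of radii \<open>r\<close> provides the bound.\<close>

lemma expansion_coeffs_le_polydisc_norm:
  fixes f :: "complex ^ 'd::finite \<Rightarrow> complex"
  assumes f: "mv_analytic_on f (polydisc r0)" and r: "\<And>j. 0 < r $ j" "\<And>j. r $ j < r0 $ j"
  shows "norm (expansion_coeffs (polydisc r0) f \<alpha>) * (mpower r \<alpha> / sqrt (mfact \<alpha>)) \<le> polydisc_norm r0 r f"
proof -
  let ?c = "expansion_coeffs (polydisc r0) f"
  have r0: "0 < r0 $ j" for j using r [of j] by linarith
  define K where "K = {w :: complex ^ 'd. \<forall>j. norm (w $ j) \<le> r $ j}"
  have "K \<subseteq> polydisc r0" using r(2) by (auto simp: K_def polydisc_def intro: le_less_trans)
  moreover have "compact K" unfolding K_def by (rule compact_closed_polydisc)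
  ultimately obtain M where M: "\<And>w. w \<in> K \<Longrightarrow> norm (f w) \<le> M"
    using mv_analytic_bounded_on_compact [OF f] by blast
  have ev: "\<forall>\<^sub>F z in nhds 0. has_expansion ?c f z"
    using eventually_nhds_in_open [OF open_polydisc zero_in_polydisc [OF r0]]
    by eventually_elim (rule expansion_coeffs_polydisc [OF f r0])
  have eq: "norm (?c \<alpha> * of_real (mpower r \<alpha> / sqrt (mfact \<alpha>))) = norm (?c \<alpha>) * (mpower r \<alpha> / sqrt (mfact \<alpha>))" for \<alpha>
    using mpower_pos [of r \<alpha>] r(1) by (simp add: norm_mult norm_divide less_imp_le)
  have "norm (?c \<alpha>) * (mpower r \<alpha> / sqrt (mfact \<alpha>)) \<le> M" for \<alpha>
    by (rule has_expansion_coeff_bound [OF f ev r]) (use M in \<open>auto simp: K_def\<close>)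
  then have "bdd_above (range (\<lambda>\<alpha>. norm (?c \<alpha> * of_real (mpower r \<alpha> / sqrt (mfact \<alpha>)))))"
    unfolding eq by (intro bdd_aboveI2)
  from cSUP_upper [OF UNIV_I this, of \<alpha>] show ?thesis unfolding eq .
qed

lemma mv_analytic_on_diff:
  assumes "mv_analytic_on f D" "mv_analytic_on f' D"
  shows "mv_analytic_on (\<lambda>z. f z - f' z) D"
  unfolding mv_analytic_on_def
proof
  fix b assume "b \<in> D"
  then obtain c c' where c: "\<forall>\<^sub>F z in nhds b. ((\<lambda>\<alpha>. c \<alpha> * mpower (z - b) \<alpha>) has_sum f z) UNIV"
    and c': "\<forall>\<^sub>F z in nhds b. ((\<lambda>\<alpha>. c' \<alpha> * mpower (z - b) \<alpha>) has_sum f' z) UNIV"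
    using assms unfolding mv_analytic_on_def by blast
  from c c' have "\<forall>\<^sub>F z in nhds b. ((\<lambda>\<alpha>. (c \<alpha> - c' \<alpha>) * mpower (z - b) \<alpha>) has_sum f z - f' z) UNIV"
  proof eventually_elim
    case (elim z)
    from has_sum_add [OF elim(1) has_sum_uminusI [OF elim(2)]]
    show ?case by (simp add: left_diff_distrib)
  qed
  then show "\<exists>c. \<forall>\<^sub>F z in nhds b. ((\<lambda>\<alpha>. c \<alpha> * mpower (z - b) \<alpha>) has_sum f z - f' z) UNIV"
    by (intro exI [of _ "\<lambda>\<alpha>. c \<alpha> - c' \<alpha>"])
qed

lemma expansion_coeffs_diff:
  assumes "f \<in> analytic_functions (polydisc r0)" "f' \<in> analytic_functions (polydisc r0)" "\<And>j. 0 < r0 $ j"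
  shows "expansion_coeffs (polydisc r0) (\<lambda>z. f z - f' z) =
      (\<lambda>\<alpha>. expansion_coeffs (polydisc r0) f \<alpha> - expansion_coeffs (polydisc r0) f' \<alpha>)"
  using assms
  by (intro expansion_coeffs_eqI open_polydisc zero_in_polydisc has_expansion_diff expansion_coeffs_polydisc)
    (auto simp: analytic_functions_def)

lemma weighted_space_one_growth:
  assumes "0 < p" "0 < \<rho>" "c \<in> weighted_space p 1 \<rho>"
  shows "coeff_growth (1/2) \<rho> (weighted_norm p 1 \<rho> c) c"
  using coeff_growth_weighted_norm(1) [OF assms] by simp

lemma has_expansion_restrict0:
  "z \<in> D \<Longrightarrow> has_expansion c (restrict0 D f) z \<longleftrightarrow> has_expansion c f z"
  by (simp add: restrict0_def)

text \<open>A weighted norm with parameter \<open>\<rho>\<close> dominates every seminorm with radii at most \<open>1 / \<rho>\<close>, with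
  constant 1.\<close>

lemma continuous_map_formal_sum_polydisc:
  fixes r0 :: "real ^ 'd::finite"
  assumes p: "0 < p" and \<rho>: "0 < \<rho>" and r0: "\<And>j. 0 < r0 $ j" "\<And>j. r0 $ j \<le> 1 / \<rho>"
  shows "continuous_map (weighted_topology p 1 \<rho>) (polydisc_topology r0)
    (\<lambda>c. restrict0 (polydisc r0) (formal_sum c))"
  unfolding weighted_lp_topology_def polydisc_topology_def
proof (rule continuous_map_seminorms)
  have sub: "polydisc r0 \<subseteq> polydisc (\<chi> j. 1 / \<rho>)" by (rule polydisc_mono) (simp add: r0)
  fix c :: "'d formal_series" assume c: "c \<in> weighted_space p 1 \<rho>"
  show "restrict0 (polydisc r0) (formal_sum c) \<in> analytic_functions (polydisc r0)"
    using coeff_growth_half_analytic [OF weighted_space_one_growth [OF p \<rho> c] \<rho>] sub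
    by (intro restrict0_analytic open_polydisc) (rule mv_analytic_on_subset)
next
  have sub: "polydisc r0 \<subseteq> polydisc (\<chi> j. 1 / \<rho>)" by (rule polydisc_mono) (simp add: r0)
  let ?h = "\<lambda>c :: 'd formal_series. restrict0 (polydisc r0) (formal_sum c)"
  have exp: "has_expansion c (?h c) z" if "c \<in> weighted_space p 1 \<rho>" "z \<in> polydisc r0" for c z
    using coeff_growth_half_expands [OF weighted_space_one_growth [OF p \<rho> that(1)] \<rho>, of z] sub that(2)
    by (auto simp: has_expansion_restrict0)
  fix q assume "q \<in> {polydisc_norm r0 r |r. \<forall>j. 0 < r $ j \<and> r $ j < r0 $ j}"
  then obtain r where q: "q = polydisc_norm r0 r" and r: "\<And>j. 0 < r $ j" "\<And>j. r $ j < r0 $ j" by blast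
  have "q (\<lambda>x. ?h c' x - ?h c x) \<le> 1 * weighted_norm p 1 \<rho> (\<lambda>\<alpha>. c' \<alpha> - c \<alpha>)"
    if c: "c \<in> weighted_space p 1 \<rho>" and c': "c' \<in> weighted_space p 1 \<rho>" for c c'
  proof -
    let ?d = "\<lambda>\<alpha>. c' \<alpha> - c \<alpha>"
    have "expansion_coeffs (polydisc r0) (\<lambda>x. ?h c' x - ?h c x) = ?d"
      by (intro expansion_coeffs_eqI open_polydisc zero_in_polydisc r0 has_expansion_diff exp c c')
    moreover have "norm (?d \<alpha> * of_real (mpower r \<alpha> / sqrt (mfact \<alpha>))) \<le> weighted_norm p 1 \<rho> ?d" for \<alpha>
    proof -
      have "?d \<in> weighted_space p 1 \<rho>" using weighted_space_diff [OF p c' c] .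
      from coeff_growth_half_bound [OF weighted_space_one_growth [OF p \<rho> this] \<rho>, of \<alpha>]
      have le: "norm (?d \<alpha>) / sqrt (mfact \<alpha>) * mpower (\<chi> j. 1 / \<rho>) \<alpha> \<le> weighted_norm p 1 \<rho> ?d"
        by (simp add: norm_divide less_imp_le)
      have "mpower r \<alpha> \<le> mpower (\<chi> j. 1 / \<rho>) \<alpha>"
        by (rule mpower_mono) (use r r0(2) in \<open>auto intro: less_imp_le order_trans [OF less_imp_le]\<close>)
      then have "norm (?d \<alpha>) / sqrt (mfact \<alpha>) * mpower r \<alpha> \<le> norm (?d \<alpha>) / sqrt (mfact \<alpha>) * mpower (\<chi> j. 1 / \<rho>) \<alpha>"
        by (rule mult_left_mono) (simp add: less_imp_le)
      then show ?thesis using le mpower_pos [of r \<alpha>] r(1)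
        by (simp add: norm_mult norm_divide less_imp_le)
    qed
    ultimately show ?thesis unfolding q by (auto intro!: cSUP_least)
  qed
  then show "\<exists>q'\<in>{\<lambda>c :: 'd formal_series. weighted_norm p 1 \<rho> c}. \<exists>C\<ge>0. \<forall>c\<in>weighted_space p 1 \<rho>.
      \<forall>c'\<in>weighted_space p 1 \<rho>. q (\<lambda>x. ?h c' x - ?h c x) \<le> C * q' (\<lambda>\<alpha>. c' \<alpha> - c \<alpha>)"
    by (intro bexI [OF _ singletonI] exI [of _ 1]) auto
qed

lemma expansion_coeffs_growth:
  fixes r0 :: "real ^ 'd::finite"
  assumes f: "mv_analytic_on f (polydisc r0)" and R: "0 < R" "\<And>j. R < r0 $ j"
  shows "coeff_growth (1/2) (1 / R) (polydisc_norm r0 (\<chi> j. R) f) (expansion_coeffs (polydisc r0) f)"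
    and "0 \<le> polydisc_norm r0 (\<chi> j. R) f"
proof -
  let ?c = "expansion_coeffs (polydisc r0) f" and ?N = "polydisc_norm r0 (\<chi> j. R) f"
  have le: "norm (?c \<alpha>) * (R ^ mlength \<alpha> / sqrt (mfact \<alpha>)) \<le> ?N" for \<alpha>
    using expansion_coeffs_le_polydisc_norm [OF f, of "\<chi> j. R" \<alpha>] R by (simp add: mpower_const)
  have "0 \<le> norm (?c \<alpha>) * (R ^ mlength \<alpha> / sqrt (mfact \<alpha>))" for \<alpha> using R by (simp add: less_imp_le)
  then show "0 \<le> ?N" using le order_trans by blast
  show "coeff_growth (1/2) (1 / R) ?N ?c"
    unfolding coeff_growth_def
  proof
    fix \<alpha>
    have "norm (?c \<alpha>) = norm (?c \<alpha>) * (R ^ mlength \<alpha> / sqrt (mfact \<alpha>)) * ((1 / R) ^ mlength \<alpha> * sqrt (mfact \<alpha>))"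
      using R by (simp add: field_simps)
    also have "\<dots> \<le> ?N * ((1 / R) ^ mlength \<alpha> * sqrt (mfact \<alpha>))"
      using R by (intro mult_right_mono le) (auto simp: less_imp_le)
    finally show "norm (?c \<alpha>) \<le> ?N * ((1 / R) ^ mlength \<alpha> * mfact \<alpha> powr (1/2))"
      by (simp add: powr_half_sqrt less_imp_le)
  qed
qed

text \<open>A single seminorm, the one with all radii \<open>R\<close>, dominates the weighted norm.  The gap between
  \<open>1 / R\<close> and \<open>\<rho>\<close> is what makes the \<open>\<ell>\<^sup>p\<close> sum converge.\<close>

lemma continuous_map_expansion_coeffs_polydisc:
  fixes r0 :: "real ^ 'd::finite"
  assumes p: "0 < p" and R: "0 < R" "\<And>j. R < r0 $ j" "1 / R < \<rho>"
  shows "continuous_map (polydisc_topology r0) (weighted_topology p 1 \<rho>) (expansion_coeffs (polydisc r0))"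
proof -
  have \<rho>: "0 < \<rho>" "0 < 1 / R" using R by (auto intro: less_trans [of 0 "1 / R"])
  have r0: "0 < r0 $ j" for j using R(1) R(2) [of j] by linarith
  obtain C where C: "0 \<le> C" "\<forall>M\<ge>0. \<forall>c :: 'd formal_series. coeff_growth (1/2) (1 / R) M c \<longrightarrow>
      c \<in> weighted_space p 1 \<rho> \<and> weighted_norm p 1 \<rho> c \<le> C * M"
    using weighted_norm_coeff_growth [OF p \<rho>(1,2), of 1] R by auto
  show ?thesis
    unfolding weighted_lp_topology_def polydisc_topology_def
  proof (rule continuous_map_seminorms)
    fix f assume "f \<in> analytic_functions (polydisc r0)"
    then show "expansion_coeffs (polydisc r0) f \<in> weighted_space p 1 \<rho>"
      using C(2) expansion_coeffs_growth [OF _ R(1,2)] by (auto simp: analytic_functions_def)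
  next
    fix q assume "q \<in> {\<lambda>c :: 'd formal_series. weighted_norm p 1 \<rho> c}"
    then have q: "q = (\<lambda>c. weighted_norm p 1 \<rho> c)" by simp
    have "q (\<lambda>x. expansion_coeffs (polydisc r0) f' x - expansion_coeffs (polydisc r0) f x)
        \<le> C * polydisc_norm r0 (\<chi> j. R) (\<lambda>x. f' x - f x)"
      if f: "f \<in> analytic_functions (polydisc r0)" and f': "f' \<in> analytic_functions (polydisc r0)" for f f'
    proof -
      let ?d = "\<lambda>x. f' x - f x"
      have eq: "expansion_coeffs (polydisc r0) ?d =
          (\<lambda>\<alpha>. expansion_coeffs (polydisc r0) f' \<alpha> - expansion_coeffs (polydisc r0) f \<alpha>)"
        by (rule expansion_coeffs_diff [OF f' f r0])
      have d: "mv_analytic_on ?d (polydisc r0)"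
        using f f' mv_analytic_on_diff [of f' "polydisc r0" f] by (auto simp: analytic_functions_def)
      show ?thesis
        using C(2) expansion_coeffs_growth [OF d R(1,2)] unfolding q eq by blast
    qed
    then show "\<exists>q'\<in>{polydisc_norm r0 r |r. \<forall>j. 0 < r $ j \<and> r $ j < r0 $ j}. \<exists>C\<ge>0.
        \<forall>f\<in>analytic_functions (polydisc r0). \<forall>f'\<in>analytic_functions (polydisc r0).
          q (\<lambda>x. expansion_coeffs (polydisc r0) f' x - expansion_coeffs (polydisc r0) f x) \<le> C * q' (\<lambda>x. f' x - f x)"
      using C(1) R by (intro bexI [of _ "polydisc_norm r0 (\<chi> j. R)"] exI [of _ C]) auto
  qed
qed

section \<open>Entire functions\<close>

lemma A_dual_one_has_expansion:
  fixes c :: "'d::finite formal_series"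
  assumes p: "0 < p" and c: "c \<in> topspace (A_dual p (flat 1))"
  shows "has_expansion c (formal_sum c) z"
proof -
  define B where "B = 1 / (norm z + 1)"
  have B: "0 < B" "1 / B = norm z + 1" by (simp_all add: B_def add_nonneg_pos)
  have "c \<in> weighted_space p 1 B" using c B by (auto simp: topspace_A_dual)
  from coeff_growth_half_expands [OF weighted_space_one_growth [OF p B(1) this] B(1)]
  show ?thesis using in_polydisc_norm [of z] B(2) by simp
qed

lemma expansion_coeffs_restrict0:
  assumes f: "mv_analytic_on f UNIV" and r0: "\<And>j. 0 < r0 $ j"
  shows "expansion_coeffs (polydisc r0) (restrict0 (polydisc r0) f) = expansion_coeffs UNIV f"
  by (rule expansion_coeffs_eqI [OF open_polydisc zero_in_polydisc [OF r0]])
    (use expansion_coeffs_entire [OF f] in \<open>simp add: has_expansion_restrict0\<close>)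

lemma expansion_coeffs_formal_sum:
  "(\<And>z. has_expansion c (formal_sum c) z) \<Longrightarrow> expansion_coeffs UNIV (formal_sum c) = c"
  by (rule expansion_coeffs_eqI) auto

lemma formal_sum_expansion_coeffs:
  "mv_analytic_on f UNIV \<Longrightarrow> formal_sum (expansion_coeffs UNIV f) = f"
  by (rule ext, rule formal_sum_eqI, rule expansion_coeffs_entire)

text \<open>An entire function is restricted to a polydisc of radius larger than \<open>1 / \<rho>\<close>.\<close>

lemma entire_coeffs_in_weighted_space:
  fixes f :: "complex ^ 'd::finite \<Rightarrow> complex"
  assumes p: "0 < p" and f: "f \<in> analytic_functions UNIV" and \<rho>: "0 < \<rho>"
  shows "expansion_coeffs UNIV f \<in> weighted_space p 1 \<rho>"
proof -
  let ?r0 = "\<chi> j::'d. 3 / \<rho>"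
  have an: "mv_analytic_on f UNIV" using f by (simp add: analytic_functions_def)
  have "continuous_map (polydisc_topology ?r0) (weighted_topology p 1 \<rho>) (expansion_coeffs (polydisc ?r0))"
    by (rule continuous_map_expansion_coeffs_polydisc [OF p, of "2 / \<rho>"])
      (use \<rho> in \<open>auto simp: divide_strict_right_mono\<close>)
  moreover have "restrict0 (polydisc ?r0) f \<in> topspace (polydisc_topology ?r0)"
    using restrict0_analytic [OF mv_analytic_on_subset [OF an subset_UNIV] open_polydisc]
    by (simp add: polydisc_topology_def)
  ultimately have "expansion_coeffs (polydisc ?r0) (restrict0 (polydisc ?r0) f) \<in> weighted_space p 1 \<rho>"
    by (auto simp: continuous_map_def)
  then show ?thesis by (simp add: expansion_coeffs_restrict0 [OF an] \<rho>)
qed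

lemma homeomorphic_map_entire:
  assumes p: "0 < p"
  shows "homeomorphic_map (A_dual p (flat 1)) (entire_topology :: (complex ^ 'd::finite \<Rightarrow> complex) topology) formal_sum"
  unfolding A_dual_def entire_topology_def
proof (rule homeomorphic_map_projective_limits)
  let ?E = "\<Inter>r\<in>{0<..}. weighted_space p 1 r :: 'd formal_series set"
  have exp: "has_expansion c (formal_sum c) z" if "c \<in> ?E" for c z
    using A_dual_one_has_expansion [OF p, of c z] that by (simp add: topspace_A_dual)
  have an: "formal_sum c \<in> analytic_functions UNIV" if "c \<in> ?E" for c
    using exp [OF that] by (intro entire_formal_sum) (auto simp: summable_on_def)
  show "bij_betw formal_sum ?E (analytic_functions UNIV)"
  proof (rule bij_betw_byWitness [where f' = "expansion_coeffs UNIV"])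
    show "\<forall>c\<in>?E. expansion_coeffs UNIV (formal_sum c) = c"
      using exp by (intro ballI expansion_coeffs_formal_sum) blast
    show "\<forall>f\<in>analytic_functions UNIV. formal_sum (expansion_coeffs UNIV f) = f"
      using formal_sum_expansion_coeffs by (auto simp: analytic_functions_def)
    show "formal_sum ` ?E \<subseteq> analytic_functions UNIV" using an by blast
    show "expansion_coeffs UNIV ` analytic_functions UNIV \<subseteq> ?E"
      using entire_coeffs_in_weighted_space [OF p] by blast
  qed
  show "restrict0 (polydisc r0) f \<in> topspace (polydisc_topology r0)"
    if "f \<in> analytic_functions UNIV" for r0 and f :: "complex ^ 'd \<Rightarrow> complex"
    using restrict0_analytic [OF mv_analytic_on_subset [OF _ subset_UNIV] open_polydisc] that
    by (simp add: polydisc_topology_def analytic_functions_def)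
  show "\<exists>\<rho>\<in>{0<..}. \<exists>h. continuous_map (weighted_topology p 1 \<rho>) (polydisc_topology r0) h \<and>
      (\<forall>c\<in>?E. h c = restrict0 (polydisc r0) (formal_sum c))" if "r0 \<in> {r. \<forall>j. 0 < r $ j}" for r0
  proof -
    have r0: "0 < r0 $ j" for j using that by simp
    \<comment> \<open>The sum of the radii is a convenient bound for each of them.\<close>
    let ?\<rho> = "1 / (\<Sum>j\<in>UNIV. r0 $ j)"
    have \<rho>: "0 < ?\<rho>" using r0 by (simp add: sum_pos)
    have "r0 $ j \<le> 1 / ?\<rho>" for j
      using member_le_sum [of j UNIV "\<lambda>j. r0 $ j"] r0 by (simp add: less_imp_le)
    from continuous_map_formal_sum_polydisc [OF p \<rho> r0 this] \<rho>
    show ?thesis by (intro bexI [of _ ?\<rho>] exI conjI) auto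
  qed
  show "\<exists>r0\<in>{r. \<forall>j. 0 < r $ j}. \<exists>k. continuous_map (polydisc_topology r0) (weighted_topology p 1 \<rho>) k \<and>
      (\<forall>c\<in>?E. k (restrict0 (polydisc r0) (formal_sum c)) = c)" if "\<rho> \<in> {0<..}" for \<rho>
  proof -
    \<comment> \<open>Radii 3 / \<rho> leave room for a seminorm with radii 2 / \<rho>, which exceed 1 / \<rho>.\<close>
    let ?r0 = "\<chi> j::'d. 3 / \<rho>"
    have \<rho>: "0 < \<rho>" using that by simp
    have "continuous_map (polydisc_topology ?r0) (weighted_topology p 1 \<rho>) (expansion_coeffs (polydisc ?r0))"
      by (rule continuous_map_expansion_coeffs_polydisc [OF p, of "2 / \<rho>"])
        (use \<rho> in \<open>auto simp: divide_strict_right_mono\<close>)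
    moreover have "expansion_coeffs (polydisc ?r0) (restrict0 (polydisc ?r0) (formal_sum c)) = c"
      if "c \<in> ?E" for c
      by (rule expansion_coeffs_eqI [OF open_polydisc zero_in_polydisc])
        (use \<rho> exp [OF that] in \<open>simp_all add: has_expansion_restrict0\<close>)
    ultimately show ?thesis
      using \<rho> by (intro bexI [of _ ?r0] exI [of _ "expansion_coeffs (polydisc ?r0)"] conjI) auto
  qed
qed auto

section \<open>Germs of analytic functions\<close>

lemma germ_of_eq_iff: "germ_of f = germ_of g \<longleftrightarrow> (\<forall>\<^sub>F z in nhds 0. f z = g z)"
  by (rule germ.abs_eq_iff)

lemma A0_dual_one_has_expansion:
  fixes c :: "'d::finite formal_series"
  assumes p: "0 < p" and c: "c \<in> topspace (A0_dual p (flat 1))"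
  shows "\<forall>\<^sub>F z in nhds 0. has_expansion c (formal_sum c) z"
proof -
  obtain B M where B: "0 < B" and c: "coeff_growth (1/2) B M c"
    using c A0_dual_coeff_growth_iff [OF p, of c 1] by auto
  have "\<forall>\<^sub>F z in nhds 0. z \<in> polydisc (\<chi> j::'d. 1 / B)"
    by (rule eventually_nhds_in_open [OF open_polydisc zero_in_polydisc]) (simp add: B)
  then show ?thesis by eventually_elim (rule coeff_growth_half_expands [OF c B])
qed

lemma linear_between_germs:
  assumes p: "0 < p"
  shows "linear_between fun_add fun_scale (topspace (A0_dual p (flat 1))) germ_add germ_scale
    analytic_germs (\<lambda>c :: 'd::finite formal_series. germ_of (formal_sum c))"
  unfolding linear_between_def
proof (intro conjI ballI allI)
  fix c c' :: "'d formal_series" and a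
  assume c: "c \<in> topspace (A0_dual p (flat 1))"
  note ec = A0_dual_one_has_expansion [OF p c]
  show "fun_scale a c \<in> topspace (A0_dual p (flat 1))" by (rule A0_dual_scale_closed [OF p c])
  have "\<forall>\<^sub>F z in nhds 0. formal_sum (fun_scale a c) z = a * formal_sum c z"
    using ec by eventually_elim (rule formal_sum_eqI [OF has_expansion_scale])
  then show "germ_of (formal_sum (fun_scale a c)) = germ_scale a (germ_of (formal_sum c))"
    by (simp add: germ_scale.abs_eq germ_of_eq_iff)
  obtain B M where B: "0 < B" and g: "coeff_growth (1/2) B M c"
    using c A0_dual_coeff_growth_iff [OF p, of c 1] by auto
  have "mv_analytic_on (formal_sum c) (polydisc (\<chi> j. 1 / B))"
    by (rule coeff_growth_half_analytic [OF g B])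
  then show "germ_of (formal_sum c) \<in> analytic_germs"
    unfolding analytic_germs_def using open_polydisc zero_in_polydisc [of "\<chi> j. 1 / B"] B by auto
  assume c': "c' \<in> topspace (A0_dual p (flat 1))"
  show "fun_add c c' \<in> topspace (A0_dual p (flat 1))" by (rule A0_dual_add_closed [OF p c c'])
  have "\<forall>\<^sub>F z in nhds 0. formal_sum (fun_add c c') z = formal_sum c z + formal_sum c' z"
    using ec A0_dual_one_has_expansion [OF p c']
    by eventually_elim (rule formal_sum_eqI [OF has_expansion_add])
  then show "germ_of (formal_sum (fun_add c c')) = germ_add (germ_of (formal_sum c)) (germ_of (formal_sum c'))"
    by (simp add: germ_add.abs_eq germ_of_eq_iff)
qed

lemma polydisc_subset_open:
  assumes "open U" "0 \<in> U"
  obtains r0 :: "real ^ 'd::finite" where "\<And>j. 0 < r0 $ j" "polydisc r0 \<subseteq> U"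
proof -
  obtain d where d: "0 < d" "ball 0 d \<subseteq> U" using assms open_contains_ball by blast
  show thesis
  proof (rule that [of "\<chi> j. d / real CARD('d)"])
    show "polydisc (\<chi> j. d / real CARD('d)) \<subseteq> U"
    proof
      fix z :: "complex ^ 'd" assume z: "z \<in> polydisc (\<chi> j. d / real CARD('d))"
      have "norm z \<le> (\<Sum>j\<in>UNIV. norm (z $ j))" unfolding norm_vec_def by (rule L2_set_le_sum) auto
      also have "\<dots> < (\<Sum>j\<in>(UNIV::'d set). d / real CARD('d))"
        by (rule sum_strict_mono) (use z in \<open>auto simp: polydisc_def\<close>)
      finally have "norm z < d" by simp
      then show "z \<in> U" using d by auto
    qed
  qed (use d in auto)
qed

text \<open>With \<open>m\<close> the smallest radius, a seminorm with radii \<open>m / 2\<close> yields every parameter \<open>\<rho> > 2 / m\<close>.\<close>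

lemma polydisc_coeffs_continuous:
  fixes r0 :: "real ^ 'd::finite"
  assumes p: "0 < p" and r0: "\<And>j. 0 < r0 $ j"
  obtains \<rho> where "0 < \<rho>"
    "continuous_map (polydisc_topology r0) (weighted_topology p 1 \<rho>) (expansion_coeffs (polydisc r0))"
proof -
  define m where "m = Min (range (\<lambda>j. r0 $ j))"
  have m: "0 < m" "\<And>j. m \<le> r0 $ j" using r0 by (auto simp: m_def)
  show thesis
  proof (rule that [of "4 / m"])
    show "0 < 4 / m" using m by simp
    show "continuous_map (polydisc_topology r0) (weighted_topology p 1 (4 / m)) (expansion_coeffs (polydisc r0))"
    proof (rule continuous_map_expansion_coeffs_polydisc [OF p, of "m / 2"])
      show "m / 2 < r0 $ j" for j using m(1) m(2) [of j] by linarith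
    qed (use m in \<open>auto simp: divide_strict_right_mono\<close>)
  qed
qed

lemma germ_of_polydisc_coeffs:
  assumes f: "f \<in> analytic_functions (polydisc r0)" and r0: "\<And>j. 0 < r0 $ j"
  shows "germ_of (formal_sum (expansion_coeffs (polydisc r0) f)) = germ_of f"
  unfolding germ_of_eq_iff
  using eventually_nhds_in_open [OF open_polydisc zero_in_polydisc [OF r0]]
  by eventually_elim
    (rule formal_sum_eqI, rule expansion_coeffs_polydisc, use f r0 in \<open>auto simp: analytic_functions_def\<close>)

text \<open>Injectivity is the uniqueness of power series at the origin.  For surjectivity a representative
  is restricted to a polydisc inside its domain of analyticity.\<close>

lemma bij_betw_germs:
  assumes p: "0 < p"
  shows "bij_betw (\<lambda>c :: 'd::finite formal_series. germ_of (formal_sum c))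
    (topspace (A0_dual p (flat 1))) analytic_germs"
  unfolding bij_betw_def
proof (intro conjI subset_antisym)
  show "inj_on (\<lambda>c :: 'd formal_series. germ_of (formal_sum c)) (topspace (A0_dual p (flat 1)))"
  proof (rule inj_onI)
    fix c c' :: "'d formal_series"
    assume c: "c \<in> topspace (A0_dual p (flat 1))" and c': "c' \<in> topspace (A0_dual p (flat 1))"
      and eq: "germ_of (formal_sum c) = germ_of (formal_sum c')"
    have "\<forall>\<^sub>F z in nhds 0. has_expansion c' (formal_sum c) z"
      using eq [unfolded germ_of_eq_iff] A0_dual_one_has_expansion [OF p c']
      by eventually_elim simp
    then show "c = c'" by (rule has_expansion_unique [OF A0_dual_one_has_expansion [OF p c]])
  qed
  show "(\<lambda>c :: 'd formal_series. germ_of (formal_sum c)) ` topspace (A0_dual p (flat 1)) \<subseteq> analytic_germs"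
    using linear_between_germs [OF p] unfolding linear_between_def by blast
  show "analytic_germs \<subseteq> (\<lambda>c :: 'd formal_series. germ_of (formal_sum c)) ` topspace (A0_dual p (flat 1))"
  proof
    fix g :: "'d germ" assume "g \<in> analytic_germs"
    then obtain f U where f: "g = germ_of f" "open U" "0 \<in> U" "mv_analytic_on f U"
      unfolding analytic_germs_def by blast
    obtain r0 :: "real ^ 'd" where r0: "\<And>j. 0 < r0 $ j" "polydisc r0 \<subseteq> U"
      by (rule polydisc_subset_open [OF f(2,3)]) (rule that)
    let ?f = "restrict0 (polydisc r0) f" and ?c = "expansion_coeffs (polydisc r0) (restrict0 (polydisc r0) f)"
    have an: "?f \<in> analytic_functions (polydisc r0)"
      by (rule restrict0_analytic [OF mv_analytic_on_subset [OF f(4) r0(2)] open_polydisc])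
    obtain \<rho> where \<rho>: "0 < \<rho>"
      "continuous_map (polydisc_topology r0) (weighted_topology p 1 \<rho>) (expansion_coeffs (polydisc r0))"
      by (rule polydisc_coeffs_continuous [OF p r0(1)]) (rule that)
    have "?c \<in> weighted_space p 1 \<rho>"
      using \<rho>(2) an by (auto simp: continuous_map_def polydisc_topology_def)
    then have "?c \<in> topspace (A0_dual p (flat 1))" using \<rho>(1) by (auto simp: topspace_A0_dual)
    moreover have "germ_of ?f = germ_of f"
      unfolding germ_of_eq_iff
      using eventually_nhds_in_open [OF open_polydisc zero_in_polydisc [OF r0(1)]]
      by eventually_elim (simp add: restrict0_def)
    ultimately show "g \<in> (\<lambda>c. germ_of (formal_sum c)) ` topspace (A0_dual p (flat 1))"
      using germ_of_polydisc_coeffs [OF an r0(1)] f(1) by (intro image_eqI [of _ _ ?c]) auto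
  qed
qed

lemma homeomorphic_map_germs:
  assumes p: "0 < p"
  shows "homeomorphic_map (A0_dual p (flat 1)) (analytic_germs_topology :: ('d::finite) germ topology)
    (\<lambda>c. germ_of (formal_sum c))"
  unfolding A0_dual_def analytic_germs_topology_def
proof (rule homeomorphic_map_inductive_limits)
  let ?E = "\<Union>r\<in>{0<..}. weighted_space p 1 r :: 'd formal_series set"
  let ?g = "\<lambda>c :: 'd formal_series. germ_of (formal_sum c)"
  show "linear_between fun_add fun_scale ?E germ_add germ_scale analytic_germs ?g"
    using linear_between_germs [OF p] by (simp only: topspace_A0_dual)
  show "bij_betw ?g ?E analytic_germs" using bij_betw_germs [OF p] by (simp only: topspace_A0_dual)
  show "germ_of f \<in> analytic_germs"
    if "r0 \<in> {r. \<forall>j. 0 < r $ j}" "f \<in> topspace (polydisc_topology r0)"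
    for r0 and f :: "complex ^ 'd \<Rightarrow> complex"
    using that open_polydisc [of r0] zero_in_polydisc [of r0]
    by (auto simp: polydisc_topology_def analytic_functions_def analytic_germs_def)
  show "\<exists>r0\<in>{r. \<forall>j. 0 < r $ j}. \<exists>h. continuous_map (weighted_topology p 1 \<rho>) (polydisc_topology r0) h \<and>
      (\<forall>c\<in>topspace (weighted_topology p 1 \<rho>). ?g c = germ_of (h c))" if "\<rho> \<in> {0<..}" for \<rho>
  proof -
    let ?r0 = "\<chi> j::'d. 1 / \<rho>"
    have \<rho>: "0 < \<rho>" using that by simp
    then have "continuous_map (weighted_topology p 1 \<rho>) (polydisc_topology ?r0)
        (\<lambda>c. restrict0 (polydisc ?r0) (formal_sum c))"
      by (intro continuous_map_formal_sum_polydisc p) auto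
    moreover have "?g c = germ_of (restrict0 (polydisc ?r0) (formal_sum c))" for c
      unfolding germ_of_eq_iff
      using eventually_nhds_in_open [OF open_polydisc zero_in_polydisc, of ?r0] \<rho>
      by (auto elim: eventually_mono simp: restrict0_def)
    ultimately show ?thesis
      using \<rho> by (intro bexI [of _ ?r0] exI [of _ "\<lambda>c. restrict0 (polydisc ?r0) (formal_sum c)"] conjI) auto
  qed
  show "\<exists>\<rho>\<in>{0<..}. \<exists>k. continuous_map (polydisc_topology r0) (weighted_topology p 1 \<rho>) k \<and>
      (\<forall>f\<in>topspace (polydisc_topology r0). ?g (k f) = germ_of f)" if "r0 \<in> {r. \<forall>j. 0 < r $ j}" for r0
  proof -
    have r0: "\<And>j. 0 < r0 $ j" using that by simp
    obtain \<rho> where \<rho>: "0 < \<rho>"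
      "continuous_map (polydisc_topology r0) (weighted_topology p 1 \<rho>) (expansion_coeffs (polydisc r0))"
      by (rule polydisc_coeffs_continuous [OF p r0]) (rule that)
    have "?g (expansion_coeffs (polydisc r0) f) = germ_of f" if "f \<in> topspace (polydisc_topology r0)" for f
      using germ_of_polydisc_coeffs [OF _ r0] that by (simp add: polydisc_topology_def)
    then show ?thesis
      using \<rho> by (intro bexI [of _ \<rho>] exI [of _ "expansion_coeffs (polydisc r0)"] conjI) auto
  qed
qed auto

section \<open>Coefficient decay and exponential growth\<close>

lemma kappa2_pos: "1 < \<sigma> \<Longrightarrow> 0 < kappa2 \<sigma>"
  by (cases \<sigma>) (auto simp: kappa2_def)

lemma flat_exponent_kappa2: "1 < \<sigma> \<Longrightarrow> flat_exponent \<sigma> = 1/2 - 1 / kappa2 \<sigma>"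
  by (cases \<sigma>) (auto simp: kappa2_def flat_exponent_def field_simps)

lemma power_over_fact_le_exp:
  fixes y :: real
  assumes "0 \<le> y"
  shows "y ^ n / fact n \<le> exp y"
proof -
  have "sum (\<lambda>n. y ^ n /\<^sub>R fact n) {n} \<le> (\<Sum>n. y ^ n /\<^sub>R fact n)"
    by (rule sum_le_suminf [OF summable_exp_generic]) (use assms in auto)
  then show ?thesis by (simp add: exp_def divide_inverse mult.commute)
qed

lemma power_le_exp_fact:
  fixes x k :: real
  assumes "0 \<le> x" "0 < k"
  shows "x ^ n * fact n powr (- 1 / k) \<le> exp (x powr k / k)"
proof -
  have "(x powr k) ^ n = (x ^ n) powr k" by (induction n) (use assms in \<open>auto simp: powr_mult\<close>)
  then have "((x powr k) ^ n) powr (1 / k) = x ^ n" using assms by (simp add: powr_powr)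
  moreover have "((x powr k) ^ n / fact n) powr (1 / k) = ((x powr k) ^ n) powr (1 / k) / fact n powr (1 / k)"
    by (rule powr_divide)
  ultimately have "x ^ n * fact n powr (- 1 / k) = ((x powr k) ^ n / fact n) powr (1 / k)"
    by (simp add: powr_minus_divide)
  also have "\<dots> \<le> exp (x powr k) powr (1 / k)"
    using assms by (intro powr_mono2 power_over_fact_le_exp) auto
  also have "\<dots> = exp (x powr k / k)" by (simp add: powr_def)
  finally show ?thesis .
qed

lemma mfact_powr: "mfact \<alpha> powr a = (\<Prod>j\<in>UNIV. fact (\<alpha> $ j) powr a)"
  unfolding mfact_def by (subst prod_powr_distrib) auto

text \<open>With \<open>\<kappa> = \<kappa>\<^sub>2(\<sigma>)\<close>, so that \<open>1/(2\<sigma>) - 1/2 = -1/\<kappa>\<close>, each term of the series is at most a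
  geometric weight times a product of factors \<open>x\<^sup>n (n!)\<^sup>-\<^sup>1\<^sup>/\<^sup>\<kappa>\<close>, and \<open>x\<^sup>\<kappa>\<^sup>n / n! \<le> exp (x\<^sup>\<kappa>)\<close>.  The factor
  2 in \<open>(2 B)\<^sup>\<kappa>\<close> pays for the geometric weight.\<close>

lemma expansion_term_bound:
  fixes z :: "complex ^ 'd::finite"
  assumes \<sigma>: "1 < \<sigma>" and c: "coeff_growth (flat_exponent \<sigma>) B M c" and B: "0 < B" and M: "0 \<le> M"
  shows "norm (c \<alpha> * basis_e \<alpha> z) \<le> (1/2) ^ mlength \<alpha> *
    (M * exp (real CARD('d) * ((2 * B) powr kappa2 \<sigma> / kappa2 \<sigma>) * norm z powr kappa2 \<sigma>))"
proof -
  let ?k = "kappa2 \<sigma>" and ?x = "2 * B * norm z"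
  note k = kappa2_pos [OF \<sigma>]
  have x: "0 \<le> ?x" using B by simp
  have "norm (c \<alpha> * basis_e \<alpha> z) = norm (c \<alpha>) * (mpower (\<chi> j. norm (z $ j)) \<alpha> / sqrt (mfact \<alpha>))"
    by (simp add: norm_mult_basis_e)
  also have "\<dots> \<le> M * (B ^ mlength \<alpha> * mfact \<alpha> powr flat_exponent \<sigma>) *
      (mpower (\<chi> j. norm z) \<alpha> / sqrt (mfact \<alpha>))"
  proof (rule mult_mono)
    show "norm (c \<alpha>) \<le> M * (B ^ mlength \<alpha> * mfact \<alpha> powr flat_exponent \<sigma>)"
      using c by (simp add: coeff_growth_def)
    show "mpower (\<chi> j. norm (z $ j)) \<alpha> / sqrt (mfact \<alpha>) \<le> mpower (\<chi> j. norm z) \<alpha> / sqrt (mfact \<alpha>)"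
      by (intro divide_right_mono mpower_mono)
        (simp_all add: Finite_Cartesian_Product.norm_nth_le less_imp_le)
  qed (use B M in \<open>auto intro!: divide_nonneg_nonneg mpower_nonneg simp: less_imp_le\<close>)
  also have "\<dots> = (1/2) ^ mlength \<alpha> * (M * (?x ^ mlength \<alpha> * mfact \<alpha> powr (- 1 / ?k)))"
  proof -
    have "flat_exponent \<sigma> = 1/2 + (- 1 / ?k)" using flat_exponent_kappa2 [OF \<sigma>] by simp
    then have "mfact \<alpha> powr flat_exponent \<sigma> = sqrt (mfact \<alpha>) * mfact \<alpha> powr (- 1 / ?k)"
      by (simp only: powr_add) (simp add: powr_half_sqrt less_imp_le)
    then show ?thesis
      by (simp add: mpower_const power_mult_distrib field_simps)
  qed
  also have "\<dots> \<le> (1/2) ^ mlength \<alpha> * (M * exp (real CARD('d) * ((2 * B) powr ?k / ?k) * norm z powr ?k))"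
  proof (intro mult_left_mono M)
    have "?x ^ mlength \<alpha> * mfact \<alpha> powr (- 1 / ?k) = (\<Prod>j\<in>UNIV. ?x ^ (\<alpha> $ j) * fact (\<alpha> $ j) powr (- 1 / ?k))"
      by (simp add: mfact_powr mlength_def power_sum prod.distrib)
    also have "\<dots> \<le> (\<Prod>j\<in>(UNIV :: 'd set). exp (?x powr ?k / ?k))"
      by (intro prod_mono conjI power_le_exp_fact x k) (use x in auto)
    also have "\<dots> = exp (real CARD('d) * (?x powr ?k / ?k))"
      by (subst exp_of_nat_mult) simp
    also have "?x powr ?k = (2 * B) powr ?k * norm z powr ?k" using B by (simp add: powr_mult)
    finally show "?x ^ mlength \<alpha> * mfact \<alpha> powr (- 1 / ?k)
        \<le> exp (real CARD('d) * ((2 * B) powr ?k / ?k) * norm z powr ?k)" by (simp add: mult_ac)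
  qed auto
  finally show ?thesis .
qed

definition geometric_sum_half :: "'d::finite itself \<Rightarrow> real" where
  "geometric_sum_half _ = (\<Sum>\<^sub>\<infinity>\<alpha> :: 'd multiindex. (1/2) ^ mlength \<alpha>)"

lemma geometric_sum_half_nonneg: "0 \<le> geometric_sum_half TYPE('d::finite)"
  unfolding geometric_sum_half_def by (rule infsum_nonneg) simp

lemma growth_has_expansion:
  fixes c :: "'d::finite formal_series"
  assumes \<sigma>: "1 < \<sigma>" and c: "coeff_growth (flat_exponent \<sigma>) B M c" and B: "0 < B" and M: "0 \<le> M"
  shows "has_expansion c (formal_sum c) z"
    and "norm (formal_sum c z) \<le> geometric_sum_half TYPE('d) *
      (M * exp (real CARD('d) * ((2 * B) powr kappa2 \<sigma> / kappa2 \<sigma>) * norm z powr kappa2 \<sigma>))"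
proof -
  let ?K = "M * exp (real CARD('d) * ((2 * B) powr kappa2 \<sigma> / kappa2 \<sigma>) * norm z powr kappa2 \<sigma>)"
  have le: "norm (c \<alpha> * basis_e \<alpha> z) \<le> (1/2) ^ mlength \<alpha> * ?K" for \<alpha>
    by (rule expansion_term_bound [OF \<sigma> c B M])
  have "(\<lambda>\<alpha>. norm (c \<alpha> * basis_e \<alpha> z)) summable_on UNIV"
    by (rule abs_summable_geometric [of "1/2" _ ?K])
      (simp, simp, rule order_trans [OF le eq_refl [OF mult.commute]])
  then show exp: "has_expansion c (formal_sum c) z"
    by (intro has_expansion_formal_sum) (rule abs_summable_summable)
  show "norm (formal_sum c z) \<le> geometric_sum_half TYPE('d) * ?K"
  proof (rule norm_infsum_le [OF exp _ le])
    show "((\<lambda>\<alpha> :: 'd multiindex. (1/2) ^ mlength \<alpha> * ?K) has_sum geometric_sum_half TYPE('d) * ?K) UNIV"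
      unfolding geometric_sum_half_def
      by (rule has_sum_cmult_left [OF has_sum_infsum [OF geometric_summable_on]]) auto
  qed
qed

text \<open>Conversely, Cauchy's estimate is used on the polydisc with radii
  \<open>\<rho>\<^sub>j = ((\<alpha>\<^sub>j + 1) / A)\<^sup>1\<^sup>/\<^sup>\<kappa>\<close>, which up to a factor depending on \<open>\<kappa>\<close> minimise
  \<open>exp (A \<rho>\<^sub>j\<^sup>\<kappa>) / \<rho>\<^sub>j\<^sup>n\<close> for \<open>n = \<alpha>\<^sub>j\<close>; the summand 1 keeps the radii positive when \<open>\<alpha>\<^sub>j = 0\<close>.  Here
  \<open>A = r d\<^sup>\<kappa>\<close>, since \<open>\<bar>z\<bar>\<close> is at most \<open>d\<close> times the largest of the \<open>d\<close> radii.\<close>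

lemma coeff_growth_of_exp_bound:
  fixes F :: "complex ^ 'd::finite \<Rightarrow> complex"
  assumes \<sigma>: "1 < \<sigma>" and F: "mv_analytic_on F UNIV" and r: "0 < r" and M: "0 \<le> M"
    and bound: "\<And>z. norm (F z) \<le> M * exp (r * norm z powr kappa2 \<sigma>)"
  shows "coeff_growth (flat_exponent \<sigma>)
    (exp 1 * (r * real CARD('d) powr kappa2 \<sigma>) powr (1 / kappa2 \<sigma>)) (M * exp (real CARD('d)))
    (expansion_coeffs UNIV F)"
  unfolding coeff_growth_def
proof
  let ?k = "kappa2 \<sigma>" and ?d = "real CARD('d)"
  note k = kappa2_pos [OF \<sigma>]
  define A where "A = r * ?d powr ?k"
  have A: "0 < A" using r by (simp add: A_def)
  fix \<alpha> :: "'d multiindex"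
  define \<rho> where "\<rho> = (\<chi> j. ((real (\<alpha> $ j) + 1) / A) powr (1 / ?k))"
  have \<rho>_pos: "0 < \<rho> $ j" for j using A by (simp add: \<rho>_def add_nonneg_pos)
  have \<rho>k: "(\<rho> $ j) powr ?k = (real (\<alpha> $ j) + 1) / A" for j
    using A k by (simp add: \<rho>_def powr_powr)
  have ev: "\<forall>\<^sub>F z in nhds 0. has_expansion (expansion_coeffs UNIV F) F z"
    by (intro always_eventually allI expansion_coeffs_entire F)
  have M': "norm (F z) \<le> M * exp (real (mlength \<alpha>) + ?d)" if z: "\<And>j. norm (z $ j) \<le> \<rho> $ j" for z
  proof -
    define m where "m = Max (range (\<lambda>j. \<rho> $ j))"
    have m_ge: "\<rho> $ j \<le> m" for j by (simp add: m_def)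
    have "m \<in> range (\<lambda>j. \<rho> $ j)" unfolding m_def by (rule Max_in) auto
    then obtain i where i: "m = \<rho> $ i" by blast
    have "norm z \<le> (\<Sum>j\<in>UNIV. norm (z $ j))" unfolding norm_vec_def by (rule L2_set_le_sum) auto
    also have "\<dots> \<le> (\<Sum>j\<in>(UNIV :: 'd set). m)" using z m_ge by (intro sum_mono) (rule order_trans)
    finally have "norm z \<le> ?d * m" by simp
    then have "norm z powr ?k \<le> (?d * m) powr ?k" using k by (intro powr_mono2) auto
    also have "\<dots> = ?d powr ?k * (\<rho> $ i) powr ?k" using \<rho>_pos by (simp add: i powr_mult)
    also have "(\<rho> $ i) powr ?k \<le> (\<Sum>j\<in>UNIV. (\<rho> $ j) powr ?k)"
      by (rule member_le_sum) auto
    also have "\<dots> = (real (mlength \<alpha>) + ?d) / A"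
      by (simp add: \<rho>k mlength_def sum_divide_distrib [symmetric] sum.distrib)
    finally have "norm z powr ?k \<le> ?d powr ?k * ((real (mlength \<alpha>) + ?d) / A)"
      by (simp add: mult_left_mono)
    then have "r * norm z powr ?k \<le> r * (?d powr ?k * ((real (mlength \<alpha>) + ?d) / A))"
      by (rule mult_left_mono) (use r in simp)
    also have "\<dots> = real (mlength \<alpha>) + ?d" using r A by (simp add: A_def)
    finally have "exp (r * norm z powr ?k) \<le> exp (real (mlength \<alpha>) + ?d)" by simp
    then show ?thesis using bound [of z] M by (meson mult_left_mono order_trans)
  qed
  have cauchy: "norm (expansion_coeffs UNIV F \<alpha>) * (mpower \<rho> \<alpha> / sqrt (mfact \<alpha>)) \<le> M * exp (real (mlength \<alpha>) + ?d)"
  proof (rule has_expansion_coeff_bound [OF _ ev \<rho>_pos])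
    show "mv_analytic_on F (polydisc (\<chi> j. \<rho> $ j + 1))" by (rule mv_analytic_on_subset [OF F subset_UNIV])
  qed (use M' in auto)
  have \<rho>_lower: "(A powr (- 1 / ?k)) ^ mlength \<alpha> * mfact \<alpha> powr (1 / ?k) \<le> mpower \<rho> \<alpha>"
  proof -
    have "(A powr (- 1 / ?k)) ^ mlength \<alpha> * mfact \<alpha> powr (1 / ?k)
        = (\<Prod>j\<in>UNIV. (A powr (- 1 / ?k)) ^ (\<alpha> $ j) * fact (\<alpha> $ j) powr (1 / ?k))"
      by (simp add: mfact_powr mlength_def power_sum prod.distrib)
    also have "\<dots> \<le> (\<Prod>j\<in>UNIV. (\<rho> $ j) ^ (\<alpha> $ j))"
    proof (rule prod_mono, rule conjI)
      fix j
      let ?n = "\<alpha> $ j"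
      have "fact ?n \<le> (real ?n + 1) ^ ?n"
        by (rule order_trans [OF fact_le_power]) (simp add: power_mono)
      then have "fact ?n powr (1 / ?k) \<le> ((real ?n + 1) ^ ?n) powr (1 / ?k)"
        using k by (intro powr_mono2) auto
      also have "\<dots> = ((real ?n + 1) powr (1 / ?k)) ^ ?n"
      proof -
        have "(x ^ n) powr a = (x powr a) ^ n" if "0 < x" for x a :: real and n
          by (induction n) (use that in \<open>auto simp: powr_mult\<close>)
        then show ?thesis by (simp add: add_nonneg_pos)
      qed
      finally have "(A powr (- 1 / ?k)) ^ ?n * fact ?n powr (1 / ?k)
          \<le> (A powr (- 1 / ?k)) ^ ?n * ((real ?n + 1) powr (1 / ?k)) ^ ?n"
        by (rule mult_left_mono) simp
      also have "\<dots> = (\<rho> $ j) ^ ?n"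
        unfolding power_mult_distrib [symmetric]
        using powr_divide [of "real ?n + 1" A "1 / ?k"] by (simp add: \<rho>_def powr_minus_divide)
      finally show "(A powr (- 1 / ?k)) ^ ?n * fact ?n powr (1 / ?k) \<le> (\<rho> $ j) ^ ?n" .
    qed simp
    finally show ?thesis by (simp add: mpower_def)
  qed
  let ?c = "expansion_coeffs UNIV F"
  let ?L = "(A powr (- 1 / ?k)) ^ mlength \<alpha> * mfact \<alpha> powr (1 / ?k)"
  have L: "0 < ?L" using A by simp
  have "norm (?c \<alpha>) * (?L / sqrt (mfact \<alpha>)) \<le> M * exp (real (mlength \<alpha>) + ?d)"
    using mult_left_mono [OF divide_right_mono [OF \<rho>_lower], of "sqrt (mfact \<alpha>)" "norm (?c \<alpha>)"] cauchy
    by (simp add: less_imp_le)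
  then have "norm (?c \<alpha>) \<le> M * exp (real (mlength \<alpha>) + ?d) * (sqrt (mfact \<alpha>) / ?L)"
    using L by (simp add: field_simps)
  also have "sqrt (mfact \<alpha>) / ?L = (A powr (1 / ?k)) ^ mlength \<alpha> * mfact \<alpha> powr flat_exponent \<sigma>"
  proof -
    have "mfact \<alpha> powr flat_exponent \<sigma> = sqrt (mfact \<alpha>) / mfact \<alpha> powr (1 / ?k)"
      unfolding flat_exponent_kappa2 [OF \<sigma>] powr_diff by (simp add: powr_half_sqrt less_imp_le)
    moreover have "A powr (- 1 / ?k) = 1 / A powr (1 / ?k)" by (simp add: powr_minus_divide)
    ultimately show ?thesis by (simp add: power_divide)
  qed
  also have "M * exp (real (mlength \<alpha>) + ?d) * \<dots> = M * exp ?d * ((exp 1 * A powr (1 / ?k)) ^ mlength \<alpha> * mfact \<alpha> powr flat_exponent \<sigma>)"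
    by (simp add: exp_add power_mult_distrib exp_of_nat_mult [symmetric])
  finally show "norm (?c \<alpha>) \<le> M * exp ?d *
      ((exp 1 * (r * ?d powr ?k) powr (1 / ?k)) ^ mlength \<alpha> * mfact \<alpha> powr flat_exponent \<sigma>)"
    by (simp add: A_def)
qed

abbreviation exp_weight :: "ereal \<Rightarrow> real \<Rightarrow> complex ^ 'd::finite \<Rightarrow> real" where
  "exp_weight \<sigma> r z \<equiv> exp (r * norm z powr kappa2 \<sigma>)"

lemma topspace_weighted_entire_topology [simp]: "topspace (weighted_entire_topology w) = weighted_entire w"
  by (simp add: weighted_entire_topology_def)

lemma weighted_entire_bound:
  assumes F: "F \<in> weighted_entire w" and w: "\<And>z. 0 < w z"
  shows "norm (F z) \<le> (SUP z. norm (F z) / w z) * w z" and "0 \<le> (SUP z. norm (F z) / w z)"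
proof -
  obtain c where "\<And>z. norm (F z) \<le> c * w z" using F by (auto simp: weighted_entire_def)
  then have "norm (F z) / w z \<le> c" for z using w by (simp add: pos_divide_le_eq)
  then have "bdd_above (range (\<lambda>z. norm (F z) / w z))" by (intro bdd_aboveI2)
  then have le: "norm (F z) / w z \<le> (SUP z. norm (F z) / w z)" for z by (rule cSUP_upper [OF UNIV_I])
  then show "norm (F z) \<le> (SUP z. norm (F z) / w z) * w z" using w by (simp add: pos_divide_le_eq)
  have "0 \<le> norm (F z) / w z" using w [of z] by (simp add: less_imp_le)
  then show "0 \<le> (SUP z. norm (F z) / w z)" using le order_trans by blast
qed

lemma weighted_entire_diff:
  assumes "F \<in> weighted_entire w" "G \<in> weighted_entire w"
  shows "(\<lambda>z. F z - G z) \<in> weighted_entire w"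
proof -
  obtain a b where ab: "0 < a" "\<And>z. norm (F z) \<le> a * w z" "0 < b" "\<And>z. norm (G z) \<le> b * w z"
    using assms by (auto simp: weighted_entire_def)
  have "norm (F z - G z) \<le> (a + b) * w z" for z
    using norm_triangle_ineq4 [of "F z" "G z"] ab(2) [of z] ab(4) [of z] by (simp add: distrib_right)
  moreover have "mv_analytic_on (\<lambda>z. F z - G z) UNIV"
    using assms by (intro mv_analytic_on_diff) (auto simp: weighted_entire_def analytic_functions_def)
  ultimately show ?thesis
    using ab(1,3) by (auto simp: weighted_entire_def analytic_functions_def intro!: exI [of _ "a + b"])
qed

lemma continuous_map_formal_sum_weighted:
  assumes p: "0 < p" and \<sigma>: "1 < \<sigma>" and r: "0 < r"
    and r': "real CARD('d::finite) * ((2 * flat_base \<sigma> r) powr kappa2 \<sigma> / kappa2 \<sigma>) \<le> r'"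
  shows "continuous_map (weighted_topology p \<sigma> r :: 'd formal_series topology)
    (weighted_entire_topology (exp_weight \<sigma> r')) formal_sum"
proof -
  let ?K = "geometric_sum_half TYPE('d)"
  have exp: "has_expansion c (formal_sum c) z" if "c \<in> weighted_space p \<sigma> r" for c and z :: "complex ^ 'd"
    using growth_has_expansion(1) [OF \<sigma> _ flat_base_pos [OF r]] coeff_growth_weighted_norm [OF p r that] by blast
  have bound: "norm (formal_sum c z) \<le> ?K * weighted_norm p \<sigma> r c * exp_weight \<sigma> r' z"
    if "c \<in> weighted_space p \<sigma> r" for c and z :: "complex ^ 'd"
  proof -
    let ?N = "weighted_norm p \<sigma> r c"
    note N = coeff_growth_weighted_norm [OF p r that]
    have "norm (formal_sum c z) \<le> ?K * (?N *
        exp (real CARD('d) * ((2 * flat_base \<sigma> r) powr kappa2 \<sigma> / kappa2 \<sigma>) * norm z powr kappa2 \<sigma>))"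
      by (rule growth_has_expansion(2) [OF \<sigma> N(1) flat_base_pos [OF r] N(2)])
    also have "\<dots> \<le> ?K * (?N * exp_weight \<sigma> r' z)"
    proof (intro mult_left_mono N(2) geometric_sum_half_nonneg)
      have "real CARD('d) * ((2 * flat_base \<sigma> r) powr kappa2 \<sigma> / kappa2 \<sigma>) * norm z powr kappa2 \<sigma>
          \<le> r' * norm z powr kappa2 \<sigma>"
        by (rule mult_right_mono [OF r']) simp
      then show "exp (real CARD('d) * ((2 * flat_base \<sigma> r) powr kappa2 \<sigma> / kappa2 \<sigma>) * norm z powr kappa2 \<sigma>)
          \<le> exp_weight \<sigma> r' z" by simp
    qed
    finally show ?thesis by (simp add: mult.assoc)
  qed
  show ?thesis
    unfolding weighted_lp_topology_def weighted_entire_topology_def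
  proof (rule continuous_map_seminorms)
    fix c :: "'d formal_series" assume c: "c \<in> weighted_space p \<sigma> r"
    have "formal_sum c \<in> analytic_functions UNIV"
      using exp [OF c] by (intro entire_formal_sum) (auto simp: summable_on_def)
    moreover have "norm (formal_sum c z) \<le> (?K * weighted_norm p \<sigma> r c + 1) * exp_weight \<sigma> r' z" for z
      using bound [OF c, of z] by (simp add: distrib_right) (smt (verit) exp_gt_zero)
    moreover have "0 < ?K * weighted_norm p \<sigma> r c + 1"
      using coeff_growth_weighted_norm(2) [OF p r c] geometric_sum_half_nonneg
      by (intro add_nonneg_pos mult_nonneg_nonneg) auto
    ultimately show "formal_sum c \<in> weighted_entire (exp_weight \<sigma> r')"
      unfolding weighted_entire_def by blast
  next
    fix q assume "q \<in> {\<lambda>F :: complex ^ 'd \<Rightarrow> complex. SUP z. norm (F z) / exp_weight \<sigma> r' z}"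
    then have q: "q = (\<lambda>F. SUP z. norm (F z) / exp_weight \<sigma> r' z)" by simp
    have "q (\<lambda>x. formal_sum c' x - formal_sum c x) \<le> ?K * weighted_norm p \<sigma> r (\<lambda>\<alpha>. c' \<alpha> - c \<alpha>)"
      if c: "c \<in> weighted_space p \<sigma> r" and c': "c' \<in> weighted_space p \<sigma> r" for c c' :: "'d formal_series"
    proof -
      let ?d = "\<lambda>\<alpha>. c' \<alpha> - c \<alpha>"
      have d: "?d \<in> weighted_space p \<sigma> r" using weighted_space_diff [OF p c' c] .
      have "formal_sum ?d z = formal_sum c' z - formal_sum c z" for z
        using formal_sum_eqI [OF has_expansion_diff [OF exp [OF c'] exp [OF c]]] .
      then have "norm (formal_sum c' z - formal_sum c z) / exp_weight \<sigma> r' z \<le> ?K * weighted_norm p \<sigma> r ?d" for z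
        using bound [OF d, of z] by (simp add: pos_divide_le_eq)
      then show ?thesis unfolding q by (intro cSUP_least) auto
    qed
    then show "\<exists>q'\<in>{\<lambda>c :: 'd formal_series. weighted_norm p \<sigma> r c}. \<exists>C\<ge>0. \<forall>c\<in>weighted_space p \<sigma> r.
        \<forall>c'\<in>weighted_space p \<sigma> r. q (\<lambda>x. formal_sum c' x - formal_sum c x) \<le> C * q' (\<lambda>\<alpha>. c' \<alpha> - c \<alpha>)"
      using geometric_sum_half_nonneg by (intro bexI [OF _ singletonI] exI [of _ ?K]) auto
  qed
qed

lemma continuous_map_expansion_coeffs_weighted:
  assumes p: "0 < p" and \<sigma>: "1 < \<sigma>" and r: "0 < r" and r': "0 < r'"
    and base: "exp 1 * (r' * real CARD('d::finite) powr kappa2 \<sigma>) powr (1 / kappa2 \<sigma>) < flat_base \<sigma> r"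
  shows "continuous_map (weighted_entire_topology (exp_weight \<sigma> r'))
    (weighted_topology p \<sigma> r :: 'd formal_series topology) (expansion_coeffs UNIV)"
proof -
  let ?B = "exp 1 * (r' * real CARD('d) powr kappa2 \<sigma>) powr (1 / kappa2 \<sigma>)"
  let ?q = "\<lambda>F :: complex ^ 'd \<Rightarrow> complex. SUP z. norm (F z) / exp_weight \<sigma> r' z"
  have B: "0 < ?B" using r' by simp
  obtain C where C: "0 \<le> C" "\<forall>M\<ge>0. \<forall>c :: 'd formal_series. coeff_growth (flat_exponent \<sigma>) ?B M c \<longrightarrow>
      c \<in> weighted_space p \<sigma> r \<and> weighted_norm p \<sigma> r c \<le> C * M"
    using weighted_norm_coeff_growth [OF p r B base] by blast
  have bd: "expansion_coeffs UNIV F \<in> weighted_space p \<sigma> r \<and>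
      weighted_norm p \<sigma> r (expansion_coeffs UNIV F) \<le> C * (?q F * exp (real CARD('d)))"
    if F: "F \<in> weighted_entire (exp_weight \<sigma> r')" for F
  proof -
    have "mv_analytic_on F UNIV" using F by (simp add: weighted_entire_def analytic_functions_def)
    from coeff_growth_of_exp_bound [OF \<sigma> this r' weighted_entire_bound(2,1) [OF F]]
    have "coeff_growth (flat_exponent \<sigma>) ?B (?q F * exp (real CARD('d))) (expansion_coeffs UNIV F)"
      by simp
    moreover have "0 \<le> ?q F * exp (real CARD('d))"
      using weighted_entire_bound(2) [OF F] by simp
    ultimately show ?thesis using C(2) by blast
  qed
  show ?thesis
    unfolding weighted_lp_topology_def weighted_entire_topology_def
  proof (rule continuous_map_seminorms)
    show "expansion_coeffs UNIV F \<in> weighted_space p \<sigma> r" if "F \<in> weighted_entire (exp_weight \<sigma> r')"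
      for F :: "complex ^ 'd \<Rightarrow> complex"
      using bd [OF that] by blast
    fix q assume "q \<in> {\<lambda>c :: 'd formal_series. weighted_norm p \<sigma> r c}"
    then have q: "q = (\<lambda>c. weighted_norm p \<sigma> r c)" by simp
    have "q (\<lambda>x. expansion_coeffs UNIV G x - expansion_coeffs UNIV F x)
        \<le> (C * exp (real CARD('d))) * ?q (\<lambda>x. G x - F x)"
      if F: "F \<in> weighted_entire (exp_weight \<sigma> r')" and G: "G \<in> weighted_entire (exp_weight \<sigma> r')"
      for F G :: "complex ^ 'd \<Rightarrow> complex"
    proof -
      have "expansion_coeffs UNIV (\<lambda>x. G x - F x) = (\<lambda>\<alpha>. expansion_coeffs UNIV G \<alpha> - expansion_coeffs UNIV F \<alpha>)"
        using F G by (intro expansion_coeffs_eqI has_expansion_diff expansion_coeffs_entire)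
          (auto simp: weighted_entire_def analytic_functions_def)
      then show ?thesis using bd [OF weighted_entire_diff [OF G F]] by (simp add: q mult_ac)
    qed
    then show "\<exists>q'\<in>{?q}. \<exists>C\<ge>0. \<forall>F\<in>weighted_entire (exp_weight \<sigma> r') :: (complex ^ 'd \<Rightarrow> complex) set. \<forall>G\<in>weighted_entire (exp_weight \<sigma> r').
        q (\<lambda>x. expansion_coeffs UNIV G x - expansion_coeffs UNIV F x) \<le> C * q' (\<lambda>x. G x - F x)"
      using C(1) by (intro bexI [OF _ singletonI] exI [of _ "C * exp (real CARD('d))"]) auto
  qed
qed

section \<open>Spaces of entire functions of restricted growth\<close>

lemma formal_sum_inverse_weighted:
  assumes p: "0 < p" and \<sigma>: "1 < \<sigma>" and r: "0 < r" and c: "c \<in> weighted_space p \<sigma> r"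
  shows "expansion_coeffs UNIV (formal_sum c) = c"
  using growth_has_expansion(1) [OF \<sigma> _ flat_base_pos [OF r]] coeff_growth_weighted_norm [OF p r c]
  by (intro expansion_coeffs_formal_sum) blast

lemma exp_weight_every_carrier:
  "{F \<in> analytic_functions UNIV. \<forall>r>0. \<exists>c>0. \<forall>z. norm (F z) \<le> c * w r z} = (\<Inter>r\<in>{0<..}. weighted_entire (w r))"
  for w :: "real \<Rightarrow> complex ^ 'd::finite \<Rightarrow> real"
  by (auto simp: weighted_entire_def intro: zero_less_one)

lemma exp_weight_some_carrier:
  "{F \<in> analytic_functions UNIV. \<exists>r>0. \<exists>c>0. \<forall>z. norm (F z) \<le> c * w r z} = (\<Union>r\<in>{0<..}. weighted_entire (w r))"
  for w :: "real \<Rightarrow> complex ^ 'd::finite \<Rightarrow> real"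
  by (auto simp: weighted_entire_def)

text \<open>In both directions the constant obtained tends to 0 with the given parameter: the growth rate is
  a multiple of \<open>B\<^sup>\<kappa>\<close>, and the base of the coefficients is a multiple of \<open>r\<^sup>1\<^sup>/\<^sup>\<kappa>\<close>.  Hence every parameter
  on one side is served by a suitable one on the other.  For \<open>\<sigma> = \<infinity>\<close> this fails, as the bases
  \<open>exp r\<close> do not become small.\<close>

lemma homeomorphic_map_every:
  assumes p: "0 < p" and \<sigma>: "1 < \<sigma>" "\<sigma> < \<infinity>"
  shows "homeomorphic_map (A_dual p (flat \<sigma>) :: 'd::finite formal_series topology)
    (weighted_entire_every (exp_weight \<sigma>)) formal_sum"
  unfolding A_dual_def weighted_entire_every_def exp_weight_every_carrier
proof (rule homeomorphic_map_projective_limits)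
  let ?E = "\<Inter>r\<in>{0<..}. weighted_space p \<sigma> r :: 'd formal_series set"
  let ?E' = "\<Inter>r\<in>{0<..}. weighted_entire (exp_weight \<sigma> r) :: (complex ^ 'd \<Rightarrow> complex) set"
  let ?k = "kappa2 \<sigma>" and ?d = "real CARD('d)"
  note k = kappa2_pos [OF \<sigma>(1)]
  have base: "flat_base \<sigma> r = r" for r using \<sigma> by (simp add: flat_base_def)
  have fwd: "\<exists>r\<in>{0<..}. continuous_map (weighted_topology p \<sigma> r :: 'd formal_series topology)
      (weighted_entire_topology (exp_weight \<sigma> r')) formal_sum" if "0 < r'" for r'
  proof -
    \<comment> \<open>The solution of d (2 r)^\<kappa> / \<kappa> = r'.\<close>
    let ?r = "(r' * ?k / ?d) powr (1 / ?k) / 2"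
    have r: "0 < ?r" using that k by simp
    have "?d * ((2 * ?r) powr ?k / ?k) = r'" using that k by (simp add: powr_powr)
    then have "continuous_map (weighted_topology p \<sigma> ?r :: 'd formal_series topology)
        (weighted_entire_topology (exp_weight \<sigma> r')) formal_sum"
      by (intro continuous_map_formal_sum_weighted p \<sigma> r) (simp add: base)
    then show ?thesis using r by blast
  qed
  have bwd: "\<exists>r'\<in>{0<..}. continuous_map (weighted_entire_topology (exp_weight \<sigma> r'))
      (weighted_topology p \<sigma> r :: 'd formal_series topology) (expansion_coeffs UNIV)" if "0 < r" for r
  proof -
    \<comment> \<open>Chosen such that the base obtained for the coefficients is r / 2.\<close>
    let ?r' = "(r / (2 * exp 1 * ?d)) powr ?k"
    have r': "0 < ?r'" using that by simp
    have "(?r' * ?d powr ?k) powr (1 / ?k) = r / (2 * exp 1)"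
      using that k by (simp add: powr_mult [symmetric] powr_powr)
    then have "exp 1 * (?r' * ?d powr ?k) powr (1 / ?k) = r / 2" by simp
    then have "continuous_map (weighted_entire_topology (exp_weight \<sigma> ?r'))
        (weighted_topology p \<sigma> r :: 'd formal_series topology) (expansion_coeffs UNIV)"
      using that by (intro continuous_map_expansion_coeffs_weighted p \<sigma> r') (auto simp: base)
    then show ?thesis using r' by blast
  qed
  have inv: "expansion_coeffs UNIV (formal_sum c) = c" if "c \<in> ?E" for c
    by (rule formal_sum_inverse_weighted [OF p \<sigma>(1) zero_less_one]) (use that in auto)
  show "bij_betw formal_sum ?E ?E'"
  proof (rule bij_betw_byWitness [where f' = "expansion_coeffs UNIV"])
    show "\<forall>c\<in>?E. expansion_coeffs UNIV (formal_sum c) = c" using inv by blast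
    have "mv_analytic_on F UNIV" if "F \<in> ?E'" for F
    proof -
      have "F \<in> weighted_entire (exp_weight \<sigma> 1)" using that by (rule INT_D) simp
      then show ?thesis by (simp add: weighted_entire_def analytic_functions_def)
    qed
    then show "\<forall>F\<in>?E'. formal_sum (expansion_coeffs UNIV F) = F"
      using formal_sum_expansion_coeffs by blast
    show "formal_sum ` ?E \<subseteq> ?E'" using fwd by (fastforce simp: continuous_map_def)
    show "expansion_coeffs UNIV ` ?E' \<subseteq> ?E" using bwd by (fastforce simp: continuous_map_def)
  qed
  show "\<exists>r\<in>{0<..}. \<exists>h. continuous_map (weighted_topology p \<sigma> r) (weighted_entire_topology (exp_weight \<sigma> r')) h \<and>
      (\<forall>c\<in>?E. h c = formal_sum c)" if "r' \<in> {0<..}" for r'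
    using fwd [of r'] that by auto
  show "\<exists>r'\<in>{0<..}. \<exists>k. continuous_map (weighted_entire_topology (exp_weight \<sigma> r')) (weighted_topology p \<sigma> r) k \<and>
      (\<forall>c\<in>?E. k (formal_sum c) = c)" if "r \<in> {0<..}" for r
    using bwd [of r] that inv by (metis greaterThan_iff)
qed auto

text \<open>Here it only matters that the constants are finite, so \<open>\<sigma> = \<infinity>\<close> is included.\<close>

lemma homeomorphic_map_some:
  assumes p: "0 < p" and \<sigma>: "1 < \<sigma>"
  shows "homeomorphic_map (A0_dual p (flat \<sigma>) :: 'd::finite formal_series topology)
    (weighted_entire_some (exp_weight \<sigma>)) formal_sum"
  unfolding A0_dual_def weighted_entire_some_def exp_weight_some_carrier
proof (rule homeomorphic_map_inductive_limits)
  let ?E = "\<Union>r\<in>{0<..}. weighted_space p \<sigma> r :: 'd formal_series set"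
  let ?E' = "\<Union>r\<in>{0<..}. weighted_entire (exp_weight \<sigma> r) :: (complex ^ 'd \<Rightarrow> complex) set"
  let ?k = "kappa2 \<sigma>" and ?d = "real CARD('d)"
  note k = kappa2_pos [OF \<sigma>]
  have fwd: "\<exists>r'\<in>{0<..}. continuous_map (weighted_topology p \<sigma> r :: 'd formal_series topology)
      (weighted_entire_topology (exp_weight \<sigma> r')) formal_sum" if r: "0 < r" for r
  proof -
    let ?r' = "?d * ((2 * flat_base \<sigma> r) powr ?k / ?k)"
    have "0 < ?r'" using flat_base_pos [OF r, of \<sigma>] k by simp
    then show ?thesis using continuous_map_formal_sum_weighted [OF p \<sigma> r order_refl] by blast
  qed
  have bwd: "\<exists>r\<in>{0<..}. continuous_map (weighted_entire_topology (exp_weight \<sigma> r'))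
      (weighted_topology p \<sigma> r :: 'd formal_series topology) (expansion_coeffs UNIV)" if r': "0 < r'" for r'
  proof -
    obtain r where r: "0 < r" "exp 1 * (r' * ?d powr ?k) powr (1 / ?k) < flat_base \<sigma> r"
      by (rule flat_base_exceeds)
    then show ?thesis using continuous_map_expansion_coeffs_weighted [OF p \<sigma> r(1) r' r(2)] by blast
  qed
  have inv: "expansion_coeffs UNIV (formal_sum c) = c" if "c \<in> ?E" for c
    using that formal_sum_inverse_weighted [OF p \<sigma>] by auto
  have inv': "formal_sum (expansion_coeffs UNIV F) = F" if "F \<in> ?E'" for F
    using that by (intro formal_sum_expansion_coeffs) (auto simp: weighted_entire_def analytic_functions_def)
  have exp: "has_expansion c (formal_sum c) z" if "c \<in> ?E" for c z
  proof -
    obtain r where r: "0 < r" "c \<in> weighted_space p \<sigma> r" using \<open>c \<in> ?E\<close> by auto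
    show ?thesis
      using growth_has_expansion(1) [OF \<sigma> _ flat_base_pos [OF r(1)]] coeff_growth_weighted_norm [OF p r] by blast
  qed
  have g: "formal_sum c \<in> ?E'" if "c \<in> ?E" for c
  proof -
    obtain r where r: "0 < r" "c \<in> weighted_space p \<sigma> r" using \<open>c \<in> ?E\<close> by auto
    from fwd [OF r(1)] r(2) show ?thesis by (auto simp: continuous_map_def)
  qed
  show "linear_between fun_add fun_scale ?E fun_add fun_scale ?E' formal_sum"
    unfolding linear_between_def
  proof (intro conjI ballI allI g)
    show "fun_add c c' \<in> ?E" if "c \<in> ?E" "c' \<in> ?E" for c c'
      using A0_dual_add_closed [OF p, of c \<sigma> c'] that by (simp only: topspace_A0_dual)
    show "fun_scale a c \<in> ?E" if "c \<in> ?E" for a c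
      using A0_dual_scale_closed [OF p, of c \<sigma> a] that by (simp only: topspace_A0_dual)
    show "formal_sum (fun_add c c') = fun_add (formal_sum c) (formal_sum c')" if "c \<in> ?E" "c' \<in> ?E" for c c'
      unfolding fun_add_def [of "formal_sum c"]
      by (rule ext, rule formal_sum_eqI, rule has_expansion_add) (rule exp, fact that)+
    show "formal_sum (fun_scale a c) = fun_scale a (formal_sum c)" if "c \<in> ?E" for a c
      unfolding fun_scale_def [of a "formal_sum c"]
      by (rule ext, rule formal_sum_eqI, rule has_expansion_scale, rule exp, fact that)
  qed
  show "bij_betw formal_sum ?E ?E'"
  proof (rule bij_betw_byWitness [where f' = "expansion_coeffs UNIV"])
    show "\<forall>c\<in>?E. expansion_coeffs UNIV (formal_sum c) = c" using inv by blast
    show "\<forall>F\<in>?E'. formal_sum (expansion_coeffs UNIV F) = F" using inv' by blast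
    show "formal_sum ` ?E \<subseteq> ?E'" using g by blast
    show "expansion_coeffs UNIV ` ?E' \<subseteq> ?E"
    proof (rule image_subsetI)
      fix F assume "F \<in> ?E'"
      then obtain r' where r': "0 < r'" "F \<in> weighted_entire (exp_weight \<sigma> r')" by auto
      from bwd [OF r'(1)] r'(2) show "expansion_coeffs UNIV F \<in> ?E" by (auto simp: continuous_map_def)
    qed
  qed
  show "\<exists>r'\<in>{0<..}. \<exists>h. continuous_map (weighted_topology p \<sigma> r) (weighted_entire_topology (exp_weight \<sigma> r')) h \<and>
      (\<forall>c\<in>topspace (weighted_topology p \<sigma> r :: 'd formal_series topology). formal_sum c = h c)" if "r \<in> {0<..}" for r
  proof -
    obtain r' where "r' \<in> {0<..}" "continuous_map (weighted_topology p \<sigma> r :: 'd formal_series topology)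
        (weighted_entire_topology (exp_weight \<sigma> r')) formal_sum"
      using fwd [of r] \<open>r \<in> {0<..}\<close> by auto
    then show ?thesis by (intro bexI [of _ r'] exI [of _ formal_sum] conjI) auto
  qed
  show "\<exists>r\<in>{0<..}. \<exists>k. continuous_map (weighted_entire_topology (exp_weight \<sigma> r')) (weighted_topology p \<sigma> r) k \<and>
      (\<forall>F\<in>topspace (weighted_entire_topology (exp_weight \<sigma> r') :: (complex ^ 'd \<Rightarrow> complex) topology). formal_sum (k F) = F)" if "r' \<in> {0<..}" for r'
  proof -
    have r': "0 < r'" using that by simp
    obtain r where r: "0 < r" "continuous_map (weighted_entire_topology (exp_weight \<sigma> r'))
        (weighted_topology p \<sigma> r :: 'd formal_series topology) (expansion_coeffs UNIV)"
      using bwd [OF r'] by auto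
    have "formal_sum (expansion_coeffs UNIV F) = F" if "F \<in> weighted_entire (exp_weight \<sigma> r')"
      for F :: "complex ^ 'd \<Rightarrow> complex"
      using inv' that r' by auto
    then show ?thesis
      using r by (intro bexI [of _ r] exI [of _ "expansion_coeffs UNIV"] conjI) auto
  qed
qed auto

theorem theorem4p2:
  fixes p :: ereal
  assumes "0 < p"
  shows
    "extends_uniquely_to_homeomorphism series_map finite_series
       (A_dual p (flat 1) :: ('d::finite) formal_series topology) entire_topology
     \<and> extends_uniquely_to_homeomorphism (\<lambda>c. germ_of (series_map c)) finite_series
       (A0_dual p (flat 1) :: 'd formal_series topology) analytic_germs_topology
     \<and> (\<forall>\<sigma>. 1 < \<sigma> \<and> \<sigma> < \<infinity> \<longrightarrow>
         extends_uniquely_to_homeomorphism series_map finite_series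
           (A_dual p (flat \<sigma>) :: 'd formal_series topology)
           (weighted_entire_every (\<lambda>r z. exp (r * norm z powr kappa2 \<sigma>))))
     \<and> (\<forall>\<sigma>. 1 < \<sigma> \<and> \<sigma> \<le> \<infinity> \<longrightarrow>
         extends_uniquely_to_homeomorphism series_map finite_series
           (A0_dual p (flat \<sigma>) :: 'd formal_series topology)
           (weighted_entire_some (\<lambda>r z. exp (r * norm z powr kappa2 \<sigma>))))"
proof (intro conjI allI impI)
  note proj = extends_uniquely_to_homeomorphismI [OF finite_series_subset_A_dual [OF assms]
      finite_series_dense_A_dual [OF assms] Hausdorff_A_dual [OF assms]]
  note ind = extends_uniquely_to_homeomorphismI [OF finite_series_subset_A0_dual [OF assms]
      finite_series_dense_A0_dual [OF assms] Hausdorff_A0_dual [OF assms]]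
  show "extends_uniquely_to_homeomorphism series_map finite_series
      (A_dual p (flat 1) :: 'd formal_series topology) entire_topology"
    by (rule proj [OF homeomorphic_map_entire [OF assms]]) (simp add: formal_sum_finite_series)
  show "extends_uniquely_to_homeomorphism (\<lambda>c. germ_of (series_map c)) finite_series
      (A0_dual p (flat 1) :: 'd formal_series topology) analytic_germs_topology"
    by (rule ind [OF homeomorphic_map_germs [OF assms]]) (simp add: formal_sum_finite_series)
  fix \<sigma> :: ereal
  show "extends_uniquely_to_homeomorphism series_map finite_series
      (A_dual p (flat \<sigma>) :: 'd formal_series topology)
      (weighted_entire_every (\<lambda>r z. exp (r * norm z powr kappa2 \<sigma>)))" if "1 < \<sigma> \<and> \<sigma> < \<infinity>"
    by (rule proj [OF homeomorphic_map_every [OF assms]]) (use that in \<open>auto simp: formal_sum_finite_series\<close>)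
  show "extends_uniquely_to_homeomorphism series_map finite_series
      (A0_dual p (flat \<sigma>) :: 'd formal_series topology)
      (weighted_entire_some (\<lambda>r z. exp (r * norm z powr kappa2 \<sigma>)))" if "1 < \<sigma> \<and> \<sigma> \<le> \<infinity>"
    by (rule ind [OF homeomorphic_map_some [OF assms]]) (use that in \<open>auto simp: formal_sum_finite_series\<close>)
qed

end
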